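(* Let $f_1$, $f_2$ and $f$ be T-functions on $D$. If the generalized semicommutator $T_{f_1}T_{f_2}-T_f$ has finite rank $N$ on $L_h^2$, then the anti-ordered generalized semicommutator $T_{f_2}T_{f_1}-T_f$ also has finite rank $N$ on $L_h^2$.
   Context: $D$ is the open unit disk in $\mathbb{C}$ and $dA$ is Lebesgue area measure on $D$ normalized so that $D$ has measure $1$. $L_h^2$ is the harmonic Bergman space: the closed subspace of $L^2(D,dA)$ consisting of (complex-valued) harmonic functions. $Q$ is the orthogonal projection of $L^2(D,dA)$ onto $L_h^2$, given by $Qf(z)=\int_D\left(\frac{1}{(1-z\bar w)^2}+\frac{1}{(1-\bar z w)^2}-1\right)f(w)\,dA(w)$; the integral formula extends $Q$ to $L^1(D,dA)$. For $u\in L^1(D,dA)$ the operator $h\mapsto Q(uh)$ is densely defined on the harmonic polynomials in $L_h^2$. $u$ is called a T-function if this operator is bounded in the $L_h^2$ norm; then the Toeplitz operator $T_u:L_h^2\to L_h^2$ is its continuous extension. A bounded operator $A$ on a Hilbert space has finite rank if the closure of its range is finite dimensional, and $\mathrm{rank}(A)=\dim \mathrm{Ran}(A)$ (rank $0$ is allowed). *)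

theory Defs
  imports "HOL-Analysis.Analysis" "HOL-Library.Function_Algebras"
begin

abbreviation unit_disk :: "complex set" where
  "unit_disk \<equiv> ball 0 1"

definition dA :: "complex measure" where
  "dA = uniform_measure (lebesgue_on unit_disk) unit_disk"

text \<open>A complex-valued function is harmonic on an open set if it is twice continuously
  differentiable there (in the real sense) and its Laplacian vanishes. The functions \<open>ux\<close>, \<open>uy\<close> are
  the first and \<open>uxx\<close>, \<open>uxy\<close>, \<open>uyx\<close>, \<open>uyy\<close> the second partial derivatives with respect to
  the real coordinates.\<close>

definition harmonic_on :: "(complex \<Rightarrow> complex) \<Rightarrow> complex set \<Rightarrow> bool" where
  "harmonic_on u S \<longleftrightarrow> (\<exists>ux uy uxx uxy uyx uyy.
     (\<forall>z\<in>S. (u has_derivative (\<lambda>h. of_real (Re h) * ux z + of_real (Im h) * uy z)) (at z)) \<and>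
     (\<forall>z\<in>S. (ux has_derivative (\<lambda>h. of_real (Re h) * uxx z + of_real (Im h) * uxy z)) (at z)) \<and>
     (\<forall>z\<in>S. (uy has_derivative (\<lambda>h. of_real (Re h) * uyx z + of_real (Im h) * uyy z)) (at z)) \<and>
     continuous_on S uxx \<and> continuous_on S uxy \<and> continuous_on S uyx \<and> continuous_on S uyy \<and>
     (\<forall>z\<in>S. uxx z + uyy z = 0))"

text \<open>Every element of the harmonic Bergman space has exactly one representative that is harmonic
  on the disk. We use that representative, extended by \<open>0\<close> outside the disk so that
  equality in the space is equality of functions.\<close>

definition Lh2 :: "(complex \<Rightarrow> complex) set" where
  "Lh2 = {h. harmonic_on h unit_disk \<and> integrable dA (\<lambda>z. (cmod (h z))\<^sup>2) \<and>
             (\<forall>z. z \<notin> unit_disk \<longrightarrow> h z = 0)}"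

definition L2_norm :: "(complex \<Rightarrow> complex) \<Rightarrow> real" where
  "L2_norm h = sqrt (\<integral>z. (cmod (h z))\<^sup>2 \<partial>dA)"

definition cscale :: "complex \<Rightarrow> (complex \<Rightarrow> complex) \<Rightarrow> complex \<Rightarrow> complex" where
  "cscale c h = (\<lambda>z. c * h z)"

interpretation cfun: vector_space cscale
  by unfold_locales (auto simp: cscale_def fun_eq_iff algebra_simps)

definition harmonic_polys :: "(complex \<Rightarrow> complex) set" where
  "harmonic_polys = {h \<in> Lh2. \<exists>p. polynomial_function p \<and> (\<forall>z\<in>unit_disk. h z = p z)}"

definition Q :: "(complex \<Rightarrow> complex) \<Rightarrow> complex \<Rightarrow> complex" where
  "Q f = (\<lambda>z. if z \<in> unit_disk
     then \<integral>w. (1 / (1 - z * cnj w)\<^sup>2 + 1 / (1 - cnj z * w)\<^sup>2 - 1) * f w \<partial>dA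
     else 0)"

definition bounded_op :: "((complex \<Rightarrow> complex) \<Rightarrow> (complex \<Rightarrow> complex)) \<Rightarrow> bool" where
  "bounded_op A \<longleftrightarrow>
     (\<forall>h\<in>Lh2. A h \<in> Lh2) \<and>
     (\<forall>g\<in>Lh2. \<forall>h\<in>Lh2. A (g + h) = A g + A h) \<and>
     (\<forall>c. \<forall>h\<in>Lh2. A (cscale c h) = cscale c (A h)) \<and>
     (\<exists>C. \<forall>h\<in>Lh2. L2_norm (A h) \<le> C * L2_norm h)"

text \<open>The membership in \<open>Lh2\<close> is part of boundedness: the integral formula alone only gives a
  harmonic function, and \<open>L2_norm\<close> is meaningful only for square-integrable ones.\<close>

definition T_function :: "(complex \<Rightarrow> complex) \<Rightarrow> bool" where
  "T_function u \<longleftrightarrow> integrable dA u \<and>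
     (\<exists>C. \<forall>h\<in>harmonic_polys.
        Q (\<lambda>w. u w * h w) \<in> Lh2 \<and> L2_norm (Q (\<lambda>w. u w * h w)) \<le> C * L2_norm h)"

text \<open>For a T-function \<open>u\<close>, the continuous extension to \<open>Lh2\<close> of the operator sending a harmonic
  polynomial \<open>h\<close> to \<open>Q (u h)\<close>. It is unique because the harmonic polynomials are dense; operators
  are normalized to be \<open>0\<close> off their domain \<open>Lh2\<close>.\<close>

definition toeplitz :: "(complex \<Rightarrow> complex) \<Rightarrow> (complex \<Rightarrow> complex) \<Rightarrow> (complex \<Rightarrow> complex)" where
  "toeplitz u = (THE T. bounded_op T \<and>
     (\<forall>h\<in>harmonic_polys. T h = Q (\<lambda>w. u w * h w)) \<and>
     (\<forall>h. h \<notin> Lh2 \<longrightarrow> T h = 0))"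

definition Lh2_closure :: "(complex \<Rightarrow> complex) set \<Rightarrow> (complex \<Rightarrow> complex) set" where
  "Lh2_closure S = {g \<in> Lh2. \<forall>e>0. \<exists>h\<in>S. L2_norm (g - h) < e}"

text \<open>\<open>cfun.dim\<close> is \<open>0\<close> on infinite-dimensional spaces, so finite dimensionality is
  required separately.\<close>

definition has_finite_rank :: "((complex \<Rightarrow> complex) \<Rightarrow> (complex \<Rightarrow> complex)) \<Rightarrow> nat \<Rightarrow> bool" where
  "has_finite_rank A N \<longleftrightarrow>
     (\<exists>B. finite B \<and> Lh2_closure (A ` Lh2) \<subseteq> cfun.span B) \<and> cfun.dim (A ` Lh2) = N"

definition gen_semicommutator ::
  "(complex \<Rightarrow> complex) \<Rightarrow> (complex \<Rightarrow> complex) \<Rightarrow> (complex \<Rightarrow> complex) \<Rightarrow>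
   (complex \<Rightarrow> complex) \<Rightarrow> (complex \<Rightarrow> complex)" where
  "gen_semicommutator f g k = (\<lambda>h. toeplitz f (toeplitz g h) - toeplitz k h)"

end

theory Submission
  imports Defs "HOL-Complex_Analysis.Complex_Analysis"
begin

text \<open>
  On \<open>Lh2\<close> consider the bilinear form that sends \<open>g\<close> and \<open>h\<close> to the integral of \<open>g * h\<close>, without
  conjugation. The kernel of \<open>Q\<close> is unchanged when its two arguments are exchanged, so for
  polynomials the form takes the same value \<open>\<integral> u p q dA\<close> at \<open>(Q (u p), q)\<close> and at \<open>(p, Q (u q))\<close>:
  every Toeplitz operator is its own transpose (\<open>toeplitz_bounded_symmetric\<close>). Transposition reverses
  products, so the transpose of \<open>T\<^bsub>f\<^esub> T\<^bsub>g\<^esub> - T\<^bsub>k\<^esub>\<close> is \<open>T\<^bsub>g\<^esub> T\<^bsub>f\<^esub> - T\<^bsub>k\<^esub>\<close>. The form is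
  nondegenerate, and an operator and its transpose have the same rank: the range of the transpose
  lies in the annihilator of the kernel of the operator, whose dimension is at most the rank
  (\<open>rank_transpose_le\<close>), and the two operators can change places. The annihilator is closed,
  which also accounts for the closure in the definition of finite rank.

  The analysis consists in making sense of \<open>toeplitz u\<close> and proving its symmetry for symbols that
  are merely integrable. Everything is expressed through the pairings with the monomials \<open>z ^ n\<close> and
  \<open>cnj z ^ n\<close>. These are orthogonal because area is invariant under rotations
  (\<open>pairing_disk_monomial\<close>). A harmonic function is the sum of a holomorphic function and the
  conjugate of one (\<open>harmonic_on_disk_iff\<close>), so it is a series in the monomials, and orthogonality
  identifies its coefficients. Expanding the kernel of \<open>Q\<close> shows that \<open>Q F\<close> is the series whose
  coefficients are the pairings of \<open>F\<close> (\<open>Q_eq_harmonic_series\<close>). Consequently \<open>Q\<close> fixes \<open>Lh2\<close> and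
  preserves pairings with monomials, which is the symmetry on polynomials.

  The partial sums of the series of \<open>h\<close> are its orthogonal projections, and with Fatou's lemma they
  converge to \<open>h\<close> in norm (\<open>harmonic_trig_polys_dense\<close>); this makes the extension of an operator from
  the harmonic polynomials unique. Its existence is obtained by prescribing the coefficients of the
  image of \<open>h\<close> as the pairings of \<open>h\<close> with the images of the monomials. Fatou's lemma shows
  that the resulting function lies in \<open>Lh2\<close> and obeys the norm bound
  (\<open>ext_toeplitz_norm_le_and_in_Lh2\<close>), and the symmetry passes to the limit.
\<close>

section \<open>The rank of a transpose\<close>

context vector_space
begin

text \<open>
  Induction on the number of functionals: the last one either vanishes on \<open>V\<close>, and can be dropped,
  or it is nonzero at some \<open>v\<close>, and then \<open>V\<close> is spanned by \<open>v\<close> together with its kernel in \<open>V\<close>.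
\<close>

lemma spanned_if_functionals_separate:
  assumes "subspace V"
    and "\<And>i x y. i < n \<Longrightarrow> x \<in> V \<Longrightarrow> y \<in> V \<Longrightarrow> \<phi> i (x + y) = \<phi> i x + \<phi> i y"
    and "\<And>i c x. i < n \<Longrightarrow> x \<in> V \<Longrightarrow> \<phi> i (scale c x) = c * \<phi> i x"
    and "\<And>x. x \<in> V \<Longrightarrow> (\<And>i. i < n \<Longrightarrow> \<phi> i x = 0) \<Longrightarrow> x = 0"
  shows "\<exists>B\<subseteq>V. finite B \<and> card B \<le> n \<and> V \<subseteq> span B"
  using assms
proof (induction n arbitrary: V)
  case 0
  then have "V \<subseteq> span {}" by auto
  then show ?case by (intro exI[of _ "{}"]) auto
next
  case (Suc n)
  define W where "W = {x \<in> V. \<phi> n x = 0}"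
  have V0: "0 \<in> V" and Vadd: "\<And>x y. x \<in> V \<Longrightarrow> y \<in> V \<Longrightarrow> x + y \<in> V"
    and Vscale: "\<And>c x. x \<in> V \<Longrightarrow> scale c x \<in> V"
    using Suc.prems(1) by (auto simp: subspace_def)
  have add: "\<phi> n (x + y) = \<phi> n x + \<phi> n y" if "x \<in> V" "y \<in> V" for x y
    using Suc.prems(2)[of n] that by simp
  have scal: "\<phi> n (scale c x) = c * \<phi> n x" if "x \<in> V" for c x
    using Suc.prems(3)[of n] that by simp
  have "\<phi> n 0 = 0"
    using scal[OF V0, of 0] by simp
  then have "subspace W"
    unfolding subspace_def W_def using V0 Vadd Vscale add scal by auto
  then have "\<exists>B\<subseteq>W. finite B \<and> card B \<le> n \<and> W \<subseteq> span B"
  proof (rule Suc.IH)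
    fix x assume x: "x \<in> W" "\<And>i. i < n \<Longrightarrow> \<phi> i x = 0"
    show "x = 0"
      using x by (intro Suc.prems(4)) (auto simp: W_def less_Suc_eq)
  qed (use Suc.prems(2,3) in \<open>auto simp: W_def\<close>)
  then obtain B where B: "B \<subseteq> W" "finite B" "card B \<le> n" "W \<subseteq> span B"
    by blast
  show ?case
  proof (cases "W = V")
    case True
    with B show ?thesis by (intro exI[of _ B]) auto
  next
    case False
    then obtain v where v: "v \<in> V" "\<phi> n v \<noteq> 0"
      by (auto simp: W_def)
    have "V \<subseteq> span (insert v B)"
    proof
      fix x assume x: "x \<in> V"
      define c where "c = \<phi> n x / \<phi> n v"
      have m: "scale (- c) v \<in> V" using v Vscale by blast
      have "\<phi> n (x + scale (- c) v) = 0"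
        unfolding add[OF x m] scal[OF v(1)] using v(2) by (simp add: c_def)
      then have "x + scale (- c) v \<in> W"
        using Vadd[OF x m] by (simp add: W_def)
      then have "x + scale (- c) v \<in> span (insert v B)"
        using B(4) span_mono[of B "insert v B"] by blast
      then have "(x + scale (- c) v) + scale c v \<in> span (insert v B)"
        by (rule span_add) (auto intro: span_scale span_base)
      then show "x \<in> span (insert v B)"
        by (simp only: scale_minus_left add.assoc left_minus add_0_right)
    qed
    moreover have "card (insert v B) \<le> Suc n"
      using B(2,3) by (simp add: card_insert_if)
    ultimately show ?thesis
      using B v by (intro exI[of _ "insert v B"]) (auto simp: W_def)
  qed
qed

text \<open>
  The transpose of \<open>A\<close> with respect to \<open>\<beta>\<close> takes its values in the annihilator of the kernel of \<open>A\<close>.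
  If vectors \<open>x i\<close> are mapped by \<open>A\<close> to a basis of its range, then they span a complement of the
  kernel, so that a vector of the annihilator is determined by its pairings with the \<open>x i\<close>; there are
  only \<open>dim (A ` V)\<close> of them. The bound is stated for the annihilator and not for the range of
  the transpose because the annihilator is closed when \<open>\<beta>\<close> is continuous.
\<close>

lemma rank_transpose_le:
  fixes \<beta> :: "'b \<Rightarrow> 'b \<Rightarrow> 'a"
  assumes V: "subspace V"
    and AV: "\<And>x. x \<in> V \<Longrightarrow> A x \<in> V"
    and A_add: "\<And>x y. x \<in> V \<Longrightarrow> y \<in> V \<Longrightarrow> A (x + y) = A x + A y"
    and A_scale: "\<And>c x. x \<in> V \<Longrightarrow> A (scale c x) = scale c (A x)"
    and \<beta>_add1: "\<And>x y z. x \<in> V \<Longrightarrow> y \<in> V \<Longrightarrow> z \<in> V \<Longrightarrow> \<beta> (x + y) z = \<beta> x z + \<beta> y z"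
    and \<beta>_scale1: "\<And>c x z. x \<in> V \<Longrightarrow> z \<in> V \<Longrightarrow> \<beta> (scale c x) z = c * \<beta> x z"
    and \<beta>_add2: "\<And>x y z. x \<in> V \<Longrightarrow> y \<in> V \<Longrightarrow> z \<in> V \<Longrightarrow> \<beta> z (x + y) = \<beta> z x + \<beta> z y"
    and \<beta>_scale2: "\<And>c x z. x \<in> V \<Longrightarrow> z \<in> V \<Longrightarrow> \<beta> z (scale c x) = c * \<beta> z x"
    and nondeg: "\<And>z. z \<in> V \<Longrightarrow> (\<And>x. x \<in> V \<Longrightarrow> \<beta> x z = 0) \<Longrightarrow> z = 0"
    and B: "finite B" "A ` V \<subseteq> span B"
  shows "\<exists>C. finite C \<and> card C \<le> dim (A ` V) \<and>
    {g \<in> V. \<forall>x\<in>V. A x = 0 \<longrightarrow> \<beta> x g = 0} \<subseteq> span C"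
proof -
  define K where "K = {x \<in> V. A x = 0}"
  define W where "W = {g \<in> V. \<forall>x\<in>K. \<beta> x g = 0}"
  have V0: "0 \<in> V" and Vadd: "\<And>x y. x \<in> V \<Longrightarrow> y \<in> V \<Longrightarrow> x + y \<in> V"
    and Vscale: "\<And>c x. x \<in> V \<Longrightarrow> scale c x \<in> V"
    using V by (auto simp: subspace_def)
  have A0: "A 0 = 0" using A_scale[OF V0, of 0] by simp
  have \<beta>0: "\<beta> z 0 = 0" "\<beta> 0 z = 0" if "z \<in> V" for z
    using \<beta>_scale2[OF V0 that, of 0] \<beta>_scale1[OF V0 that, of 0] by auto
  obtain E where E: "E \<subseteq> A ` V" "independent E" "A ` V \<subseteq> span E" "card E = dim (A ` V)"
    using basis_exists by blast
  have "E \<subseteq> span B" using E(1) B(2) by blast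
  then have finE: "finite E" and "card E \<le> card B"
    using independent_span_bound[OF B(1) E(2)] by auto
  obtain e where e: "bij_betw e {..<card E} E"
    using ex_bij_betw_nat_finite[OF finE] by (auto simp: atLeast0LessThan)
  have "\<forall>i<card E. \<exists>x\<in>V. A x = e i"
  proof (intro allI impI)
    fix i assume "i < card E"
    then have "e i \<in> A ` V" using e E(1) by (auto simp: bij_betw_def)
    then show "\<exists>x\<in>V. A x = e i" by force
  qed
  then obtain x where x: "\<And>i. i < card E \<Longrightarrow> x i \<in> V \<and> A (x i) = e i"
    by metis
  \<comment> \<open>the preimages of a basis of the range span a complement of the kernel\<close>
  have decomp: "\<exists>k\<in>K. \<exists>c. h = k + (\<Sum>i<card E. scale (c i) (x i))" if h: "h \<in> V" for h
  proof -
    have "A h \<in> span (e ` {..<card E})"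
      using E(3) h e by (auto simp: bij_betw_def)
    then obtain d where "A h = (\<Sum>y\<in>e ` {..<card E}. scale (d y) y)"
      by (auto simp: span_finite)
    also have "\<dots> = (\<Sum>i<card E. scale (d (e i)) (e i))"
      using e by (subst sum.reindex) (auto simp: bij_betw_def)
    finally have Ah: "A h = (\<Sum>i<card E. scale (d (e i)) (e i))" .
    have comb: "(\<Sum>i\<in>I. scale (c i) (x i)) \<in> V \<and>
        A (\<Sum>i\<in>I. scale (c i) (x i)) = (\<Sum>i\<in>I. scale (c i) (e i))"
      if "finite I" "I \<subseteq> {..<card E}" for I c
      using that
    proof (induction I)
      case empty
      then show ?case using V0 A0 by simp
    next
      case (insert i I)
      then show ?case
        using x[of i] Vadd Vscale A_add A_scale by auto
    qed
    define s where "s = (\<Sum>i<card E. scale (- d (e i)) (x i))"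
    have s: "s \<in> V" "A s = (\<Sum>i<card E. scale (- d (e i)) (e i))"
      unfolding s_def using comb[of "{..<card E}" "\<lambda>i. - d (e i)"] by auto
    have "A (h + s) = 0"
      using A_add[OF h s(1)] s(2) Ah by (simp add: sum_negf)
    then have "h + s \<in> K"
      using h s(1) Vadd by (simp add: K_def)
    moreover have "h = (h + s) + (\<Sum>i<card E. scale (d (e i)) (x i))"
      by (simp add: s_def sum_negf)
    ultimately show ?thesis
      by (intro bexI[of _ "h + s"] exI[of _ "\<lambda>i. d (e i)"])
  qed
  have W: "subspace W"
    unfolding subspace_def W_def using V0 Vadd Vscale \<beta>0 \<beta>_add2 \<beta>_scale2 by (auto simp: K_def)
  then have "\<exists>C\<subseteq>W. finite C \<and> card C \<le> card E \<and> W \<subseteq> span C"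
  proof (rule spanned_if_functionals_separate[where \<phi> = "\<lambda>i g. \<beta> (x i) g"])
    fix g assume g: "g \<in> W" "\<And>i. i < card E \<Longrightarrow> \<beta> (x i) g = 0"
    then have gV: "g \<in> V" by (simp add: W_def)
    show "g = 0"
    proof (rule nondeg[OF gV])
      fix h assume "h \<in> V"
      then obtain k c where k: "k \<in> K" and h: "h = k + (\<Sum>i<card E. scale (c i) (x i))"
        using decomp by blast
      have "(\<Sum>i\<in>I. scale (c i) (x i)) \<in> V \<and> \<beta> (\<Sum>i\<in>I. scale (c i) (x i)) g = 0"
        if "finite I" "I \<subseteq> {..<card E}" for I
        using that
      proof (induction I)
        case empty
        then show ?case using V0 \<beta>0 gV by simp
      next
        case (insert i I)
        then show ?case
          using x[of i] Vadd Vscale \<beta>_add1 \<beta>_scale1 g(2)[of i] gV by auto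
      qed
      from this[of "{..<card E}"] show "\<beta> h g = 0"
        using k g(1) gV \<beta>_add1 by (auto simp: h W_def K_def)
    qed
  qed (use x \<beta>_add2 \<beta>_scale2 in \<open>auto simp: W_def\<close>)
  then show ?thesis
    unfolding E(4) W_def K_def by (simp add: conj_ac Ball_def imp_conjL) blast
qed

end

section \<open>Area measure on the disk\<close>

lemma measurable_Complex_pair [measurable]:
  "(\<lambda>p. Complex (fst p) (snd p)) \<in> borel_measurable (borel \<Otimes>\<^sub>M borel)"
  unfolding Complex_eq by measurable

text \<open>
  This identification brings Tonelli's theorem to the complex plane.
\<close>

lemma lborel_complex_eq_distr_pair:
  "(lborel :: complex measure) = distr (lborel \<Otimes>\<^sub>M lborel) borel (\<lambda>p. Complex (fst p) (snd p))"
proof (rule lborel_eqI)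
  fix l u :: complex
  assume le: "\<And>b. b \<in> Basis \<Longrightarrow> l \<bullet> b \<le> u \<bullet> b"
  have ri: "Re l \<le> Re u" "Im l \<le> Im u"
    using le[of 1] le[of \<i>] by (auto simp: Basis_complex_def)
  have "(\<lambda>p. Complex (fst p) (snd p)) -` box l u \<inter> space (lborel \<Otimes>\<^sub>M lborel) =
      {Re l<..<Re u} \<times> {Im l<..<Im u}"
    by (auto simp: box_def Basis_complex_def space_pair_measure)
  then have "emeasure (distr (lborel \<Otimes>\<^sub>M lborel) borel (\<lambda>p. Complex (fst p) (snd p))) (box l u) =
      emeasure (lborel \<Otimes>\<^sub>M lborel) ({Re l<..<Re u} \<times> {Im l<..<Im u})"
    by (subst emeasure_distr) (auto simp: measurable_Complex_pair)
  also have "\<dots> = ennreal (Re u - Re l) * ennreal (Im u - Im l)"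
    using ri by (subst lborel.emeasure_pair_measure_Times) auto
  also have "\<dots> = ennreal (\<Prod>b\<in>Basis. (u - l) \<bullet> b)"
    using ri by (simp add: Basis_complex_def ennreal_mult)
  finally show "emeasure (distr (lborel \<Otimes>\<^sub>M lborel) borel (\<lambda>p. Complex (fst p) (snd p))) (box l u) =
      ennreal (\<Prod>b\<in>Basis. (u - l) \<bullet> b)" .
qed simp

lemma nn_integral_lborel_translate:
  fixes f :: "real \<Rightarrow> ennreal"
  assumes [measurable]: "f \<in> borel_measurable borel"
  shows "(\<integral>\<^sup>+x. f (x + t) \<partial>lborel) = (\<integral>\<^sup>+x. f x \<partial>lborel)"
  using nn_integral_real_affine[of f 1 t] by (simp add: add.commute)

lemma measurable_Complex1 [measurable]: "(\<lambda>x. Complex x y) \<in> borel_measurable borel"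
  and measurable_Complex2 [measurable]: "(\<lambda>y. Complex x y) \<in> borel_measurable borel"
  unfolding Complex_eq by measurable

text \<open>
  On each horizontal line a horizontal shear is a translation.
\<close>

lemma nn_integral_horizontal_shear:
  fixes f :: "complex \<Rightarrow> ennreal"
  assumes [measurable]: "f \<in> borel_measurable borel"
  shows "(\<integral>\<^sup>+z. f (z + of_real (t * Im z)) \<partial>lborel) = (\<integral>\<^sup>+z. f z \<partial>lborel)"
proof -
  have iter: "(\<integral>\<^sup>+z. g z \<partial>lborel) = (\<integral>\<^sup>+y. (\<integral>\<^sup>+x. g (Complex x y) \<partial>lborel) \<partial>lborel)"
    if [measurable]: "g \<in> borel_measurable borel" for g :: "complex \<Rightarrow> ennreal"
    by (subst lborel_complex_eq_distr_pair, subst nn_integral_distr)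
       (auto simp: lborel_pair.nn_integral_snd[symmetric] measurable_Complex_pair)
  have "Complex x y + of_real (t * y) = Complex (x + t * y) y" for x y
    by (simp add: complex_eq_iff)
  then show ?thesis
    by (subst (1 2) iter)
       (auto intro!: nn_integral_cong nn_integral_lborel_translate simp del: of_real_mult)
qed

lemma nn_integral_vertical_shear:
  fixes f :: "complex \<Rightarrow> ennreal"
  assumes [measurable]: "f \<in> borel_measurable borel"
  shows "(\<integral>\<^sup>+z. f (z + \<i> * of_real (t * Re z)) \<partial>lborel) = (\<integral>\<^sup>+z. f z \<partial>lborel)"
proof -
  have iter: "(\<integral>\<^sup>+z. g z \<partial>lborel) = (\<integral>\<^sup>+x. (\<integral>\<^sup>+y. g (Complex x y) \<partial>lborel) \<partial>lborel)"
    if [measurable]: "g \<in> borel_measurable borel" for g :: "complex \<Rightarrow> ennreal"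
    by (subst lborel_complex_eq_distr_pair, subst nn_integral_distr)
       (auto simp: lborel.nn_integral_fst[symmetric] measurable_Complex_pair)
  have "Complex x y + \<i> * of_real (t * x) = Complex x (y + t * x)" for x y
    by (simp add: complex_eq_iff)
  then show ?thesis
    by (subst (1 2) iter)
       (auto intro!: nn_integral_cong nn_integral_lborel_translate simp del: of_real_mult)
qed

text \<open>
  A rotation is a product of three shears, and shears preserve Lebesgue measure by Tonelli's theorem.
  The two horizontal shears have the slope \<open>- tan (\<theta> / 2)\<close> for the rotation by \<open>\<theta>\<close>,
  written here without trigonometric functions.
\<close>

lemma rotation_eq_three_shears:
  fixes c z :: complex
  assumes "cmod c = 1" "Im c \<noteq> 0"
  defines "H \<equiv> \<lambda>w. w + of_real ((Re c - 1) / Im c * Im w)"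
    and "V \<equiv> \<lambda>w. w + \<i> * of_real (Im c * Re w)"
  shows "H (V (H z)) = c * z"
proof -
  have sq: "Re c ^ 2 + Im c ^ 2 = 1"
    using assms(1) by (metis cmod_power2 one_power2)
  define t where "t = (Re c - 1) / Im c"
  have t1: "t * Im c = Re c - 1"
    using assms(2) by (simp add: t_def)
  have "t * (Re c + 1) = (Re c ^ 2 - 1) / Im c"
    by (simp add: t_def power2_eq_square algebra_simps diff_divide_distrib add_divide_distrib)
  also have "Re c ^ 2 - 1 = - (Im c ^ 2)"
    using sq by simp
  finally have t2: "t * (Re c + 1) = - Im c"
    using assms(2) by (simp add: power2_eq_square)
  have "Re (H (V (H z))) = Re z + t * Im z + t * Im z + t * Im c * (Re z + t * Im z)"
    by (simp add: H_def V_def t_def[symmetric] algebra_simps)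
  also have "\<dots> = Re c * Re z + (t * (Re c + 1)) * Im z"
    unfolding t1 by (simp add: algebra_simps)
  finally have re: "Re (H (V (H z))) = Re (c * z)"
    unfolding t2 by simp
  have "Im (H (V (H z))) = Im z + Im c * Re z + (t * Im c) * Im z"
    by (simp add: H_def V_def t_def[symmetric] algebra_simps)
  then have "Im (H (V (H z))) = Im (c * z)"
    unfolding t1 by (simp add: algebra_simps)
  with re show ?thesis
    by (simp add: complex_eq_iff)
qed

lemma nn_integral_rotation:
  fixes f :: "complex \<Rightarrow> ennreal"
  assumes [measurable]: "f \<in> borel_measurable borel" and "cmod c = 1" "Im c \<noteq> 0"
  shows "(\<integral>\<^sup>+z. f (c * z) \<partial>lborel) = (\<integral>\<^sup>+z. f z \<partial>lborel)"
proof -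
  define H where "H = (\<lambda>w::complex. w + of_real ((Re c - 1) / Im c * Im w))"
  define V where "V = (\<lambda>w::complex. w + \<i> * of_real (Im c * Re w))"
  have [measurable]: "H \<in> borel_measurable borel" "V \<in> borel_measurable borel"
    unfolding H_def V_def by measurable
  have h: "(\<integral>\<^sup>+z. g (H z) \<partial>lborel) = (\<integral>\<^sup>+z. g z \<partial>lborel)"
    if "g \<in> borel_measurable borel" for g :: "complex \<Rightarrow> ennreal"
    unfolding H_def by (rule nn_integral_horizontal_shear[OF that])
  have v: "(\<integral>\<^sup>+z. g (V z) \<partial>lborel) = (\<integral>\<^sup>+z. g z \<partial>lborel)"
    if "g \<in> borel_measurable borel" for g :: "complex \<Rightarrow> ennreal"
    unfolding V_def by (rule nn_integral_vertical_shear[OF that])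
  have "(\<integral>\<^sup>+z. f (c * z) \<partial>lborel) = (\<integral>\<^sup>+z. f (H (V (H z))) \<partial>lborel)"
    using rotation_eq_three_shears[OF assms(2,3)] by (simp add: H_def V_def)
  also have "\<dots> = (\<integral>\<^sup>+z. f (H (V z)) \<partial>lborel)"
    by (rule h) measurable
  also have "\<dots> = (\<integral>\<^sup>+z. f (H z) \<partial>lborel)"
    by (rule v) measurable
  also have "\<dots> = (\<integral>\<^sup>+z. f z \<partial>lborel)"
    by (rule h) measurable
  finally show ?thesis .
qed

lemma lborel_distr_rotation:
  fixes c :: complex
  assumes "cmod c = 1" "Im c \<noteq> 0"
  shows "distr lborel borel ((*) c) = lborel"
proof (rule measure_eqI)
  fix A assume "A \<in> sets (distr lborel borel ((*) c))"
  then have A[measurable]: "A \<in> sets borel" by simp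
  have "emeasure (distr lborel borel ((*) c)) A = (\<integral>\<^sup>+z. indicator A z \<partial>distr lborel borel ((*) c))"
    by simp
  also have "\<dots> = (\<integral>\<^sup>+z. indicator A (c * z) \<partial>lborel)"
    by (subst nn_integral_distr) auto
  also have "\<dots> = emeasure lborel A"
    using nn_integral_rotation[of "indicator A", OF _ assms] by simp
  finally show "emeasure (distr lborel borel ((*) c)) A = emeasure lborel A" .
qed simp

lemma space_dA [simp]: "space dA = unit_disk"
  by (simp add: dA_def space_restrict_space)

lemma sets_dA: "sets dA = sets (lebesgue_on unit_disk)"
  by (simp add: dA_def)

lemma unit_disk_measure_pos: "0 < measure lborel unit_disk"
  by (simp add: content_ball_pos)

lemma emeasure_unit_disk:
  "emeasure (lebesgue_on unit_disk) unit_disk = ennreal (measure lborel unit_disk)"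
  using emeasure_lborel_ball_finite[of "0::complex" 1]
  by (simp add: emeasure_restrict_space measure_restrict_space emeasure_eq_ennreal_measure
      top.not_eq_extremum)

lemma dA_eq_density:
  "dA = density (lebesgue_on unit_disk) (\<lambda>_. ennreal (1 / measure lborel unit_disk))"
proof -
  have "indicator unit_disk x / emeasure (lebesgue_on unit_disk) unit_disk =
      ennreal (1 / measure lborel unit_disk)" if "x \<in> unit_disk" for x
    using that unit_disk_measure_pos unfolding emeasure_unit_disk
    by (simp add: divide_ennreal[symmetric])
  then show ?thesis
    unfolding dA_def uniform_measure_def
    by (intro density_cong borel_measurable_divide_ennreal borel_measurable_indicator)
       (auto simp: space_restrict_space sets_restrict_space_iff)
qed

lemma emeasure_dA_disk [simp]: "emeasure dA unit_disk = 1"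
  using unit_disk_measure_pos unfolding dA_def
  by (subst emeasure_uniform_measure_1) (auto simp: emeasure_unit_disk)

interpretation dA: finite_measure dA
  by standard simp

lemma measure_dA_disk [simp]: "measure dA unit_disk = 1"
  by (simp add: measure_def)

lemma continuous_on_measurable_dA:
  assumes "continuous_on unit_disk f"
  shows "f \<in> borel_measurable dA"
  using continuous_imp_measurable_on_sets_lebesgue[OF assms]
  by (simp add: measurable_cong_sets[OF sets_dA refl])

lemma borel_measurable_dA:
  assumes "f \<in> borel_measurable borel"
  shows "f \<in> borel_measurable dA"
proof -
  have "f \<in> borel_measurable (lebesgue_on unit_disk)"
    using assms by (intro measurable_restrict_space1 measurable_completion) auto
  then show ?thesis
    by (simp add: measurable_cong_sets[OF sets_dA refl])
qed

lemma ball_in_borel [measurable]: "ball (a :: complex) r \<in> sets borel"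
  by simp

lemma integral_dA:
  fixes f :: "complex \<Rightarrow> complex"
  assumes [measurable]: "f \<in> borel_measurable borel"
  shows "(\<integral>z. f z \<partial>dA) =
    (1 / measure lborel unit_disk) *\<^sub>R (\<integral>z. indicator unit_disk z *\<^sub>R f z \<partial>lborel)"
proof -
  have m: "f \<in> borel_measurable (lebesgue_on unit_disk)"
    using assms by (intro measurable_restrict_space1 measurable_completion) auto
  have "(\<integral>z. f z \<partial>dA) = (\<integral>z. (1 / measure lborel unit_disk) *\<^sub>R f z \<partial>lebesgue_on unit_disk)"
    unfolding dA_eq_density using m unit_disk_measure_pos by (subst integral_density) auto
  also have "\<dots> = (1 / measure lborel unit_disk) *\<^sub>R (\<integral>z. f z \<partial>lebesgue_on unit_disk)"
    by simp
  also have "(\<integral>z. f z \<partial>lebesgue_on unit_disk) = (\<integral>z. indicator unit_disk z *\<^sub>R f z \<partial>lebesgue)"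
    by (subst integral_restrict_space) auto
  also have "\<dots> = (\<integral>z. indicator unit_disk z *\<^sub>R f z \<partial>lborel)"
    by (subst integral_completion) (auto intro!: borel_measurable_scaleR borel_measurable_indicator)
  finally show ?thesis .
qed

lemma integral_dA_rotation:
  fixes f :: "complex \<Rightarrow> complex"
  assumes [measurable]: "f \<in> borel_measurable borel" and c: "cmod c = 1" "Im c \<noteq> 0"
  shows "(\<integral>z. f (c * z) \<partial>dA) = (\<integral>z. f z \<partial>dA)"
proof -
  have "(\<integral>z. indicator unit_disk z *\<^sub>R f z \<partial>lborel) =
      (\<integral>z. indicator unit_disk z *\<^sub>R f z \<partial>distr lborel borel ((*) c))"
    by (simp add: lborel_distr_rotation[OF c])
  also have "\<dots> = (\<integral>z. indicator unit_disk (c * z) *\<^sub>R f (c * z) \<partial>lborel)"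
    by (rule integral_distr) measurable
  also have "\<dots> = (\<integral>z. indicator unit_disk z *\<^sub>R f (c * z) \<partial>lborel)"
    by (intro Bochner_Integration.integral_cong) (auto simp: indicator_def norm_mult c)
  finally show ?thesis
    by (simp add: integral_dA)
qed

lemma integral_dA_scaling:
  fixes f :: "complex \<Rightarrow> complex"
  assumes [measurable]: "f \<in> borel_measurable borel" and r: "0 < r" "r \<le> 1"
  shows "(\<integral>z. indicator (ball 0 r) z *\<^sub>R f z \<partial>dA) = of_real (r\<^sup>2) * (\<integral>z. f (of_real r * z) \<partial>dA)"
proof -
  have ball: "of_real r * z \<in> ball 0 r \<longleftrightarrow> z \<in> unit_disk" for z :: complex
    using r by (simp add: norm_mult)
  have "(\<integral>z. indicator unit_disk z *\<^sub>R (indicator (ball 0 r) z *\<^sub>R f z) \<partial>lborel) =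
      (\<integral>z. indicator (ball 0 r) z *\<^sub>R f z \<partial>lborel)"
    using r by (intro Bochner_Integration.integral_cong) (auto simp: indicator_def)
  also have "\<dots> = (\<integral>z. indicator (ball 0 r) z *\<^sub>R f z
      \<partial>density (distr lborel borel (\<lambda>z. 0 + r *\<^sub>R z)) (\<lambda>_. ennreal (\<bar>r\<bar> ^ DIM(complex))))"
    using r lborel_affine[of r "0 :: complex"] by simp
  also have "\<dots> = of_real (r\<^sup>2) * (\<integral>z. indicator (ball 0 r) (of_real r * z) *\<^sub>R f (of_real r * z) \<partial>lborel)"
    using r by (simp add: integral_density integral_distr scaleR_conv_of_real)
  also have "\<dots> = of_real (r\<^sup>2) * (\<integral>z. indicator unit_disk z *\<^sub>R f (of_real r * z) \<partial>lborel)"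
    unfolding indicator_def using ball by simp
  finally show ?thesis
    by (simp add: integral_dA scaleR_conv_of_real)
qed

section \<open>Harmonic functions on the disk\<close>

text \<open>
  Two applications of the mean value theorem, first in the direction \<open>a\<close> and then in the direction
  \<open>b\<close>, express the second difference over a small parallelogram by the mixed derivative at one of
  its points. Exchanging the directions leaves the second difference unchanged; this is why mixed
  partial derivatives agree.
\<close>

lemma real_mixed_difference:
  fixes v vx vxy :: "complex \<Rightarrow> real"
  assumes vx: "\<And>z. z \<in> S \<Longrightarrow> ((\<lambda>t. v (z + a * of_real t)) has_real_derivative vx z) (at 0)"
    and vxy: "\<And>z. z \<in> S \<Longrightarrow> ((\<lambda>t. vx (z + b * of_real t)) has_real_derivative vxy z) (at 0)"
    and t: "0 < t"
    and sub: "\<And>p q. \<lbrakk>0 \<le> p; p \<le> t; 0 \<le> q; q \<le> t\<rbrakk> \<Longrightarrow> z + a * of_real p + b * of_real q \<in> S"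
  shows "\<exists>p q. 0 \<le> p \<and> p \<le> t \<and> 0 \<le> q \<and> q \<le> t \<and>
    v (z + a * of_real t + b * of_real t) - v (z + a * of_real t) - v (z + b * of_real t) + v z =
    t\<^sup>2 * vxy (z + a * of_real p + b * of_real q)"
proof -
  have line: "((\<lambda>s. f (y + c * of_real s)) has_real_derivative f' (y + c * of_real s0)) (at s0)"
    if "\<And>z. z \<in> S \<Longrightarrow> ((\<lambda>t. f (z + c * of_real t)) has_real_derivative f' z) (at 0)"
      and "y + c * of_real s0 \<in> S" for f f' :: "complex \<Rightarrow> real" and y c :: complex and s0 :: real
  proof -
    have "((\<lambda>s. f (y + c * of_real s0 + c * of_real s)) has_real_derivative f' (y + c * of_real s0))
        (at (s0 - s0))"
      using that by simp
    moreover have "((\<lambda>s. s - s0) has_real_derivative 1) (at s0)"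
      by (auto intro!: derivative_eq_intros)
    ultimately have "((\<lambda>s. f (y + c * of_real s0 + c * of_real (s - s0))) has_real_derivative
        f' (y + c * of_real s0) * 1) (at s0)"
      by (rule DERIV_chain2[where f = "\<lambda>s. f (y + c * of_real s0 + c * of_real s)"])
    then show ?thesis
      by (simp add: algebra_simps)
  qed
  (* The difference of v in direction b, as a function of the position along a. *)
  define \<phi> where "\<phi> = (\<lambda>s. v (z + b * of_real t + a * of_real s) - v (z + a * of_real s))"
  have "\<exists>p. 0 < p \<and> p < t \<and> \<phi> t - \<phi> 0 =
      (t - 0) * (vx (z + b * of_real t + a * of_real p) - vx (z + a * of_real p))"
    using t
  proof (rule MVT2)
    fix s assume s: "0 \<le> s" "s \<le> t"
    show "(\<phi> has_real_derivative
        (vx (z + b * of_real t + a * of_real s) - vx (z + a * of_real s))) (at s)"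
      unfolding \<phi>_def
      using sub[of s t] sub[of s 0] s t
      by (intro DERIV_diff line[OF vx]) (auto simp: algebra_simps)
  qed
  then obtain p where p: "0 < p" "p < t" and
    ep: "\<phi> t - \<phi> 0 = t * (vx (z + b * of_real t + a * of_real p) - vx (z + a * of_real p))"
    by auto
  define \<psi> where "\<psi> = (\<lambda>s. vx (z + a * of_real p + b * of_real s))"
  have "\<exists>q. 0 < q \<and> q < t \<and> \<psi> t - \<psi> 0 = (t - 0) * vxy (z + a * of_real p + b * of_real q)"
    using t
  proof (rule MVT2)
    fix s assume s: "0 \<le> s" "s \<le> t"
    show "(\<psi> has_real_derivative vxy (z + a * of_real p + b * of_real s)) (at s)"
      unfolding \<psi>_def using sub[of p s] s p by (intro line[OF vxy]) auto
  qed
  then obtain q where q: "0 < q" "q < t" "\<psi> t - \<psi> 0 = t * vxy (z + a * of_real p + b * of_real q)"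
    by auto
  have "v (z + a * of_real t + b * of_real t) - v (z + a * of_real t) - v (z + b * of_real t) + v z
      = \<phi> t - \<phi> 0"
    by (simp add: \<phi>_def algebra_simps)
  also have "\<dots> = t * (\<psi> t - \<psi> 0)"
    by (simp add: ep \<psi>_def algebra_simps)
  finally show ?thesis
    using p q by (intro exI[of _ p] exI[of _ q]) (auto simp: power2_eq_square)
qed

lemma real_mixed_partials_eq:
  fixes v vx vy vxy vyx :: "complex \<Rightarrow> real"
  assumes "open S" and z: "z \<in> S"
    and vx: "\<And>z. z \<in> S \<Longrightarrow> ((\<lambda>t. v (z + 1 * of_real t)) has_real_derivative vx z) (at 0)"
    and vy: "\<And>z. z \<in> S \<Longrightarrow> ((\<lambda>t. v (z + \<i> * of_real t)) has_real_derivative vy z) (at 0)"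
    and vxy: "\<And>z. z \<in> S \<Longrightarrow> ((\<lambda>t. vx (z + \<i> * of_real t)) has_real_derivative vxy z) (at 0)"
    and vyx: "\<And>z. z \<in> S \<Longrightarrow> ((\<lambda>t. vy (z + 1 * of_real t)) has_real_derivative vyx z) (at 0)"
    and cont: "continuous_on S vxy" "continuous_on S vyx"
  shows "vxy z = vyx z"
proof (rule ccontr)
  assume ne: "vxy z \<noteq> vyx z"
  define e where "e = \<bar>vxy z - vyx z\<bar> / 2"
  have e: "0 < e" using ne by (simp add: e_def)
  obtain d0 where d0: "0 < d0" "ball z d0 \<subseteq> S"
    using \<open>open S\<close> z by (meson open_contains_ball)
  obtain d1 where d1: "0 < d1" "\<And>w. w \<in> S \<Longrightarrow> dist w z < d1 \<Longrightarrow> dist (vxy w) (vxy z) < e"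
    using cont(1) z e unfolding continuous_on_iff by metis
  obtain d2 where d2: "0 < d2" "\<And>w. w \<in> S \<Longrightarrow> dist w z < d2 \<Longrightarrow> dist (vyx w) (vyx z) < e"
    using cont(2) z e unfolding continuous_on_iff by metis
  (* The parallelogram has diameter at most 2 * t, so it lies within all three radii. *)
  define t where "t = Min {d0, d1, d2} / 4"
  have t: "0 < t" "2 * t < d0" "2 * t < d1" "2 * t < d2"
    using d0(1) d1(1) d2(1) by (auto simp: t_def min_def)
  have near: "dist (z + of_real p + \<i> * of_real q) z \<le> 2 * t"
    if "0 \<le> p" "p \<le> t" "0 \<le> q" "q \<le> t" for p q
  proof -
    have "norm (of_real p + \<i> * of_real q :: complex) \<le> p + q"
      using norm_triangle_ineq[of "of_real p" "\<i> * of_real q :: complex"] that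
      by (simp add: norm_mult)
    then show ?thesis
      using that by (simp add: dist_norm add.assoc)
  qed
  have inS: "z + of_real p + \<i> * of_real q \<in> S"
    if "0 \<le> p" "p \<le> t" "0 \<le> q" "q \<le> t" for p q
    using near[OF that] t d0 by (auto simp: dist_commute)
  have inS': "z + \<i> * of_real q + of_real p \<in> S"
    if "0 \<le> q" "q \<le> t" "0 \<le> p" "p \<le> t" for p q
    using inS[of p q] that by (simp add: algebra_simps)
  define \<Delta> where
    "\<Delta> = v (z + of_real t + \<i> * of_real t) - v (z + of_real t) - v (z + \<i> * of_real t) + v z"
  obtain p q where pq: "0 \<le> p" "p \<le> t" "0 \<le> q" "q \<le> t"
      "\<Delta> = t\<^sup>2 * vxy (z + of_real p + \<i> * of_real q)"
    using real_mixed_difference[of S v 1 vx \<i> vxy t z, OF vx vxy t(1)] inS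
    by (auto simp: \<Delta>_def)
  obtain q' p' where pq': "0 \<le> p'" "p' \<le> t" "0 \<le> q'" "q' \<le> t"
      "\<Delta> = t\<^sup>2 * vyx (z + of_real p' + \<i> * of_real q')"
    using real_mixed_difference[of S v \<i> vy 1 vyx t z, OF vy vyx t(1)] inS'
    by (auto simp: \<Delta>_def algebra_simps)
  have "vxy (z + of_real p + \<i> * of_real q) = vyx (z + of_real p' + \<i> * of_real q')"
    using pq(5) pq'(5) t(1) by simp
  moreover have "\<bar>vxy (z + of_real p + \<i> * of_real q) - vxy z\<bar> < e"
    using near[of p q] pq t d1(2)[OF inS[of p q]] by (simp add: dist_real_def)
  moreover have "\<bar>vyx (z + of_real p' + \<i> * of_real q') - vyx z\<bar> < e"
    using near[of p' q'] pq' t d2(2)[OF inS[of p' q']] by (simp add: dist_real_def)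
  ultimately have "\<bar>vxy z - vyx z\<bar> < 2 * e"
    by linarith
  then show False
    by (simp add: e_def)
qed

text \<open>
  The mean value theorem is about real functions, so the claim is reduced to the real and imaginary parts.
\<close>

lemma mixed_partials_eq:
  fixes u ux uy uxx uxy uyx uyy :: "complex \<Rightarrow> complex"
  assumes "open S" and z: "z \<in> S"
    and u: "\<And>z. z \<in> S \<Longrightarrow>
      (u has_derivative (\<lambda>h. of_real (Re h) * ux z + of_real (Im h) * uy z)) (at z)"
    and ux: "\<And>z. z \<in> S \<Longrightarrow>
      (ux has_derivative (\<lambda>h. of_real (Re h) * uxx z + of_real (Im h) * uxy z)) (at z)"
    and uy: "\<And>z. z \<in> S \<Longrightarrow>
      (uy has_derivative (\<lambda>h. of_real (Re h) * uyx z + of_real (Im h) * uyy z)) (at z)"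
    and cont: "continuous_on S uxy" "continuous_on S uyx"
  shows "uxy z = uyx z"
proof -
  have dir: "((\<lambda>t. l (f (z + c * of_real t))) has_real_derivative
      l (of_real (Re c) * fx + of_real (Im c) * fy)) (at 0)"
    if f: "(f has_derivative (\<lambda>h. of_real (Re h) * fx + of_real (Im h) * fy)) (at z)"
      and l: "bounded_linear l"
    for f :: "complex \<Rightarrow> complex" and l :: "complex \<Rightarrow> real" and z c fx fy
  proof -
    interpret l: bounded_linear l by (rule l)
    have "((\<lambda>t. z + c * of_real t) has_derivative (\<lambda>t. c * of_real t)) (at (0::real))"
      by (intro derivative_eq_intros) auto
    moreover have "(f has_derivative (\<lambda>h. of_real (Re h) * fx + of_real (Im h) * fy))
        (at (z + c * of_real 0))"
      using f by simp
    ultimately have "((\<lambda>t. f (z + c * of_real t)) has_derivative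
        (\<lambda>t. of_real (Re (c * of_real t)) * fx + of_real (Im (c * of_real t)) * fy)) (at 0)"
      by (rule has_derivative_compose)
    then have d: "((\<lambda>t. l (f (z + c * of_real t))) has_derivative
        (\<lambda>t. l (of_real (Re (c * of_real t)) * fx + of_real (Im (c * of_real t)) * fy))) (at 0)"
      by (rule l.has_derivative)
    have e: "l (of_real (Re (c * of_real t)) * fx + of_real (Im (c * of_real t)) * fy) =
        l (of_real (Re c) * fx + of_real (Im c) * fy) * t" for t
    proof -
      have "of_real (Re (c * of_real t)) * fx + of_real (Im (c * of_real t)) * fy =
          t *\<^sub>R (of_real (Re c) * fx + of_real (Im c) * fy)"
        by (simp add: scaleR_conv_of_real algebra_simps)
      then show ?thesis by (simp add: l.scaleR)
    qed
    show ?thesis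
      unfolding has_field_derivative_def by (rule has_derivative_eq_rhs[OF d]) (rule ext, rule e)
  qed
  have eq: "l (uxy z) = l (uyx z)" if l: "bounded_linear l" for l :: "complex \<Rightarrow> real"
  proof (rule real_mixed_partials_eq[of S z "\<lambda>z. l (u z)" "\<lambda>z. l (ux z)" "\<lambda>z. l (uy z)"
        "\<lambda>z. l (uxy z)" "\<lambda>z. l (uyx z)"])
    show "continuous_on S (\<lambda>z. l (uxy z))"
      by (rule bounded_linear.continuous_on[OF l cont(1)])
    show "continuous_on S (\<lambda>z. l (uyx z))"
      by (rule bounded_linear.continuous_on[OF l cont(2)])
    fix z assume z: "z \<in> S"
    show "((\<lambda>t. l (u (z + 1 * of_real t))) has_real_derivative l (ux z)) (at 0)"
      using dir[OF u[OF z] l, of 1] by simp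
    show "((\<lambda>t. l (u (z + \<i> * of_real t))) has_real_derivative l (uy z)) (at 0)"
      using dir[OF u[OF z] l, of \<i>] by simp
    show "((\<lambda>t. l (ux (z + \<i> * of_real t))) has_real_derivative l (uxy z)) (at 0)"
      using dir[OF ux[OF z] l, of \<i>] by simp
    show "((\<lambda>t. l (uy (z + 1 * of_real t))) has_real_derivative l (uyx z)) (at 0)"
      using dir[OF uy[OF z] l, of 1] by simp
  qed (use assms(1) z in auto)
  show ?thesis
    using eq[OF bounded_linear_Re] eq[OF bounded_linear_Im] by (simp add: complex_eq_iff)
qed

text \<open>
  For harmonic \<open>u\<close> the functions \<open>F = (u\<^sub>x - \<i> u\<^sub>y) / 2\<close> and \<open>G = cnj (u\<^sub>x + \<i> u\<^sub>y) / 2\<close> satisfy the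
  Cauchy-Riemann equations, by \<open>\<Delta>u = 0\<close> and the equality of the mixed derivatives. On a disk they
  have primitives \<open>P\<close> and \<open>R\<close>, and \<open>P + cnj R\<close> has the same derivative as \<open>u\<close>. This reduces
  harmonic functions to power series.
\<close>

lemma harmonic_on_disk_iff:
  "harmonic_on u unit_disk \<longleftrightarrow>
    (\<exists>P R. P holomorphic_on unit_disk \<and> R holomorphic_on unit_disk \<and>
      (\<forall>z\<in>unit_disk. u z = P z + cnj (R z)))"
proof
  assume "harmonic_on u unit_disk"
  then obtain ux uy uxx uxy uyx uyy where
    u: "\<And>z. z \<in> unit_disk \<Longrightarrow>
      (u has_derivative (\<lambda>h. of_real (Re h) * ux z + of_real (Im h) * uy z)) (at z)"
    and ux: "\<And>z. z \<in> unit_disk \<Longrightarrow>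
      (ux has_derivative (\<lambda>h. of_real (Re h) * uxx z + of_real (Im h) * uxy z)) (at z)"
    and uy: "\<And>z. z \<in> unit_disk \<Longrightarrow>
      (uy has_derivative (\<lambda>h. of_real (Re h) * uyx z + of_real (Im h) * uyy z)) (at z)"
    and cont: "continuous_on unit_disk uxy" "continuous_on unit_disk uyx"
    and lap: "\<And>z. z \<in> unit_disk \<Longrightarrow> uxx z + uyy z = 0"
    unfolding harmonic_on_def by blast
  have mixed: "uxy z = uyx z" if "z \<in> unit_disk" for z
    by (rule mixed_partials_eq[OF _ that u ux uy cont]) auto
  have lap': "uyy z = - uxx z" if "z \<in> unit_disk" for z
    using lap[OF that] by (simp add: add_eq_0_iff)
  define F where "F = (\<lambda>z. 1 / 2 * (ux z - \<i> * uy z))"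
  define G where "G = (\<lambda>z. 1 / 2 * (cnj (ux z) - \<i> * cnj (uy z)))"
  have dF: "(F has_field_derivative 1 / 2 * (uxx z - \<i> * uxy z)) (at z)" if "z \<in> unit_disk" for z
    unfolding F_def has_field_derivative_def
  proof (rule has_derivative_eq_rhs)
    show "((\<lambda>z. 1 / 2 * (ux z - \<i> * uy z)) has_derivative
        (\<lambda>h. 1 / 2 * (of_real (Re h) * uxx z + of_real (Im h) * uxy z
        - \<i> * (of_real (Re h) * uyx z + of_real (Im h) * uyy z)))) (at z)"
      by (intro has_derivative_mult_right has_derivative_diff ux[OF that] uy[OF that])
  qed (simp add: fun_eq_iff complex_eq_iff mixed[OF that] lap'[OF that] field_simps)
  have dG: "(G has_field_derivative 1 / 2 * (cnj (uxx z) - \<i> * cnj (uxy z))) (at z)"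
    if "z \<in> unit_disk" for z
    unfolding G_def has_field_derivative_def
  proof (rule has_derivative_eq_rhs)
    show "((\<lambda>z. 1 / 2 * (cnj (ux z) - \<i> * cnj (uy z))) has_derivative
        (\<lambda>h. 1 / 2 * (cnj (of_real (Re h) * uxx z + of_real (Im h) * uxy z)
        - \<i> * cnj (of_real (Re h) * uyx z + of_real (Im h) * uyy z)))) (at z)"
      by (intro has_derivative_mult_right has_derivative_diff has_derivative_cnj ux[OF that] uy[OF that])
  qed (simp add: fun_eq_iff complex_eq_iff mixed[OF that] lap'[OF that] field_simps)
  have "F holomorphic_on unit_disk" "G holomorphic_on unit_disk"
    unfolding holomorphic_on_open[OF open_ball] using dF dG by blast+
  then obtain P R where
    P: "\<And>z. z \<in> unit_disk \<Longrightarrow> (P has_field_derivative F z) (at z within unit_disk)" and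
    R: "\<And>z. z \<in> unit_disk \<Longrightarrow> (R has_field_derivative G z) (at z within unit_disk)"
    using holomorphic_convex_primitive'[OF convex_ball open_ball, of F]
      holomorphic_convex_primitive'[OF convex_ball open_ball, of G] by metis
  have "\<exists>c. \<forall>z\<in>unit_disk. u z - P z - cnj (R z) = c"
  proof (rule has_derivative_zero_constant)
    fix z assume z: "z \<in> unit_disk"
    have "((\<lambda>z. u z - P z - cnj (R z)) has_derivative
        (\<lambda>h. of_real (Re h) * ux z + of_real (Im h) * uy z - F z * h - cnj (G z * h)))
        (at z within unit_disk)"
      using P[OF z] R[OF z] unfolding has_field_derivative_def
      by (intro has_derivative_diff has_derivative_cnj has_derivative_at_withinI[OF u[OF z]])
    moreover have "of_real (Re h) * ux z + of_real (Im h) * uy z - F z * h - cnj (G z * h) = 0" for h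
      by (simp add: F_def G_def complex_eq_iff field_simps)
    ultimately show "((\<lambda>z. u z - P z - cnj (R z)) has_derivative (\<lambda>h. 0)) (at z within unit_disk)"
      by simp
  qed auto
  then obtain c where c: "\<And>z. z \<in> unit_disk \<Longrightarrow> u z - P z - cnj (R z) = c"
    by blast
  have "u z = (P z + c) + cnj (R z)" if "z \<in> unit_disk" for z
    using c[OF that] by (simp add: algebra_simps)
  moreover have "P holomorphic_on unit_disk" "R holomorphic_on unit_disk"
    unfolding holomorphic_on_def field_differentiable_def using P R by blast+
  ultimately show "\<exists>P R. P holomorphic_on unit_disk \<and> R holomorphic_on unit_disk \<and>
      (\<forall>z\<in>unit_disk. u z = P z + cnj (R z))"
    by (intro exI[of _ "\<lambda>z. P z + c"] exI[of _ R]) (auto intro!: holomorphic_intros)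
next
  assume "\<exists>P R. P holomorphic_on unit_disk \<and> R holomorphic_on unit_disk \<and>
      (\<forall>z\<in>unit_disk. u z = P z + cnj (R z))"
  then obtain P R where P: "P holomorphic_on unit_disk" and R: "R holomorphic_on unit_disk"
    and u: "\<And>z. z \<in> unit_disk \<Longrightarrow> u z = P z + cnj (R z)"
    by blast
  have hol: "deriv P holomorphic_on unit_disk" "deriv R holomorphic_on unit_disk"
    "deriv (deriv P) holomorphic_on unit_disk" "deriv (deriv R) holomorphic_on unit_disk"
    using P R by (auto intro!: holomorphic_deriv)
  have d: "((\<lambda>z. f z + cnj (g z)) has_derivative
       (\<lambda>h. of_real (Re h) * (deriv f z + cnj (deriv g z)) +
            of_real (Im h) * (\<i> * deriv f z + cnj (\<i> * deriv g z)))) (at z)"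
    if "f holomorphic_on unit_disk" "g holomorphic_on unit_disk" "z \<in> unit_disk" for f g z
  proof -
    have "(f has_derivative (*) (deriv f z)) (at z)" "(g has_derivative (*) (deriv g z)) (at z)"
      using that holomorphic_derivI[of _ unit_disk z UNIV] by (auto simp: has_field_derivative_def)
    then have "((\<lambda>z. f z + cnj (g z)) has_derivative
        (\<lambda>h. deriv f z * h + cnj (deriv g z * h))) (at z)"
      by (intro has_derivative_add has_derivative_cnj)
    moreover have "deriv f z * h + cnj (deriv g z * h) =
        of_real (Re h) * (deriv f z + cnj (deriv g z)) +
            of_real (Im h) * (\<i> * deriv f z + cnj (\<i> * deriv g z))" for h
      by (simp add: complex_eq_iff algebra_simps)
    ultimately show ?thesis by simp
  qed
  have d2: "((\<lambda>z. \<i> * f z + cnj (\<i> * g z)) has_derivative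
       (\<lambda>h. of_real (Re h) * (\<i> * deriv f z + cnj (\<i> * deriv g z)) +
            of_real (Im h) * (- deriv f z - cnj (deriv g z)))) (at z)"
    if "f holomorphic_on unit_disk" "g holomorphic_on unit_disk" "z \<in> unit_disk" for f g z
  proof -
    have "f field_differentiable at z" "g field_differentiable at z"
      using that by (auto intro: holomorphic_on_imp_differentiable_at)
    then have "deriv (\<lambda>z. \<i> * f z) z = \<i> * deriv f z" "deriv (\<lambda>z. \<i> * g z) z = \<i> * deriv g z"
      by (auto intro: deriv_cmult)
    then show ?thesis
      using d[of "\<lambda>z. \<i> * f z" "\<lambda>z. \<i> * g z" z] that
      by (simp add: holomorphic_intros algebra_simps)
  qed
  have du: "(u has_derivative D) (at z)"
    if "((\<lambda>z. P z + cnj (R z)) has_derivative D) (at z)" "z \<in> unit_disk" for D z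
    by (rule has_derivative_transform_within_open[OF that(1) open_ball that(2)]) (simp add: u)
  have cont: "continuous_on unit_disk (deriv (deriv P))" "continuous_on unit_disk (deriv (deriv R))"
    using hol by (auto intro: holomorphic_on_imp_continuous_on)
  show "harmonic_on u unit_disk"
    unfolding harmonic_on_def
  proof (intro exI conjI ballI)
    fix z assume z: "z \<in> unit_disk"
    show "(u has_derivative (\<lambda>h. of_real (Re h) * (deriv P z + cnj (deriv R z)) +
        of_real (Im h) * (\<i> * deriv P z + cnj (\<i> * deriv R z)))) (at z)"
      by (rule du[OF d[OF P R z] z])
    show "((\<lambda>z. deriv P z + cnj (deriv R z)) has_derivative
        (\<lambda>h. of_real (Re h) * (deriv (deriv P) z + cnj (deriv (deriv R) z)) +
        of_real (Im h) * (\<i> * deriv (deriv P) z + cnj (\<i> * deriv (deriv R) z)))) (at z)"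
      by (rule d[OF hol(1,2) z])
    show "((\<lambda>z. \<i> * deriv P z + cnj (\<i> * deriv R z)) has_derivative
        (\<lambda>h. of_real (Re h) * (\<i> * deriv (deriv P) z + cnj (\<i> * deriv (deriv R) z)) +
        of_real (Im h) * (- deriv (deriv P) z - cnj (deriv (deriv R) z)))) (at z)"
      by (rule d2[OF hol(1,2) z])
  qed (auto intro!: continuous_intros cont simp del: complex_cnj_mult)
qed

section \<open>Monomials and their pairing\<close>

text \<open>
  Both families \<open>z ^ n\<close> and \<open>cnj z ^ n\<close> are indexed by one integer. Conjugation is then
  \<open>k \<mapsto> - k\<close>, a rotation by \<open>c\<close> multiplies by \<open>c powi k\<close>, and the constants, which belong to both
  families, are counted once. The value \<open>0\<close> off the disk makes these functions elements of \<open>Lh2\<close>.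
\<close>

definition disk_monomial :: "int \<Rightarrow> complex \<Rightarrow> complex" where
  "disk_monomial k z =
    (if z \<in> unit_disk then if 0 \<le> k then z ^ nat k else cnj z ^ nat (- k) else 0)"

text \<open>
  There is no conjugation: this is the bilinear form for which Toeplitz operators are symmetric.
\<close>

definition pairing :: "(complex \<Rightarrow> complex) \<Rightarrow> (complex \<Rightarrow> complex) \<Rightarrow> complex" where
  "pairing f g = (\<integral>z. f z * g z \<partial>dA)"

lemma disk_monomial_outside: "z \<notin> unit_disk \<Longrightarrow> disk_monomial k z = 0"
  by (simp add: disk_monomial_def)

lemma cnj_disk_monomial: "cnj (disk_monomial k z) = disk_monomial (- k) z"
  by (simp add: disk_monomial_def)

lemma norm_disk_monomial:
  "z \<in> unit_disk \<Longrightarrow> cmod (disk_monomial k z) = cmod z ^ nat \<bar>k\<bar>"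
  by (simp add: disk_monomial_def norm_power)

lemma norm_disk_monomial_le_1: "cmod (disk_monomial k z) \<le> 1"
  by (cases "z \<in> unit_disk")
     (simp_all add: norm_disk_monomial disk_monomial_outside power_le_one)

lemma borel_measurable_disk_monomial [measurable]: "disk_monomial k \<in> borel_measurable borel"
proof -
  have "disk_monomial k = (\<lambda>z. indicator unit_disk z *
      (if 0 \<le> k then z ^ nat k else cnj z ^ nat (- k)))"
    by (auto simp: disk_monomial_def fun_eq_iff)
  also have "\<dots> \<in> borel_measurable borel"
    by (cases "0 \<le> k")
       (auto intro!: borel_measurable_times[OF borel_measurable_indicator borel_measurable_continuous_onI]
          continuous_intros)
  finally show ?thesis .
qed

lemma disk_monomial_measurable_dA [measurable]: "disk_monomial k \<in> borel_measurable dA"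
  by (intro borel_measurable_dA borel_measurable_disk_monomial)

lemma disk_monomial_rotate:
  assumes "cmod c = 1"
  shows "disk_monomial k (c * z) = c powi k * disk_monomial k z"
proof -
  have "cnj c = inverse c"
    using assms complex_norm_square[of c] by (intro inverse_unique[symmetric]) simp
  then show ?thesis
    using assms by (auto simp: disk_monomial_def power_int_def norm_mult power_mult_distrib)
qed

lemma disk_monomial_scale:
  assumes "z \<in> unit_disk" "0 < r" "r \<le> 1"
  shows "disk_monomial k (of_real r * z) = of_real (r ^ nat \<bar>k\<bar>) * disk_monomial k z"
proof -
  have "r * cmod z < 1"
    using assms mult_le_one[of r "cmod z"] mult_left_le_one_le[of "cmod z" r] by force
  then show ?thesis
    using assms by (auto simp: disk_monomial_def norm_mult power_mult_distrib)
qed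

text \<open>
  Let \<open>m\<close> be the integral. By scaling, the ring between the radii \<open>r\<close> and \<open>1\<close> carries
  \<open>m * (1 - r ^ (2 * n + 2))\<close>, and the ring has area \<open>1 - r\<^sup>2\<close>. On it the integrand lies between
  \<open>r ^ (2 * n)\<close> and \<open>1\<close>. Dividing by \<open>1 - r\<^sup>2\<close> and letting \<open>r\<close> tend to \<open>1\<close> leaves
  \<open>m * (n + 1) = 1\<close>.
\<close>

lemma integral_norm_power_dA: "(\<integral>z. cmod z ^ (2 * n) \<partial>dA) = 1 / (real n + 1)"
proof -
  define m where "m = (\<lambda>n. \<integral>z. cmod z ^ (2 * n) \<partial>dA)"
  have meas [measurable]: "(\<lambda>z. cmod z ^ k) \<in> borel_measurable dA" for k
    by (intro borel_measurable_dA) measurable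
  have [measurable]: "indicator (ball 0 r) \<in> borel_measurable dA" for r :: real
    by (intro borel_measurable_dA) measurable
  have int: "integrable dA (\<lambda>z. cmod z ^ k)" for k
    by (rule dA.integrable_const_bound[of _ 1]) (auto simp: power_le_one)
  have "(\<lambda>z. indicator (ball 0 r) z * cmod z ^ k) \<in> borel_measurable dA" for k r
    by measurable
  then have int': "integrable dA (\<lambda>z. indicator (ball 0 r) z * cmod z ^ k)" for k r
    by (intro dA.integrable_const_bound[of _ 1]) (auto simp: power_le_one indicator_def)
  have ball: "(\<integral>z. indicator (ball 0 r) z * cmod z ^ (2 * n) \<partial>dA) = (r\<^sup>2) ^ Suc n * m n"
    if "0 < r" "r \<le> 1" for r n
  proof -
    have "complex_of_real (\<integral>z. indicator (ball 0 r) z * cmod z ^ (2 * n) \<partial>dA) =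
        (\<integral>z. indicator (ball 0 r) z *\<^sub>R of_real (cmod z ^ (2 * n)) \<partial>dA)"
      unfolding integral_complex_of_real[symmetric]
      by (intro Bochner_Integration.integral_cong) (auto simp: scaleR_conv_of_real)
    also have "\<dots> = of_real (r\<^sup>2) * (\<integral>z. of_real (cmod (of_real r * z) ^ (2 * n)) \<partial>dA)"
      using that by (intro integral_dA_scaling) auto
    also have "(\<integral>z. complex_of_real (cmod (of_real r * z) ^ (2 * n)) \<partial>dA) =
        of_real (r ^ (2 * n) * m n)"
      unfolding integral_complex_of_real m_def using that by (simp add: norm_mult power_mult_distrib)
    also have "of_real (r\<^sup>2) * complex_of_real (r ^ (2 * n) * m n) = of_real ((r\<^sup>2) ^ Suc n * m n)"
      by (simp add: power_mult)
    finally show ?thesis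
      by (simp only: of_real_eq_iff)
  qed
  have m0: "m 0 = 1"
    by (simp add: m_def)
  have bounds: "(r\<^sup>2) ^ n \<le> m n * (\<Sum>i\<le>n. (r\<^sup>2) ^ i) \<and> m n * (\<Sum>i\<le>n. (r\<^sup>2) ^ i) \<le> 1"
    if r: "0 < r" "r < 1" for r
  proof -
    have r2: "0 < r\<^sup>2" "r\<^sup>2 < 1"
      using r by (auto simp: power_less_one_iff)
    have ring: "(\<integral>z. (1 - indicator (ball 0 r) z) * cmod z ^ (2 * k) \<partial>dA) = m k * (1 - (r\<^sup>2) ^ Suc k)"
      for k
      using int[of "2 * k"] int'[of r "2 * k"] ball[of r k] r
      by (simp add: left_diff_distrib m_def algebra_simps)
    have int1: "integrable dA (\<lambda>z. 1 - indicator (ball 0 r) z :: real)"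
      using int'[of r 0] by simp
    have int2: "integrable dA (\<lambda>z. (1 - indicator (ball 0 r) z) * cmod z ^ (2 * n))"
      using int int' by (simp add: left_diff_distrib)
    have one: "(\<integral>z. (1 - indicator (ball 0 r) z :: real) \<partial>dA) = 1 - r\<^sup>2"
      using ring[of 0] m0 by simp
    have "(r\<^sup>2) ^ n * (1 - r\<^sup>2) = (\<integral>z. (r\<^sup>2) ^ n * (1 - indicator (ball 0 r) z) \<partial>dA)"
      by (simp add: one)
    also have "\<dots> \<le> (\<integral>z. (1 - indicator (ball 0 r) z) * cmod z ^ (2 * n) \<partial>dA)"
    proof (rule integral_mono)
      show "integrable dA (\<lambda>z. (r\<^sup>2) ^ n * (1 - indicator (ball 0 r) z))"
        by (intro integrable_mult_right int1)
      show "integrable dA (\<lambda>z. (1 - indicator (ball 0 r) z) * cmod z ^ (2 * n))"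
        by (rule int2)
    qed (use r in \<open>auto simp: indicator_def power_mult[symmetric] power_mono\<close>)
    finally have lo: "(r\<^sup>2) ^ n * (1 - r\<^sup>2) \<le> m n * (1 - (r\<^sup>2) ^ Suc n)"
      unfolding ring .
    have "(\<integral>z. (1 - indicator (ball 0 r) z) * cmod z ^ (2 * n) \<partial>dA) \<le>
        (\<integral>z. (1 - indicator (ball 0 r) z) \<partial>dA)"
      by (rule integral_mono[OF int2 int1]) (auto simp: indicator_def power_le_one)
    then have up: "m n * (1 - (r\<^sup>2) ^ Suc n) \<le> 1 - r\<^sup>2"
      unfolding ring one .
    have eq: "m n * (1 - (r\<^sup>2) ^ Suc n) = (m n * (\<Sum>i\<le>n. (r\<^sup>2) ^ i)) * (1 - r\<^sup>2)"
      by (simp only: sum_gp_basic[of "r\<^sup>2" n, symmetric] mult_ac)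
    have pos: "0 < 1 - r\<^sup>2" using r2 by simp
    show ?thesis
      using mult_right_le_imp_le[OF lo[unfolded eq] pos]
        mult_right_le_imp_le[of _ "1 - r\<^sup>2" 1, OF _ pos] up[unfolded eq] by simp
  qed
  have ev: "eventually (\<lambda>r::real. 0 < r \<and> r < 1) (at_left 1)"
    by (auto simp: eventually_at_left[of 0] intro: exI[of _ 0])
  have "((\<lambda>r. m n * (\<Sum>i\<le>n. (r\<^sup>2) ^ i)) \<longlongrightarrow> m n * (\<Sum>i\<le>n. (1\<^sup>2) ^ i)) (at_left 1)"
    by (intro tendsto_intros)
  moreover have "((\<lambda>r. m n * (\<Sum>i\<le>n. (r\<^sup>2) ^ i)) \<longlongrightarrow> 1) (at_left 1)"
  proof (rule tendsto_sandwich)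
    have "((\<lambda>r::real. (r\<^sup>2) ^ n) \<longlongrightarrow> (1\<^sup>2) ^ n) (at_left 1)"
      by (intro tendsto_intros)
    then show "((\<lambda>r::real. (r\<^sup>2) ^ n) \<longlongrightarrow> 1) (at_left 1)" by simp
    show "eventually (\<lambda>r. (r\<^sup>2) ^ n \<le> m n * (\<Sum>i\<le>n. (r\<^sup>2) ^ i)) (at_left 1)"
      using ev by eventually_elim (use bounds in blast)
    show "eventually (\<lambda>r. m n * (\<Sum>i\<le>n. (r\<^sup>2) ^ i) \<le> 1) (at_left 1)"
      using ev by eventually_elim (use bounds in blast)
  qed auto
  ultimately have "m n * (\<Sum>i\<le>n. (1\<^sup>2) ^ i) = 1"
    using tendsto_unique trivial_limit_at_left_real by blast
  then show ?thesis
    by (simp add: m_def field_simps)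
qed

text \<open>
  A rotation by \<open>c\<close> multiplies the product of the two monomials by \<open>c powi (k + l)\<close> and does not change
  its integral, which must therefore vanish unless \<open>k + l = 0\<close>.
\<close>

lemma pairing_disk_monomial:
  "pairing (disk_monomial k) (disk_monomial l) = (if k + l = 0 then 1 / (of_int \<bar>k\<bar> + 1) else 0)"
proof (cases "k + l = 0")
  case True
  then have l: "l = - k" by simp
  have "pairing (disk_monomial k) (disk_monomial l) = (\<integral>z. of_real (cmod z ^ (2 * nat \<bar>k\<bar>)) \<partial>dA)"
    unfolding pairing_def
  proof (rule Bochner_Integration.integral_cong)
    fix z assume "z \<in> space dA"
    then have "z \<in> unit_disk" by simp
    have "disk_monomial k z * disk_monomial l z = of_real ((cmod (disk_monomial k z))\<^sup>2)"
      by (simp only: l cnj_disk_monomial[symmetric] complex_norm_square)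
    then show "disk_monomial k z * disk_monomial l z = of_real (cmod z ^ (2 * nat \<bar>k\<bar>))"
      using norm_disk_monomial[OF \<open>z \<in> unit_disk\<close>, of k] by (simp add: power_mult mult.commute)
  qed simp
  also have "\<dots> = of_real (1 / (real (nat \<bar>k\<bar>) + 1))"
    by (simp only: integral_complex_of_real integral_norm_power_dA)
  also have "\<dots> = 1 / (of_int \<bar>k\<bar> + 1)"
    by (simp flip: of_int_abs)
  finally show ?thesis
    using True by simp
next
  case False
  define m where "m = \<bar>k + l\<bar>"
  have m: "1 \<le> m" using False by (simp add: m_def)
  (* With this angle, c powi (k + l) is the imaginary unit or its negative, hence not 1. *)
  define \<theta> where "\<theta> = pi / (2 * of_int m)"
  define c where "c = cis \<theta>"
  have "0 < \<theta>" "\<theta> < pi"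
    using m by (auto simp: \<theta>_def field_simps)
  then have c: "cmod c = 1" "Im c \<noteq> 0"
    using sin_gt_zero[of \<theta>] by (auto simp: c_def)
  then have c0: "c \<noteq> 0" by auto
  have "of_int (k + l) * \<theta> = pi / 2 \<or> of_int (k + l) * \<theta> = - (pi / 2)"
    using m by (auto simp: \<theta>_def m_def abs_if field_simps)
  then have "Re (c powi (k + l)) = 0"
    unfolding c_def cis_power_int by (elim disjE) (simp_all only: cis.sel cos_minus cos_pi_half)
  then have ne: "c powi (k + l) \<noteq> 1"
    by auto
  have "pairing (disk_monomial k) (disk_monomial l) =
      (\<integral>z. disk_monomial k (c * z) * disk_monomial l (c * z) \<partial>dA)"
    unfolding pairing_def by (subst integral_dA_rotation[OF _ c]) auto
  also have "\<dots> = (\<integral>z. c powi (k + l) * (disk_monomial k z * disk_monomial l z) \<partial>dA)"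
    unfolding disk_monomial_rotate[OF c(1)] using c0 by (simp add: power_int_add mult_ac)
  also have "\<dots> = c powi (k + l) * pairing (disk_monomial k) (disk_monomial l)"
    by (simp add: pairing_def)
  finally show ?thesis
    using ne False by simp
qed

lemma pairing_disk_monomial_ball:
  assumes "0 < r" "r \<le> 1"
  shows "(\<integral>z. indicator (ball 0 r) z *\<^sub>R (disk_monomial k z * disk_monomial l z) \<partial>dA) =
    of_real (r ^ (2 + nat \<bar>k\<bar> + nat \<bar>l\<bar>)) * pairing (disk_monomial k) (disk_monomial l)"
proof -
  have "(\<integral>z. indicator (ball 0 r) z *\<^sub>R (disk_monomial k z * disk_monomial l z) \<partial>dA) =
      of_real (r\<^sup>2) * (\<integral>z. disk_monomial k (of_real r * z) * disk_monomial l (of_real r * z) \<partial>dA)"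
    using assms by (intro integral_dA_scaling) auto
  also have "(\<integral>z. disk_monomial k (of_real r * z) * disk_monomial l (of_real r * z) \<partial>dA) =
      (\<integral>z. of_real (r ^ (nat \<bar>k\<bar> + nat \<bar>l\<bar>)) * (disk_monomial k z * disk_monomial l z) \<partial>dA)"
    using assms
    by (intro Bochner_Integration.integral_cong) (auto simp: disk_monomial_scale power_add)
  also have "\<dots> = of_real (r ^ (nat \<bar>k\<bar> + nat \<bar>l\<bar>)) * pairing (disk_monomial k) (disk_monomial l)"
    by (simp add: pairing_def)
  finally show ?thesis
    by (simp add: power_add power2_eq_square)
qed

section \<open>Series of harmonic monomials\<close>

text \<open>
  The sum ranges over a set, so the index \<open>0\<close> contributes once and every other \<open>n\<close> contributes the two
  monomials of degree \<open>n\<close>.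
\<close>

definition harmonic_term :: "(int \<Rightarrow> complex) \<Rightarrow> nat \<Rightarrow> complex \<Rightarrow> complex" where
  "harmonic_term c n z = (\<Sum>k\<in>{int n, - int n}. c k * disk_monomial k z)"

definition harmonic_series :: "(int \<Rightarrow> complex) \<Rightarrow> complex \<Rightarrow> complex" where
  "harmonic_series c z = (\<Sum>n. harmonic_term c n z)"

definition convergent_coeffs :: "(int \<Rightarrow> complex) \<Rightarrow> bool" where
  "convergent_coeffs c \<longleftrightarrow>
    (\<forall>r. 0 \<le> r \<and> r < 1 \<longrightarrow> summable (\<lambda>n. (\<Sum>k\<in>{int n, - int n}. cmod (c k)) * r ^ n))"

lemma norm_harmonic_term_le:
  assumes "z \<in> unit_disk"
  shows "cmod (harmonic_term c n z) \<le> (\<Sum>k\<in>{int n, - int n}. cmod (c k)) * cmod z ^ n"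
proof -
  have "cmod (harmonic_term c n z) \<le> (\<Sum>k\<in>{int n, - int n}. cmod (c k * disk_monomial k z))"
    unfolding harmonic_term_def by (rule norm_sum)
  also have "\<dots> = (\<Sum>k\<in>{int n, - int n}. cmod (c k) * cmod z ^ n)"
    using assms by (intro sum.cong) (auto simp: norm_mult norm_disk_monomial)
  finally show ?thesis
    by (simp add: sum_distrib_right)
qed

lemma harmonic_term_outside: "z \<notin> unit_disk \<Longrightarrow> harmonic_term c n z = 0"
  by (simp add: harmonic_term_def disk_monomial_outside)

lemma harmonic_series_outside: "z \<notin> unit_disk \<Longrightarrow> harmonic_series c z = 0"
  by (simp add: harmonic_series_def harmonic_term_outside)

lemma summable_norm_harmonic_term:
  assumes "convergent_coeffs c"
  shows "summable (\<lambda>n. cmod (harmonic_term c n z))"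
proof (cases "z \<in> unit_disk")
  case True
  then have "summable (\<lambda>n. (\<Sum>k\<in>{int n, - int n}. cmod (c k)) * cmod z ^ n)"
    using assms by (simp add: convergent_coeffs_def)
  then show ?thesis
    by (rule summable_comparison_test') (simp add: norm_harmonic_term_le[OF True])
qed (simp add: harmonic_term_outside)

lemma harmonic_series_sums:
  "convergent_coeffs c \<Longrightarrow> (\<lambda>n. harmonic_term c n z) sums harmonic_series c z"
  unfolding harmonic_series_def
  by (rule summable_sums[OF summable_norm_cancel[OF summable_norm_harmonic_term]])

lemma harmonic_term_measurable [measurable]: "harmonic_term c n \<in> borel_measurable dA"
  unfolding harmonic_term_def by measurable

lemma indicator_ball_measurable_dA [measurable]:
  "(indicator (ball 0 r) :: complex \<Rightarrow> real) \<in> borel_measurable dA"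
  by (intro borel_measurable_dA) measurable

lemma integral_harmonic_term_ball:
  assumes r: "0 < r" "r \<le> 1"
  shows "(\<integral>z. indicator (ball 0 r) z *\<^sub>R (harmonic_term c n z * disk_monomial l z) \<partial>dA) =
    (if n = nat \<bar>l\<bar> then c (- l) * of_real (r ^ (2 + 2 * n)) / (of_nat n + 1) else 0)"
proof -
  have int: "integrable dA (\<lambda>z. indicator (ball 0 r) z *\<^sub>R (disk_monomial k z * disk_monomial l z))" for k
  proof (rule dA.integrable_const_bound)
    show "AE z in dA. norm (indicator (ball 0 r) z *\<^sub>R (disk_monomial k z * disk_monomial l z)) \<le> 1"
      by (auto simp: norm_mult indicator_def intro!: mult_le_one norm_disk_monomial_le_1)
  qed measurable
  have "(\<integral>z. indicator (ball 0 r) z *\<^sub>R (harmonic_term c n z * disk_monomial l z) \<partial>dA) =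
      (\<integral>z. (\<Sum>k\<in>{int n, - int n}.
        c k * (indicator (ball 0 r) z *\<^sub>R (disk_monomial k z * disk_monomial l z))) \<partial>dA)"
    by (simp only: harmonic_term_def sum_distrib_right scaleR_sum_right mult.assoc mult_scaleR_right)
  also have "\<dots> = (\<Sum>k\<in>{int n, - int n}.
        c k * (\<integral>z. indicator (ball 0 r) z *\<^sub>R (disk_monomial k z * disk_monomial l z) \<partial>dA))"
    by (subst Bochner_Integration.integral_sum)
       (intro integrable_mult_right int, simp only: integral_mult_right_zero)
  also have "\<dots> = (\<Sum>k\<in>{int n, - int n}.
        if k = - l then c (- l) * of_real (r ^ (2 + 2 * n)) / (of_nat n + 1) else 0)"
  proof (rule sum.cong)
    fix k assume k: "k \<in> {int n, - int n}"
    show "c k * (\<integral>z. indicator (ball 0 r) z *\<^sub>R (disk_monomial k z * disk_monomial l z) \<partial>dA) =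
        (if k = - l then c (- l) * of_real (r ^ (2 + 2 * n)) / (of_nat n + 1) else 0)"
    proof (cases "k = - l")
      case True
      then have "nat \<bar>k\<bar> = n" "nat \<bar>l\<bar> = n" "complex_of_int \<bar>k\<bar> = of_nat n"
        using k by auto
      then show ?thesis
        using True unfolding pairing_disk_monomial_ball[OF r] pairing_disk_monomial
        by (simp add: mult_2 add.assoc)
    next
      case False
      then show ?thesis
        unfolding pairing_disk_monomial_ball[OF r] pairing_disk_monomial by (simp add: eq_neg_iff_add_eq_0)
    qed
  qed simp
  also have "\<dots> = (if - l \<in> {int n, - int n} then c (- l) * of_real (r ^ (2 + 2 * n)) / (of_nat n + 1) else 0)"
    by (simp only: sum.delta finite.intros)
  also have "- l \<in> {int n, - int n} \<longleftrightarrow> n = nat \<bar>l\<bar>"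
    by auto
  finally show ?thesis .
qed

text \<open>
  On a smaller disk the series converges uniformly and can be integrated term by term; by
  orthogonality only the monomial of index \<open>- l\<close> survives.
\<close>

lemma integral_harmonic_series_ball:
  assumes c: "convergent_coeffs c" and r: "0 < r" "r < 1"
  shows "(\<integral>z. indicator (ball 0 r) z *\<^sub>R (harmonic_series c z * disk_monomial l z) \<partial>dA) =
    c (- l) * of_real (r ^ (2 + 2 * nat \<bar>l\<bar>)) / (of_int \<bar>l\<bar> + 1)"
proof -
  define f where "f = (\<lambda>n z. indicator (ball 0 r) z *\<^sub>R (harmonic_term c n z * disk_monomial l z))"
  define b where "b = (\<lambda>n. (\<Sum>k\<in>{int n, - int n}. cmod (c k)) * r ^ n)"
  have b: "summable b"
    using c r unfolding b_def convergent_coeffs_def by auto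
  have bound: "norm (f n z) \<le> b n" for n z
  proof (cases "z \<in> ball 0 r")
    case True
    then have z: "z \<in> unit_disk" "cmod z \<le> r"
      using r by auto
    have "norm (f n z) \<le> cmod (harmonic_term c n z) * 1"
      unfolding f_def using True
      by (auto simp: norm_mult intro!: mult_left_le norm_disk_monomial_le_1)
    also have "\<dots> \<le> (\<Sum>k\<in>{int n, - int n}. cmod (c k)) * cmod z ^ n"
      using norm_harmonic_term_le[OF z(1)] by simp
    also have "\<dots> \<le> b n"
      unfolding b_def using z by (intro mult_left_mono power_mono sum_nonneg) auto
    finally show ?thesis .
  next
    case False
    then show ?thesis
      using r by (auto simp: f_def b_def intro!: mult_nonneg_nonneg sum_nonneg)
  qed
  have [measurable]: "f n \<in> borel_measurable dA" for n
    unfolding f_def by measurable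
  have int: "integrable dA (f n)" for n
    by (rule dA.integrable_const_bound[of _ "b n"]) (auto simp: bound)
  have "(\<integral>z. norm (f n z) \<partial>dA) \<le> (\<integral>z. b n \<partial>dA)" for n
    by (rule integral_mono) (auto simp: bound int)
  then have "(\<integral>z. norm (f n z) \<partial>dA) \<le> b n" for n
    by simp
  then have sm: "summable (\<lambda>n. \<integral>z. norm (f n z) \<partial>dA)"
    by (intro summable_comparison_test'[OF b]) simp
  have sn: "summable (\<lambda>n. norm (f n z))" for z
    by (rule summable_comparison_test'[OF b]) (simp add: bound)
  have "(\<integral>z. (\<Sum>n. f n z) \<partial>dA) = (\<Sum>n. integral\<^sup>L dA (f n))"
    by (rule integral_suminf[OF int _ sm]) (simp add: sn)
  also have "(\<lambda>n. integral\<^sup>L dA (f n)) =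
      (\<lambda>n. if n = nat \<bar>l\<bar> then c (- l) * of_real (r ^ (2 + 2 * n)) / (of_nat n + 1) else 0)"
    unfolding f_def by (subst integral_harmonic_term_ball) (use r in auto)
  also have "suminf \<dots> = c (- l) * of_real (r ^ (2 + 2 * nat \<bar>l\<bar>)) / (of_nat (nat \<bar>l\<bar>) + 1)"
    by (rule sums_unique[symmetric, OF sums_single])
  also have "of_nat (nat \<bar>l\<bar>) = complex_of_int \<bar>l\<bar>"
    by simp
  finally have *: "(\<integral>z. (\<Sum>n. f n z) \<partial>dA) =
      c (- l) * of_real (r ^ (2 + 2 * nat \<bar>l\<bar>)) / (of_int \<bar>l\<bar> + 1)" .
  have "(\<Sum>n. f n z) = indicator (ball 0 r) z *\<^sub>R (harmonic_series c z * disk_monomial l z)" for z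
    unfolding f_def
    by (rule sums_unique[symmetric], rule sums_scaleR_right, rule sums_mult2,
        rule harmonic_series_sums[OF c])
  with * show ?thesis by (simp only:)
qed

lemma norm_of_int_abs_plus_1: "cmod (of_int \<bar>k\<bar> + 1) = real_of_int \<bar>k\<bar> + 1"
proof -
  have "complex_of_int \<bar>k\<bar> + 1 = of_real (of_int \<bar>k\<bar> + 1)"
    by (simp only: of_real_add of_real_1 of_real_of_int_eq)
  moreover have "0 \<le> real_of_int \<bar>k\<bar> + 1"
    by linarith
  ultimately show ?thesis
    by (simp only: norm_of_real abs_of_nonneg)
qed

lemma of_int_abs_plus_1_neq_0: "complex_of_int \<bar>k\<bar> + 1 \<noteq> 0"
proof
  assume "complex_of_int \<bar>k\<bar> + 1 = 0"
  then have "cmod (complex_of_int \<bar>k\<bar> + 1) = 0"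
    by (simp only: norm_zero)
  then show False
    unfolding norm_of_int_abs_plus_1 by linarith
qed

text \<open>
  The radius of the smaller disk tends to \<open>1\<close>; integrability of the sum provides the dominating function.
\<close>

lemma pairing_harmonic_series_monomial:
  assumes c: "convergent_coeffs c" and int: "integrable dA (harmonic_series c)"
  shows "pairing (harmonic_series c) (disk_monomial l) = c (- l) / (of_int \<bar>l\<bar> + 1)"
proof -
  define r where "r = (\<lambda>j. 1 - 1 / real (Suc (Suc j)))"
  have r: "0 < r j" "r j < 1" for j
    by (auto simp: r_def field_simps)
  have r1: "r \<longlonglongrightarrow> 1 - 0"
    unfolding r_def
    by (intro tendsto_diff tendsto_const
        LIMSEQ_Suc[OF LIMSEQ_inverse_real_of_nat, unfolded inverse_eq_divide])
  have [measurable]: "harmonic_series c \<in> borel_measurable dA"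
    using int by auto
  have "(\<lambda>j. \<integral>z. indicator (ball 0 (r j)) z *\<^sub>R (harmonic_series c z * disk_monomial l z) \<partial>dA)
      \<longlonglongrightarrow> pairing (harmonic_series c) (disk_monomial l)"
    unfolding pairing_def
  proof (rule integral_dominated_convergence[where w = "\<lambda>z. cmod (harmonic_series c z)"])
    show "AE z in dA. (\<lambda>j. indicator (ball 0 (r j)) z *\<^sub>R (harmonic_series c z * disk_monomial l z))
        \<longlonglongrightarrow> harmonic_series c z * disk_monomial l z"
    proof (rule AE_I2)
      fix z assume "z \<in> space dA"
      then have "cmod z < 1" by simp
      then have "eventually (\<lambda>j. cmod z < r j) sequentially"
        using r1 by (auto intro: order_tendstoD)
      then show "(\<lambda>j. indicator (ball 0 (r j)) z *\<^sub>R (harmonic_series c z * disk_monomial l z))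
        \<longlonglongrightarrow> harmonic_series c z * disk_monomial l z"
        by (intro tendsto_eventually) (auto elim!: eventually_mono)
    qed
    show "AE z in dA. norm (indicator (ball 0 (r j)) z *\<^sub>R (harmonic_series c z * disk_monomial l z))
        \<le> cmod (harmonic_series c z)" for j
      by (rule AE_I2)
         (auto simp: norm_mult indicator_def intro!: mult_left_le norm_disk_monomial_le_1)
  qed (use int in auto)
  moreover have "(\<lambda>j. \<integral>z. indicator (ball 0 (r j)) z *\<^sub>R (harmonic_series c z * disk_monomial l z) \<partial>dA)
      \<longlonglongrightarrow> c (- l) * of_real ((1 - 0) ^ (2 + 2 * nat \<bar>l\<bar>)) / (of_int \<bar>l\<bar> + 1)"
    unfolding integral_harmonic_series_ball[OF c r]
    by (intro tendsto_intros r1 of_int_abs_plus_1_neq_0)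
  ultimately have "pairing (harmonic_series c) (disk_monomial l) =
      c (- l) * of_real ((1 - 0) ^ (2 + 2 * nat \<bar>l\<bar>)) / (of_int \<bar>l\<bar> + 1)"
    by (rule LIMSEQ_unique)
  then show ?thesis by simp
qed

text \<open>
  This is the growth of the coefficients of a function whose pairings with all monomials are bounded by
  \<open>M\<close>.
\<close>

definition coeff_bound :: "real \<Rightarrow> (int \<Rightarrow> complex) \<Rightarrow> bool" where
  "coeff_bound M c \<longleftrightarrow> (\<forall>k. cmod (c k) \<le> M * (of_int \<bar>k\<bar> + 1))"

lemma summable_Suc_power:
  assumes "0 \<le> r" "r < (1::real)"
  shows "summable (\<lambda>n. real (Suc n) * r ^ n)"
  using geometric_deriv_sums[of r] assms by (simp add: sums_iff)

lemma coeff_bound_sum: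
  assumes "coeff_bound M c" "0 \<le> M"
  shows "(\<Sum>k\<in>{int n, - int n}. cmod (c k)) \<le> 2 * M * real (Suc n)"
proof -
  have "cmod (c k) \<le> M * real (Suc n)" if "k \<in> {int n, - int n}" for k
    using assms(1)[unfolded coeff_bound_def, rule_format, of k] that by (auto simp: add.commute)
  then have "(\<Sum>k\<in>{int n, - int n}. cmod (c k)) \<le> of_nat (card {int n, - int n}) * (M * real (Suc n))"
    by (rule sum_bounded_above)
  also have "\<dots> \<le> 2 * (M * real (Suc n))"
    using assms(2) card_insert_le_m1[of 2 "{- int n}" "int n"] by (intro mult_right_mono) auto
  finally show ?thesis by simp
qed

lemma coeff_bound_convergent:
  assumes "coeff_bound M c"
  shows "convergent_coeffs c"
proof -
  have M: "0 \<le> M"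
    using order_trans[OF norm_ge_zero assms[unfolded coeff_bound_def, rule_format, of 0]] by simp
  show ?thesis
    unfolding convergent_coeffs_def
  proof (intro allI impI)
    fix r :: real assume r: "0 \<le> r \<and> r < 1"
    have "summable (\<lambda>n. 2 * M * (real (Suc n) * r ^ n))"
      using r by (intro summable_mult summable_Suc_power) auto
    then show "summable (\<lambda>n. (\<Sum>k\<in>{int n, - int n}. cmod (c k)) * r ^ n)"
    proof (rule summable_comparison_test')
      fix n
      have "(\<Sum>k\<in>{int n, - int n}. cmod (c k)) * r ^ n \<le> 2 * M * real (Suc n) * r ^ n"
        using r by (intro mult_right_mono coeff_bound_sum assms M) auto
      moreover have "0 \<le> (\<Sum>k\<in>{int n, - int n}. cmod (c k)) * r ^ n"
        using r by (intro mult_nonneg_nonneg sum_nonneg) auto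
      ultimately show "norm ((\<Sum>k\<in>{int n, - int n}. cmod (c k)) * r ^ n) \<le> 2 * M * (real (Suc n) * r ^ n)"
        by (simp only: real_norm_def abs_of_nonneg mult.assoc)
    qed
  qed
qed

text \<open>
  The factor of \<open>M\<close> depends on \<open>z\<close> alone, so the series tend to \<open>0\<close> pointwise on the disk when
  their bounds \<open>M\<close> do.
\<close>

lemma norm_harmonic_series_le:
  assumes c: "coeff_bound M c" and z: "z \<in> unit_disk"
  shows "cmod (harmonic_series c z) \<le> M * (\<Sum>n. 2 * (real (Suc n) * cmod z ^ n))"
proof -
  have M: "0 \<le> M"
    using order_trans[OF norm_ge_zero c[unfolded coeff_bound_def, rule_format, of 0]] by simp
  have sm: "summable (\<lambda>n. 2 * (real (Suc n) * cmod z ^ n))"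
    using z by (intro summable_mult summable_Suc_power) auto
  have "cmod (harmonic_series c z) \<le> (\<Sum>n. cmod (harmonic_term c n z))"
    unfolding harmonic_series_def
    by (intro summable_norm summable_norm_harmonic_term coeff_bound_convergent[OF c])
  also have "\<dots> \<le> (\<Sum>n. M * (2 * (real (Suc n) * cmod z ^ n)))"
  proof (rule suminf_le)
    fix n
    have "cmod (harmonic_term c n z) \<le> (\<Sum>k\<in>{int n, - int n}. cmod (c k)) * cmod z ^ n"
      by (rule norm_harmonic_term_le[OF z])
    also have "\<dots> \<le> 2 * M * real (Suc n) * cmod z ^ n"
      by (intro mult_right_mono coeff_bound_sum c M) auto
    finally show "cmod (harmonic_term c n z) \<le> M * (2 * (real (Suc n) * cmod z ^ n))"
      by (simp only: mult_ac)
  qed (use sm summable_norm_harmonic_term coeff_bound_convergent[OF c] in \<open>auto intro: summable_mult\<close>)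
  also have "\<dots> = M * (\<Sum>n. 2 * (real (Suc n) * cmod z ^ n))"
    by (rule suminf_mult[OF sm])
  finally show ?thesis .
qed

lemma harmonic_series_add:
  assumes "convergent_coeffs c" "convergent_coeffs d"
  shows "harmonic_series (\<lambda>k. c k + d k) z = harmonic_series c z + harmonic_series d z"
proof -
  have "(\<lambda>n. harmonic_term (\<lambda>k. c k + d k) n z) = (\<lambda>n. harmonic_term c n z + harmonic_term d n z)"
    by (simp add: harmonic_term_def distrib_right sum.distrib fun_eq_iff)
  then show ?thesis
    unfolding harmonic_series_def[of "\<lambda>k. c k + d k"]
    using sums_unique[OF sums_add[OF assms[THEN harmonic_series_sums, of z]]] by simp
qed

lemma harmonic_series_scale:
  assumes "convergent_coeffs c"
  shows "harmonic_series (\<lambda>k. a * c k) z = a * harmonic_series c z"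
proof -
  have "(\<lambda>n. harmonic_term (\<lambda>k. a * c k) n z) = (\<lambda>n. a * harmonic_term c n z)"
    by (simp only: harmonic_term_def sum_distrib_left mult.assoc)
  then show ?thesis
    unfolding harmonic_series_def[of "\<lambda>k. a * c k"]
    using sums_unique[OF sums_mult[OF assms[THEN harmonic_series_sums, of z]]] by simp
qed

lemma harmonic_term_0: "z \<in> unit_disk \<Longrightarrow> harmonic_term c 0 z = c 0"
  by (simp add: harmonic_term_def disk_monomial_def)

lemma harmonic_term_pos:
  "\<lbrakk>z \<in> unit_disk; 0 < n\<rbrakk> \<Longrightarrow>
    harmonic_term c n z = c (int n) * z ^ n + c (- int n) * cnj z ^ n"
  by (simp add: harmonic_term_def disk_monomial_def)

lemma harmonic_on_harmonic_series:
  assumes c: "convergent_coeffs c"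
  shows "harmonic_on (harmonic_series c) unit_disk"
proof -
  define P where "P = (\<lambda>z. \<Sum>n. c (int n) * z ^ n)"
  define b where "b = (\<lambda>n. if n = 0 then 0 else cnj (c (- int n)))"
  define R where "R = (\<lambda>z. \<Sum>n. b n * z ^ n)"
  have bd: "cmod (c (int n)) \<le> (\<Sum>k\<in>{int n, - int n}. cmod (c k))"
    "cmod (b n) \<le> (\<Sum>k\<in>{int n, - int n}. cmod (c k))" for n
    by (cases "n = 0"; auto simp: b_def)+
  have sm: "summable (\<lambda>n. (\<Sum>k\<in>{int n, - int n}. cmod (c k)) * cmod z ^ n)" if "z \<in> unit_disk" for z
    using that c by (simp add: convergent_coeffs_def)
  have P: "(\<lambda>n. c (int n) * z ^ n) sums P z" and R: "(\<lambda>n. b n * z ^ n) sums R z"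
    if "z \<in> unit_disk" for z
    unfolding P_def R_def
    by (auto intro!: summable_sums summable_comparison_test'[OF sm[OF that]] mult_right_mono bd
        simp: norm_mult norm_power simp del: sum.insert)
  have "harmonic_series c z = P z + cnj (R z)" if z: "z \<in> unit_disk" for z
  proof -
    have "(\<lambda>n. c (int n) * z ^ n + cnj (b n * z ^ n)) sums (P z + cnj (R z))"
      using P[OF z] R[OF z] by (intro sums_add) (simp_all only: sums_cnj)
    moreover have "c (int n) * z ^ n + cnj (b n * z ^ n) = harmonic_term c n z" for n
      using z by (cases "n = 0") (simp_all add: b_def harmonic_term_0 harmonic_term_pos)
    ultimately show ?thesis
      unfolding harmonic_series_def by (simp add: sums_iff)
  qed
  moreover have "P holomorphic_on unit_disk" "R holomorphic_on unit_disk"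
    using P R by (auto intro!: power_series_holomorphic)
  ultimately show ?thesis
    unfolding harmonic_on_disk_iff by blast
qed

lemma harmonic_on_expansion:
  assumes h: "harmonic_on h unit_disk" and out: "\<And>z. z \<notin> unit_disk \<Longrightarrow> h z = 0"
  obtains c where "convergent_coeffs c" "h = harmonic_series c"
proof -
  obtain P R where PR: "P holomorphic_on unit_disk" "R holomorphic_on unit_disk"
    and hPR: "\<And>z. z \<in> unit_disk \<Longrightarrow> h z = P z + cnj (R z)"
    using h unfolding harmonic_on_disk_iff by blast
  (* Taylor coefficients; the two constant terms are merged in c 0 below. *)
  define a where "a = (\<lambda>n. (deriv ^^ n) P 0 / fact n)"
  define b where "b = (\<lambda>n. (deriv ^^ n) R 0 / fact n)"
  have P: "(\<lambda>n. a n * z ^ n) sums P z" and R: "(\<lambda>n. b n * z ^ n) sums R z" if "z \<in> unit_disk" for z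
    using holomorphic_power_series[OF PR(1) that] holomorphic_power_series[OF PR(2) that]
    by (auto simp: a_def b_def)
  define c where "c = (\<lambda>k. if k = 0 then a 0 + cnj (b 0)
    else if 0 < k then a (nat k) else cnj (b (nat (- k))))"
  have conv: "convergent_coeffs c"
    unfolding convergent_coeffs_def
  proof (intro allI impI)
    fix r :: real assume r: "0 \<le> r \<and> r < 1"
    (* A power series that converges at x converges absolutely at radii below cmod x. *)
    define x where "x = complex_of_real ((r + 1) / 2)"
    have x: "x \<in> unit_disk" "norm (of_real r :: complex) < norm x"
      using r by (auto simp: x_def norm_divide simp flip: of_real_add)
    have "summable (\<lambda>n. norm (a n * of_real r ^ n) + norm (b n * of_real r ^ n))"
      using P[OF x(1)] R[OF x(1)] x(2)
      by (intro summable_add powser_insidea[where x = x]) (auto simp: sums_iff)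
    then show "summable (\<lambda>n. (\<Sum>k\<in>{int n, - int n}. cmod (c k)) * r ^ n)"
    proof (rule summable_comparison_test')
      fix n
      have "(\<Sum>k\<in>{int n, - int n}. cmod (c k)) \<le> cmod (a n) + cmod (b n)"
        by (cases "n = 0") (auto simp: c_def intro: order_trans[OF norm_triangle_ineq])
      then have "(\<Sum>k\<in>{int n, - int n}. cmod (c k)) * r ^ n \<le> (cmod (a n) + cmod (b n)) * r ^ n"
        using r by (intro mult_right_mono) auto
      moreover have "0 \<le> (\<Sum>k\<in>{int n, - int n}. cmod (c k)) * r ^ n"
        using r by (intro mult_nonneg_nonneg sum_nonneg) auto
      ultimately show "norm ((\<Sum>k\<in>{int n, - int n}. cmod (c k)) * r ^ n) \<le>
          norm (a n * of_real r ^ n) + norm (b n * of_real r ^ n)"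
        using r by (simp only: real_norm_def abs_of_nonneg norm_mult norm_power norm_of_real
            distrib_right)
    qed
  qed
  moreover have "h = harmonic_series c"
  proof
    fix z
    show "h z = harmonic_series c z"
    proof (cases "z \<in> unit_disk")
      case z: True
      have "(\<lambda>n. a n * z ^ n + cnj (b n * z ^ n)) sums (P z + cnj (R z))"
        using P[OF z] R[OF z] by (intro sums_add) (simp_all only: sums_cnj)
      moreover have "a n * z ^ n + cnj (b n * z ^ n) = harmonic_term c n z" for n
        using z by (cases "n = 0") (simp_all add: c_def harmonic_term_0 harmonic_term_pos)
      ultimately show ?thesis
        unfolding harmonic_series_def hPR[OF z] by (simp add: sums_iff)
    qed (simp add: out harmonic_series_outside)
  qed
  ultimately show ?thesis
    by (rule that)
qed

section \<open>Square-integrable functions\<close>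

definition square_integrable :: "(complex \<Rightarrow> complex) \<Rightarrow> bool" where
  "square_integrable f \<longleftrightarrow> f \<in> borel_measurable dA \<and> integrable dA (\<lambda>z. (cmod (f z))\<^sup>2)"

lemma square_integrable_measurable: "square_integrable f \<Longrightarrow> f \<in> borel_measurable dA"
  by (simp add: square_integrable_def)

lemma L2_norm_nonneg: "0 \<le> L2_norm f"
  by (simp add: L2_norm_def)

lemma L2_norm_power2: "(L2_norm f)\<^sup>2 = (\<integral>z. (cmod (f z))\<^sup>2 \<partial>dA)"
  by (simp add: L2_norm_def)

lemma two_mult_le_squares: "2 * (a * b) \<le> a\<^sup>2 + (b::real)\<^sup>2"
  using sum_squares_bound[of a b] by simp

lemma integrable_product_norm:
  assumes "square_integrable f" "square_integrable g"
  shows "integrable dA (\<lambda>z. cmod (f z) * cmod (g z))"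
proof (rule Bochner_Integration.integrable_bound)
  show "integrable dA (\<lambda>z. (cmod (f z))\<^sup>2 + (cmod (g z))\<^sup>2)"
    using assms by (simp add: square_integrable_def)
  show "(\<lambda>z. cmod (f z) * cmod (g z)) \<in> borel_measurable dA"
    using assms by (auto simp: square_integrable_def)
  show "AE z in dA. norm (cmod (f z) * cmod (g z)) \<le> norm ((cmod (f z))\<^sup>2 + (cmod (g z))\<^sup>2)"
  proof (rule AE_I2)
    fix z
    have "0 \<le> cmod (f z) * cmod (g z)" by simp
    then show "norm (cmod (f z) * cmod (g z)) \<le> norm ((cmod (f z))\<^sup>2 + (cmod (g z))\<^sup>2)"
      using two_mult_le_squares[of "cmod (f z)" "cmod (g z)"] unfolding real_norm_def by linarith
  qed
qed

lemma integrable_product: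
  assumes "square_integrable f" "square_integrable g"
  shows "integrable dA (\<lambda>z. f z * g z)"
proof (rule Bochner_Integration.integrable_bound[OF integrable_product_norm[OF assms]])
  show "(\<lambda>z. f z * g z) \<in> borel_measurable dA"
    using assms by (auto simp: square_integrable_def)
qed (simp add: norm_mult)

text \<open>
  The inequality \<open>2 a b \<le> t a\<^sup>2 + b\<^sup>2 / t\<close> is integrated with \<open>t\<close> the quotient of the norms. A small
  \<open>e\<close> is added to both norms in order that the quotient is defined when one of them is zero.
\<close>

lemma Cauchy_Schwarz_integral:
  assumes "square_integrable f" "square_integrable g"
  shows "(\<integral>z. cmod (f z) * cmod (g z) \<partial>dA) \<le> L2_norm f * L2_norm g"
proof -
  define a b where "a = L2_norm f" and "b = L2_norm g"
  have ab: "0 \<le> a" "0 \<le> b" by (auto simp: a_def b_def L2_norm_nonneg)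
  have f: "integrable dA (\<lambda>z. (cmod (f z))\<^sup>2)" and g: "integrable dA (\<lambda>z. (cmod (g z))\<^sup>2)"
    using assms by (auto simp: square_integrable_def)
  have eps: "(\<integral>z. cmod (f z) * cmod (g z) \<partial>dA) \<le> (a + e) * (b + e)" if e: "0 < e" for e
  proof -
    define t where "t = (b + e) / (a + e)"
    have t: "0 < t" using ab e by (simp add: t_def)
    have "2 * (\<integral>z. cmod (f z) * cmod (g z) \<partial>dA) = (\<integral>z. 2 * (cmod (f z) * cmod (g z)) \<partial>dA)"
      by simp
    also have "\<dots> \<le> (\<integral>z. t * (cmod (f z))\<^sup>2 + (cmod (g z))\<^sup>2 / t \<partial>dA)"
    proof (rule integral_mono)
      show "integrable dA (\<lambda>z. 2 * (cmod (f z) * cmod (g z)))"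
        using integrable_product_norm[OF assms] by simp
      show "integrable dA (\<lambda>z. t * (cmod (f z))\<^sup>2 + (cmod (g z))\<^sup>2 / t)"
        using f g by simp
      fix z
      have "2 * ((sqrt t * cmod (f z)) * (cmod (g z) / sqrt t)) \<le>
          (sqrt t * cmod (f z))\<^sup>2 + (cmod (g z) / sqrt t)\<^sup>2"
        by (rule two_mult_le_squares)
      then show "2 * (cmod (f z) * cmod (g z)) \<le> t * (cmod (f z))\<^sup>2 + (cmod (g z))\<^sup>2 / t"
        using t by (simp add: power_mult_distrib power_divide)
    qed
    also have "\<dots> = t * a\<^sup>2 + b\<^sup>2 / t"
      using f g by (simp add: a_def b_def L2_norm_power2)
    also have "\<dots> \<le> t * (a + e)\<^sup>2 + (b + e)\<^sup>2 / t"
      using t ab e by (intro add_mono mult_left_mono divide_right_mono power_mono) auto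
    also have "\<dots> = 2 * ((a + e) * (b + e))"
      using ab e by (simp add: t_def power2_eq_square)
    finally show ?thesis by simp
  qed
  have "((\<lambda>e. (a + e) * (b + e)) \<longlongrightarrow> (a + 0) * (b + 0)) (at_right 0)"
    by (intro tendsto_intros)
  then have "(\<integral>z. cmod (f z) * cmod (g z) \<partial>dA) \<le> (a + 0) * (b + 0)"
    by (rule tendsto_lowerbound) (auto simp: eventually_at_right_less intro: eps
        eventually_mono[OF eventually_at_right_less])
  then show ?thesis by (simp add: a_def b_def)
qed

lemma norm_pairing_le:
  assumes "square_integrable f" "square_integrable g"
  shows "cmod (pairing f g) \<le> L2_norm f * L2_norm g"
proof -
  have "cmod (pairing f g) \<le> (\<integral>z. cmod (f z) * cmod (g z) \<partial>dA)"
    unfolding pairing_def by (rule order_trans[OF integral_norm_bound]) (simp add: norm_mult)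
  then show ?thesis
    using Cauchy_Schwarz_integral[OF assms] by simp
qed

lemma square_integrable_add:
  assumes "square_integrable f" "square_integrable g"
  shows "square_integrable (f + g)"
  unfolding square_integrable_def
proof
  have [measurable]: "f \<in> borel_measurable dA" "g \<in> borel_measurable dA"
    using assms by (auto simp: square_integrable_def)
  show "f + g \<in> borel_measurable dA"
    unfolding plus_fun_def by measurable
  show "integrable dA (\<lambda>z. (cmod ((f + g) z))\<^sup>2)"
  proof (rule Bochner_Integration.integrable_bound)
    show "integrable dA (\<lambda>z. (cmod (f z))\<^sup>2 + (cmod (g z))\<^sup>2 + 2 * (cmod (f z) * cmod (g z)))"
      using assms integrable_product_norm[OF assms] by (simp add: square_integrable_def)
    show "AE z in dA. norm ((cmod ((f + g) z))\<^sup>2) \<le>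
        norm ((cmod (f z))\<^sup>2 + (cmod (g z))\<^sup>2 + 2 * (cmod (f z) * cmod (g z)))"
    proof (rule AE_I2)
      fix z
      have "(cmod (f z + g z))\<^sup>2 \<le> (cmod (f z) + cmod (g z))\<^sup>2"
        by (intro power_mono norm_triangle_ineq) auto
      then show "norm ((cmod ((f + g) z))\<^sup>2) \<le>
        norm ((cmod (f z))\<^sup>2 + (cmod (g z))\<^sup>2 + 2 * (cmod (f z) * cmod (g z)))"
        by (simp add: power2_sum)
    qed
  qed (simp add: plus_fun_def)
qed

lemma L2_norm_triangle:
  assumes "square_integrable f" "square_integrable g"
  shows "L2_norm (f + g) \<le> L2_norm f + L2_norm g"
proof (rule power2_le_imp_le)
  have f: "integrable dA (\<lambda>z. (cmod (f z))\<^sup>2)" and g: "integrable dA (\<lambda>z. (cmod (g z))\<^sup>2)"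
    using assms by (auto simp: square_integrable_def)
  have "(L2_norm (f + g))\<^sup>2 = (\<integral>z. (cmod (f z + g z))\<^sup>2 \<partial>dA)"
    by (simp add: L2_norm_power2)
  also have "\<dots> \<le> (\<integral>z. (cmod (f z))\<^sup>2 + (cmod (g z))\<^sup>2 + 2 * (cmod (f z) * cmod (g z)) \<partial>dA)"
  proof (rule integral_mono)
    show "integrable dA (\<lambda>z. (cmod (f z + g z))\<^sup>2)"
      using square_integrable_add[OF assms] by (simp add: square_integrable_def)
    show "integrable dA (\<lambda>z. (cmod (f z))\<^sup>2 + (cmod (g z))\<^sup>2 + 2 * (cmod (f z) * cmod (g z)))"
      using f g integrable_product_norm[OF assms] by simp
    fix z
    have "(cmod (f z + g z))\<^sup>2 \<le> (cmod (f z) + cmod (g z))\<^sup>2"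
      by (intro power_mono norm_triangle_ineq) auto
    then show "(cmod (f z + g z))\<^sup>2 \<le> (cmod (f z))\<^sup>2 + (cmod (g z))\<^sup>2 + 2 * (cmod (f z) * cmod (g z))"
      by (simp add: power2_sum)
  qed
  also have "\<dots> = (L2_norm f)\<^sup>2 + (L2_norm g)\<^sup>2 + 2 * (\<integral>z. cmod (f z) * cmod (g z) \<partial>dA)"
    using f g integrable_product_norm[OF assms] by (simp add: L2_norm_power2)
  also have "\<dots> \<le> (L2_norm f + L2_norm g)\<^sup>2"
    using Cauchy_Schwarz_integral[OF assms] by (simp add: power2_sum)
  finally show "(L2_norm (f + g))\<^sup>2 \<le> (L2_norm f + L2_norm g)\<^sup>2" .
qed (simp add: L2_norm_nonneg)

lemma square_integrable_cscale: "square_integrable f \<Longrightarrow> square_integrable (cscale c f)"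
  by (auto simp: square_integrable_def cscale_def norm_mult power_mult_distrib)

lemma L2_norm_cscale: "L2_norm (cscale c f) = cmod c * L2_norm f"
  by (simp add: L2_norm_def cscale_def norm_mult power_mult_distrib real_sqrt_mult)

lemma minus_eq_cscale: "f - g = f + cscale (- 1) g"
  by (simp add: cscale_def fun_eq_iff)

lemma pairing_commute: "pairing f g = pairing g f"
  by (simp add: pairing_def mult.commute)

lemma pairing_add_left:
  assumes "square_integrable f" "square_integrable g" "square_integrable k"
  shows "pairing (f + g) k = pairing f k + pairing g k"
  using assms by (simp add: pairing_def distrib_right integrable_product)

lemma pairing_add_right:
  assumes "square_integrable f" "square_integrable g" "square_integrable k"
  shows "pairing k (f + g) = pairing k f + pairing k g"
  using pairing_add_left[OF assms] by (simp add: pairing_commute)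

lemma pairing_cscale_left: "pairing (cscale c f) g = c * pairing f g"
  by (simp add: pairing_def cscale_def mult.assoc)

lemma pairing_cscale_right: "pairing f (cscale c g) = c * pairing f g"
  using pairing_cscale_left[of c g f] by (simp add: pairing_commute)

lemma pairing_diff_left:
  assumes "square_integrable f" "square_integrable g" "square_integrable k"
  shows "pairing (f - g) k = pairing f k - pairing g k"
  unfolding minus_eq_cscale[of f g] pairing_cscale_left
    pairing_add_left[OF assms(1) square_integrable_cscale[OF assms(2)] assms(3)]
  by simp

lemma pairing_diff_right:
  assumes "square_integrable f" "square_integrable g" "square_integrable k"
  shows "pairing k (f - g) = pairing k f - pairing k g"
  using pairing_diff_left[OF assms] by (simp add: pairing_commute)

text \<open>
  All norm bounds on limits below come from this: a pointwise limit of functions in a closed ball of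
  the space of square-integrable functions stays in that ball.
\<close>

lemma square_integrable_Fatou:
  assumes f: "\<And>n. square_integrable (f n)"
    and lim: "\<And>z. z \<in> unit_disk \<Longrightarrow> (\<lambda>n. f n z) \<longlonglongrightarrow> g z"
    and C: "\<And>n. L2_norm (f n) \<le> C"
  shows "square_integrable g" "L2_norm g \<le> C"
proof -
  have [measurable]: "f n \<in> borel_measurable dA" for n
    using f by (simp add: square_integrable_def)
  have g [measurable]: "g \<in> borel_measurable dA"
    by (rule borel_measurable_LIMSEQ_metric[of f]) (auto simp: lim)
  have C0: "0 \<le> C"
    using C[of 0] L2_norm_nonneg[of "f 0"] by simp
  have "(\<integral>\<^sup>+z. ennreal ((cmod (g z))\<^sup>2) \<partial>dA) = (\<integral>\<^sup>+z. liminf (\<lambda>n. ennreal ((cmod (f n z))\<^sup>2)) \<partial>dA)"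
  proof (rule nn_integral_cong)
    fix z assume "z \<in> space dA"
    then have "(\<lambda>n. ennreal ((cmod (f n z))\<^sup>2)) \<longlonglongrightarrow> ennreal ((cmod (g z))\<^sup>2)"
      by (intro tendsto_ennrealI tendsto_intros lim) simp
    then show "ennreal ((cmod (g z))\<^sup>2) = liminf (\<lambda>n. ennreal ((cmod (f n z))\<^sup>2))"
      by (rule lim_imp_Liminf[OF sequentially_bot, symmetric])
  qed
  also have "\<dots> \<le> liminf (\<lambda>n. \<integral>\<^sup>+z. ennreal ((cmod (f n z))\<^sup>2) \<partial>dA)"
    by (rule nn_integral_liminf) measurable
  also have "\<dots> \<le> liminf (\<lambda>n::nat. ennreal (C\<^sup>2))"
  proof (rule Liminf_mono, rule always_eventually, rule allI)
    fix n
    have "(\<integral>\<^sup>+z. ennreal ((cmod (f n z))\<^sup>2) \<partial>dA) = ennreal (\<integral>z. (cmod (f n z))\<^sup>2 \<partial>dA)"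
      using f[of n] by (intro nn_integral_eq_integral) (auto simp: square_integrable_def)
    also have "\<dots> \<le> ennreal (C\<^sup>2)"
      unfolding L2_norm_power2[symmetric] using C[of n] L2_norm_nonneg
      by (intro ennreal_leI power_mono)
    finally show "(\<integral>\<^sup>+z. ennreal ((cmod (f n z))\<^sup>2) \<partial>dA) \<le> ennreal (C\<^sup>2)" .
  qed
  also have "\<dots> = ennreal (C\<^sup>2)"
    by (simp add: Liminf_const)
  finally have nn: "(\<integral>\<^sup>+z. ennreal ((cmod (g z))\<^sup>2) \<partial>dA) \<le> ennreal (C\<^sup>2)" .
  then have int: "integrable dA (\<lambda>z. (cmod (g z))\<^sup>2)"
    by (intro integrableI_nonneg) (auto intro: le_less_trans)
  then show "square_integrable g"
    using g by (simp add: square_integrable_def)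
  have "ennreal ((L2_norm g)\<^sup>2) \<le> ennreal (C\<^sup>2)"
    unfolding L2_norm_power2 using nn nn_integral_eq_integral[OF int] by simp
  then have "(L2_norm g)\<^sup>2 \<le> C\<^sup>2"
    using C0 by simp
  then show "L2_norm g \<le> C"
    using C0 power2_le_imp_le by blast
qed

section \<open>The harmonic Bergman space\<close>

lemma harmonic_on_disk_continuous: "harmonic_on h unit_disk \<Longrightarrow> continuous_on unit_disk h"
  unfolding harmonic_on_def
  by (blast intro: continuous_at_imp_continuous_on has_derivative_continuous)

lemma Lh2_iff:
  "h \<in> Lh2 \<longleftrightarrow> harmonic_on h unit_disk \<and> square_integrable h \<and> (\<forall>z. z \<notin> unit_disk \<longrightarrow> h z = 0)"
  unfolding Lh2_def square_integrable_def
  using harmonic_on_disk_continuous continuous_on_measurable_dA by blast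

lemma Lh2_square_integrable: "h \<in> Lh2 \<Longrightarrow> square_integrable h"
  by (simp add: Lh2_iff)

lemma harmonic_on_diskI:
  assumes "P holomorphic_on unit_disk" "R holomorphic_on unit_disk"
    and "\<And>z. z \<in> unit_disk \<Longrightarrow> u z = P z + cnj (R z)"
  shows "harmonic_on u unit_disk"
  using assms unfolding harmonic_on_disk_iff by blast

lemma harmonic_on_add:
  assumes "harmonic_on g unit_disk" "harmonic_on h unit_disk"
  shows "harmonic_on (g + h) unit_disk"
proof -
  obtain P R P' R' where
    "P holomorphic_on unit_disk" "R holomorphic_on unit_disk" "\<And>z. z \<in> unit_disk \<Longrightarrow> g z = P z + cnj (R z)"
    "P' holomorphic_on unit_disk" "R' holomorphic_on unit_disk" "\<And>z. z \<in> unit_disk \<Longrightarrow> h z = P' z + cnj (R' z)"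
    using assms unfolding harmonic_on_disk_iff by blast
  then show ?thesis
    by (intro harmonic_on_diskI[of "\<lambda>z. P z + P' z" "\<lambda>z. R z + R' z"])
       (auto intro!: holomorphic_intros)
qed

lemma harmonic_on_cscale:
  assumes "harmonic_on h unit_disk"
  shows "harmonic_on (cscale c h) unit_disk"
proof -
  obtain P R where
    "P holomorphic_on unit_disk" "R holomorphic_on unit_disk" "\<And>z. z \<in> unit_disk \<Longrightarrow> h z = P z + cnj (R z)"
    using assms unfolding harmonic_on_disk_iff by blast
  then show ?thesis
    by (intro harmonic_on_diskI[of "\<lambda>z. c * P z" "\<lambda>z. cnj c * R z"])
       (auto intro!: holomorphic_intros simp: cscale_def distrib_left)
qed

lemma Lh2_add: "g \<in> Lh2 \<Longrightarrow> h \<in> Lh2 \<Longrightarrow> g + h \<in> Lh2"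
  by (simp add: Lh2_iff harmonic_on_add square_integrable_add)

lemma Lh2_cscale: "h \<in> Lh2 \<Longrightarrow> cscale c h \<in> Lh2"
  by (simp add: Lh2_iff harmonic_on_cscale square_integrable_cscale) (simp add: cscale_def)

lemma zero_in_Lh2: "0 \<in> Lh2"
proof -
  have "harmonic_on 0 unit_disk"
    by (intro harmonic_on_diskI[of "\<lambda>z. 0" "\<lambda>z. 0"]) auto
  then show ?thesis
    by (simp add: Lh2_def)
qed

lemma Lh2_diff: "g \<in> Lh2 \<Longrightarrow> h \<in> Lh2 \<Longrightarrow> g - h \<in> Lh2"
  unfolding minus_eq_cscale by (intro Lh2_add Lh2_cscale)

lemma subspace_Lh2: "cfun.subspace Lh2"
  unfolding cfun.subspace_def by (auto simp: zero_in_Lh2 Lh2_add Lh2_cscale)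

lemma polynomial_function_cmult:
  fixes p q :: "complex \<Rightarrow> complex"
  assumes "polynomial_function p" "polynomial_function q"
  shows "polynomial_function (\<lambda>z. p z * q z)"
proof -
  have "polynomial_function (\<lambda>z. \<i> * q z)"
    using polynomial_function_compose[OF assms(2)
        polynomial_function_bounded_linear[OF bounded_linear_mult_right[of \<i>]]]
    by (simp add: o_def)
  moreover have "polynomial_function (\<lambda>z. Re (p z))" "polynomial_function (\<lambda>z. Im (p z))"
    using polynomial_function_compose[OF assms(1) polynomial_function_bounded_linear[OF bounded_linear_Re]]
      polynomial_function_compose[OF assms(1) polynomial_function_bounded_linear[OF bounded_linear_Im]]
    by (simp_all add: o_def)
  ultimately have "polynomial_function (\<lambda>z. Re (p z) *\<^sub>R q z + Im (p z) *\<^sub>R (\<i> * q z))"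
    using assms(2) by (intro polynomial_function_add polynomial_function_mult)
  moreover have "Re (p z) *\<^sub>R q z + Im (p z) *\<^sub>R (\<i> * q z) = p z * q z" for z
    by (simp add: complex_eq_iff)
  ultimately show ?thesis by simp
qed

lemma polynomial_function_cpower:
  fixes p :: "complex \<Rightarrow> complex"
  shows "polynomial_function p \<Longrightarrow> polynomial_function (\<lambda>z. p z ^ n)"
  by (induction n) (simp_all add: polynomial_function_cmult)

lemma subspace_harmonic_polys: "cfun.subspace harmonic_polys"
  unfolding cfun.subspace_def
proof (intro conjI ballI allI)
  show "0 \<in> harmonic_polys"
    unfolding harmonic_polys_def
    by (auto simp: zero_in_Lh2 intro!: exI[of _ "\<lambda>z. 0"])
next
  fix g h assume "g \<in> harmonic_polys" "h \<in> harmonic_polys"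
  then obtain p q where "g \<in> Lh2" "polynomial_function p" "\<forall>z\<in>unit_disk. g z = p z"
      and "h \<in> Lh2" "polynomial_function q" "\<forall>z\<in>unit_disk. h z = q z"
    unfolding harmonic_polys_def by blast
  then show "g + h \<in> harmonic_polys"
    unfolding harmonic_polys_def
    by (auto simp: Lh2_add intro!: exI[of _ "\<lambda>z. p z + q z"] polynomial_function_add)
next
  fix c h assume "h \<in> harmonic_polys"
  then obtain p where "h \<in> Lh2" "polynomial_function p" "\<forall>z\<in>unit_disk. h z = p z"
    unfolding harmonic_polys_def by blast
  then show "cscale c h \<in> harmonic_polys"
    unfolding harmonic_polys_def
    using Lh2_cscale[of h c]
    by (auto simp: cscale_def intro!: exI[of _ "\<lambda>z. c * p z"] polynomial_function_cmult)
qed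

lemma harmonic_on_disk_monomial: "harmonic_on (disk_monomial k) unit_disk"
proof (cases "0 \<le> k")
  case True
  then show ?thesis
    by (intro harmonic_on_diskI[of "\<lambda>z. z ^ nat k" "\<lambda>z. 0"])
       (auto intro!: holomorphic_intros simp: disk_monomial_def)
next
  case False
  then show ?thesis
    by (intro harmonic_on_diskI[of "\<lambda>z. 0" "\<lambda>z. z ^ nat (- k)"])
       (auto intro!: holomorphic_intros simp: disk_monomial_def)
qed

lemma integrable_norm_power2_disk_monomial: "integrable dA (\<lambda>z. (cmod (disk_monomial k z))\<^sup>2)"
  by (rule dA.integrable_const_bound[of _ 1])
     (auto simp: power_le_one norm_disk_monomial_le_1)

lemma disk_monomial_in_harmonic_polys: "disk_monomial k \<in> harmonic_polys"
proof -
  have "disk_monomial k \<in> Lh2"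
    by (simp add: Lh2_def harmonic_on_disk_monomial integrable_norm_power2_disk_monomial
        disk_monomial_outside)
  moreover have "polynomial_function (\<lambda>z. if 0 \<le> k then z ^ nat k else cnj z ^ nat (- k))"
    using polynomial_function_cpower[OF polynomial_function_id, of "nat k"]
      polynomial_function_cpower[OF polynomial_function_bounded_linear[OF bounded_linear_cnj], of "nat (- k)"]
    by (cases "0 \<le> k") simp_all
  ultimately show ?thesis
    unfolding harmonic_polys_def
    by (auto intro!: exI[of _ "\<lambda>z. if 0 \<le> k then z ^ nat k else cnj z ^ nat (- k)"]
        simp: disk_monomial_def)
qed

lemma harmonic_polys_Lh2: "p \<in> harmonic_polys \<Longrightarrow> p \<in> Lh2"
  by (simp add: harmonic_polys_def)

lemma disk_monomial_in_Lh2: "disk_monomial k \<in> Lh2"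
  by (rule harmonic_polys_Lh2[OF disk_monomial_in_harmonic_polys])

lemma L2_norm_disk_monomial_le_1: "L2_norm (disk_monomial k) \<le> 1"
proof -
  have "(\<integral>z. (cmod (disk_monomial k z))\<^sup>2 \<partial>dA) \<le> (\<integral>z. 1 \<partial>dA)"
    by (rule integral_mono[OF integrable_norm_power2_disk_monomial])
       (auto simp: power_le_one norm_disk_monomial_le_1)
  then show ?thesis
    by (simp add: L2_norm_def)
qed

lemma bounded_harmonic_poly:
  assumes "p \<in> harmonic_polys"
  shows "\<exists>B. \<forall>z. cmod (p z) \<le> B"
proof -
  obtain q where q: "p \<in> Lh2" "polynomial_function q" "\<And>z. z \<in> unit_disk \<Longrightarrow> p z = q z"
    using assms unfolding harmonic_polys_def by blast
  have "compact (q ` cball 0 1)"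
    using q(2) by (intro compact_continuous_image continuous_on_polymonial_function) auto
  then obtain B where B: "\<And>z. z \<in> cball 0 1 \<Longrightarrow> cmod (q z) \<le> B"
    by (meson bounded_iff compact_imp_bounded image_eqI)
  have "cmod (p z) \<le> max B 0" for z
  proof (cases "z \<in> unit_disk")
    case True
    then show ?thesis using B[of z] q(3)[of z] by simp
  next
    case False
    then show ?thesis using q(1) by (simp add: Lh2_def)
  qed
  then show ?thesis by blast
qed

text \<open>
  A harmonic polynomial is bounded on the disk, so its product with an integrable symbol is integrable.
\<close>

lemma integrable_mult_harmonic_poly:
  assumes u: "integrable dA u" and p: "p \<in> harmonic_polys"
  shows "integrable dA (\<lambda>z. u z * p z)"
proof -
  obtain B where B: "\<And>z. cmod (p z) \<le> B"
    using bounded_harmonic_poly[OF p] by blast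
  have [measurable]: "u \<in> borel_measurable dA" "p \<in> borel_measurable dA"
    using u square_integrable_measurable[OF Lh2_square_integrable[OF harmonic_polys_Lh2[OF p]]] by auto
  show ?thesis
  proof (rule Bochner_Integration.integrable_bound)
    show "integrable dA (\<lambda>z. B * cmod (u z))"
      using u by simp
    show "AE z in dA. norm (u z * p z) \<le> norm (B * cmod (u z))"
    proof (rule AE_I2)
      fix z
      have "cmod (u z) * cmod (p z) \<le> cmod (u z) * B"
        by (intro mult_left_mono B) auto
      also have "\<dots> \<le> norm (B * cmod (u z))"
        by (simp only: real_norm_def mult.commute[of _ B] abs_ge_self)
      finally show "norm (u z * p z) \<le> norm (B * cmod (u z))"
        by (simp add: norm_mult)
    qed
  qed measurable
qed

section \<open>The kernel of the projection\<close>

text \<open>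
  The factor \<open>\<bar>k\<bar> + 1\<close> normalizes the pairing of \<open>disk_monomial k\<close> with \<open>disk_monomial (- k)\<close> to \<open>1\<close>.
\<close>

definition harmonic_coeffs :: "(complex \<Rightarrow> complex) \<Rightarrow> int \<Rightarrow> complex" where
  "harmonic_coeffs F k = (of_int \<bar>k\<bar> + 1) * pairing F (disk_monomial (- k))"

lemma coeff_boundI_pairing:
  assumes "\<And>k. cmod (pairing F (disk_monomial k)) \<le> M"
  shows "coeff_bound M (harmonic_coeffs F)"
  unfolding coeff_bound_def
proof
  fix k
  have "cmod (harmonic_coeffs F k) = cmod (pairing F (disk_monomial (- k))) * (of_int \<bar>k\<bar> + 1)"
    by (simp only: harmonic_coeffs_def norm_mult norm_of_int_abs_plus_1 mult.commute)
  also have "\<dots> \<le> M * (of_int \<bar>k\<bar> + 1)"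
    by (intro mult_right_mono assms) auto
  finally show "cmod (harmonic_coeffs F k) \<le> M * (of_int \<bar>k\<bar> + 1)" .
qed

lemma integrable_mult_monomial:
  assumes "integrable dA F"
  shows "integrable dA (\<lambda>w. F w * disk_monomial k w)"
  using integrable_mult_harmonic_poly[OF assms disk_monomial_in_harmonic_polys] .

lemma norm_pairing_monomial_le:
  assumes "integrable dA F"
  shows "cmod (pairing F (disk_monomial k)) \<le> (\<integral>w. cmod (F w) \<partial>dA)"
proof -
  have "cmod (pairing F (disk_monomial k)) \<le> (\<integral>w. cmod (F w * disk_monomial k w) \<partial>dA)"
    unfolding pairing_def by (rule integral_norm_bound)
  also have "\<dots> \<le> (\<integral>w. cmod (F w) \<partial>dA)"
  proof (rule integral_mono)
    show "integrable dA (\<lambda>w. cmod (F w * disk_monomial k w))"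
      by (rule integrable_norm[OF integrable_mult_monomial[OF assms]])
  qed (use assms in \<open>auto simp: norm_mult intro!: mult_left_le norm_disk_monomial_le_1\<close>)
  finally show ?thesis .
qed

lemma coeff_bound_harmonic_coeffs:
  "integrable dA F \<Longrightarrow> coeff_bound (\<integral>w. cmod (F w) \<partial>dA) (harmonic_coeffs F)"
  by (intro coeff_boundI_pairing norm_pairing_monomial_le)

text \<open>
  Both squares are derivatives of geometric series; the summand \<open>- 1\<close> of the kernel removes the
  constant that they have in common.
\<close>

lemma Bergman_kernel_sums:
  assumes z: "z \<in> unit_disk" and w: "w \<in> unit_disk"
  shows "(\<lambda>n. harmonic_term (\<lambda>k. (of_int \<bar>k\<bar> + 1) * disk_monomial (- k) w) n z) sums
    (1 / (1 - z * cnj w)\<^sup>2 + 1 / (1 - cnj z * w)\<^sup>2 - 1)"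
proof -
  have lt: "cmod (z * cnj w) < 1" "cmod (cnj z * w) < 1"
    using z w mult_strict_mono'[of "cmod z" 1 "cmod w" 1] by (auto simp: norm_mult)
  have one: "(\<lambda>n. if n = 0 then (1::complex) else 0) sums 1"
    using sums_single[of 0 "\<lambda>_. 1::complex"] by simp
  have "(\<lambda>n. of_nat (Suc n) * (z * cnj w) ^ n + of_nat (Suc n) * (cnj z * w) ^ n -
      (if n = 0 then 1 else 0)) sums (1 / (1 - z * cnj w)\<^sup>2 + 1 / (1 - cnj z * w)\<^sup>2 - 1)"
    by (intro sums_add sums_diff geometric_deriv_sums lt one)
  moreover have "of_nat (Suc n) * (z * cnj w) ^ n + of_nat (Suc n) * (cnj z * w) ^ n -
      (if n = 0 then 1 else 0) =
      harmonic_term (\<lambda>k. (of_int \<bar>k\<bar> + 1) * disk_monomial (- k) w) n z" for n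
  proof (cases "n = 0")
    case True
    then show ?thesis
      using z w by (simp add: harmonic_term_def disk_monomial_def)
  next
    case False
    then show ?thesis
      using z w by (simp add: harmonic_term_pos disk_monomial_def power_mult_distrib algebra_simps)
  qed
  ultimately show ?thesis by simp
qed

text \<open>
  For fixed \<open>z\<close> the kernel is a series in monomials of \<open>w\<close> that converges uniformly, so it can be
  integrated against \<open>F\<close> term by term. All that \<open>Q\<close> retains of \<open>F\<close> are thus its pairings with monomials.
\<close>

lemma Q_eq_harmonic_series:
  assumes F: "integrable dA F"
  shows "Q F = harmonic_series (harmonic_coeffs F)"
proof
  fix z
  show "Q F z = harmonic_series (harmonic_coeffs F) z"
  proof (cases "z \<in> unit_disk")
    case z: True
    define t where "t = (\<lambda>n w. harmonic_term (\<lambda>k. (of_int \<bar>k\<bar> + 1) * disk_monomial (- k) w) n z * F w)"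
    define b where "b = (\<lambda>n. 2 * (real (Suc n) * cmod z ^ n))"
    have b: "summable b"
      using z unfolding b_def by (intro summable_mult summable_Suc_power) auto
    have tsum: "t n = (\<lambda>w. \<Sum>k\<in>{int n, - int n}.
        ((of_int \<bar>k\<bar> + 1) * disk_monomial k z) * (F w * disk_monomial (- k) w))" for n
      unfolding t_def harmonic_term_def sum_distrib_right by (intro ext sum.cong) (auto simp: mult_ac)
    have int: "integrable dA (t n)" for n
      unfolding tsum
      by (intro Bochner_Integration.integrable_sum integrable_mult_right integrable_mult_monomial F)
    have bound: "cmod (t n w) \<le> b n * cmod (F w)" for n w
    proof -
      have cb: "coeff_bound 1 (\<lambda>k. (of_int \<bar>k\<bar> + 1) * disk_monomial (- k) w)"
        unfolding coeff_bound_def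
      proof
        fix k
        show "cmod ((of_int \<bar>k\<bar> + 1) * disk_monomial (- k) w) \<le> 1 * (of_int \<bar>k\<bar> + 1)"
          unfolding norm_mult norm_of_int_abs_plus_1 mult_1
          by (rule mult_left_le[OF norm_disk_monomial_le_1]) simp
      qed
      have "cmod (harmonic_term (\<lambda>k. (of_int \<bar>k\<bar> + 1) * disk_monomial (- k) w) n z) \<le>
          (\<Sum>k\<in>{int n, - int n}. cmod ((of_int \<bar>k\<bar> + 1) * disk_monomial (- k) w)) * cmod z ^ n"
        by (rule norm_harmonic_term_le[OF z])
      also have "\<dots> \<le> 2 * 1 * real (Suc n) * cmod z ^ n"
        by (intro mult_right_mono coeff_bound_sum[OF cb]) auto
      also have "\<dots> = b n"
        by (simp only: b_def mult_1_right mult.assoc)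
      finally have "cmod (harmonic_term (\<lambda>k. (of_int \<bar>k\<bar> + 1) * disk_monomial (- k) w) n z) \<le> b n" .
      then show ?thesis
        unfolding t_def norm_mult by (rule mult_right_mono) simp
    qed
    have intb: "(\<integral>w. cmod (t n w) \<partial>dA) \<le> b n * (\<integral>w. cmod (F w) \<partial>dA)" for n
    proof -
      have "(\<integral>w. cmod (t n w) \<partial>dA) \<le> (\<integral>w. b n * cmod (F w) \<partial>dA)"
        using int[of n] F by (intro integral_mono bound) auto
      then show ?thesis by simp
    qed
    have sm: "summable (\<lambda>n. \<integral>w. cmod (t n w) \<partial>dA)"
      by (rule summable_comparison_test'[OF summable_mult2[OF b, of "\<integral>w. cmod (F w) \<partial>dA"]])
         (simp add: intb)
    have sn: "summable (\<lambda>n. cmod (t n w))" for w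
      by (rule summable_comparison_test'[OF summable_mult2[OF b, of "cmod (F w)"]])
         (simp add: bound)
    have "Q F z = (\<integral>w. (\<Sum>n. t n w) \<partial>dA)"
      unfolding Q_def if_P[OF z]
    proof (rule Bochner_Integration.integral_cong)
      fix w assume "w \<in> space dA"
      then have "w \<in> unit_disk" by simp
      from sums_mult2[OF Bergman_kernel_sums[OF z this], of "F w"]
      show "(1 / (1 - z * cnj w)\<^sup>2 + 1 / (1 - cnj z * w)\<^sup>2 - 1) * F w = (\<Sum>n. t n w)"
        unfolding t_def by (rule sums_unique)
    qed simp
    also have "\<dots> = (\<Sum>n. \<integral>w. t n w \<partial>dA)"
      by (rule integral_suminf[OF int _ sm]) (simp add: sn)
    also have "(\<lambda>n. \<integral>w. t n w \<partial>dA) = (\<lambda>n. harmonic_term (harmonic_coeffs F) n z)"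
    proof
      fix n
      have "(\<integral>w. t n w \<partial>dA) = (\<Sum>k\<in>{int n, - int n}.
          ((of_int \<bar>k\<bar> + 1) * disk_monomial k z) * pairing F (disk_monomial (- k)))"
        unfolding tsum pairing_def
        by (subst Bochner_Integration.integral_sum)
           (intro integrable_mult_right integrable_mult_monomial F, simp only: integral_mult_right_zero)
      also have "\<dots> = harmonic_term (harmonic_coeffs F) n z"
        unfolding harmonic_term_def harmonic_coeffs_def by (intro sum.cong) auto
      finally show "(\<integral>w. t n w \<partial>dA) = harmonic_term (harmonic_coeffs F) n z" .
    qed
    finally show ?thesis
      by (simp add: harmonic_series_def)
  qed (simp add: Q_def harmonic_series_outside)
qed

lemma square_integrable_imp_integrable:
  assumes "square_integrable f"
  shows "integrable dA f"
proof -
  have "square_integrable (\<lambda>_. 1)"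
    by (simp add: square_integrable_def)
  from integrable_product[OF assms this] show ?thesis by simp
qed

text \<open>
  Symmetry of \<open>Q\<close> in the form that applies to integrable \<open>F\<close>: the coefficients of \<open>Q F\<close>
  are read off twice, from the kernel and from orthogonality.
\<close>

lemma pairing_Q_monomial:
  assumes F: "integrable dA F" and QF: "Q F \<in> Lh2"
  shows "pairing (Q F) (disk_monomial l) = pairing F (disk_monomial l)"
proof -
  have "integrable dA (harmonic_series (harmonic_coeffs F))"
    using square_integrable_imp_integrable[OF Lh2_square_integrable[OF QF]]
    by (simp add: Q_eq_harmonic_series[OF F])
  then have "pairing (Q F) (disk_monomial l) = harmonic_coeffs F (- l) / (of_int \<bar>l\<bar> + 1)"
    unfolding Q_eq_harmonic_series[OF F]
    by (intro pairing_harmonic_series_monomial coeff_bound_convergent[OF coeff_bound_harmonic_coeffs[OF F]])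
  also have "\<dots> = pairing F (disk_monomial l)"
    unfolding harmonic_coeffs_def abs_minus_cancel minus_minus
    by (rule nonzero_mult_div_cancel_left[OF of_int_abs_plus_1_neq_0])
  finally show ?thesis .
qed

text \<open>
  The reproducing property of the kernel, as by \<open>Q_eq_harmonic_series\<close> the right-hand side is \<open>Q h\<close>.
\<close>

lemma Lh2_eq_harmonic_series:
  assumes h: "h \<in> Lh2"
  shows "h = harmonic_series (harmonic_coeffs h)"
proof -
  obtain c where c: "convergent_coeffs c" "h = harmonic_series c"
    using harmonic_on_expansion[of h] h by (auto simp: Lh2_def)
  have "harmonic_coeffs h k = c k" for k
  proof -
    have "pairing h (disk_monomial (- k)) = c k / (of_int \<bar>k\<bar> + 1)"
      using pairing_harmonic_series_monomial[OF c(1), of "- k"] c(2)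
        square_integrable_imp_integrable[OF Lh2_square_integrable[OF h]] by simp
    then show ?thesis
      unfolding harmonic_coeffs_def
      by (simp only: times_divide_eq_right nonzero_mult_div_cancel_left[OF of_int_abs_plus_1_neq_0])
  qed
  then have "harmonic_coeffs h = c" by (rule ext)
  with c(2) show ?thesis by (simp only:)
qed

section \<open>Density of the harmonic polynomials\<close>

abbreviation harmonic_trig_polys :: "(complex \<Rightarrow> complex) set" where
  "harmonic_trig_polys \<equiv> cfun.span (range disk_monomial)"

lemma harmonic_trig_polys_subset: "harmonic_trig_polys \<subseteq> harmonic_polys"
  by (intro cfun.span_minimal subspace_harmonic_polys) (auto intro: disk_monomial_in_harmonic_polys)

lemma coeff_bound_Lh2:
  assumes "h \<in> Lh2"
  shows "coeff_bound (L2_norm h) (harmonic_coeffs h)"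
proof (rule coeff_boundI_pairing)
  fix k
  have "cmod (pairing h (disk_monomial k)) \<le> L2_norm h * L2_norm (disk_monomial k)"
    by (intro norm_pairing_le Lh2_square_integrable assms disk_monomial_in_Lh2)
  also have "\<dots> \<le> L2_norm h"
    by (intro mult_left_le L2_norm_disk_monomial_le_1 L2_norm_nonneg)
  finally show "cmod (pairing h (disk_monomial k)) \<le> L2_norm h" .
qed

lemma Lh2_eqI:
  assumes "g \<in> Lh2" "h \<in> Lh2" "\<And>k. pairing g (disk_monomial k) = pairing h (disk_monomial k)"
  shows "g = h"
proof -
  have "harmonic_coeffs g = harmonic_coeffs h"
    by (intro ext) (simp only: harmonic_coeffs_def assms(3))
  then show ?thesis
    using Lh2_eq_harmonic_series[OF assms(1)] Lh2_eq_harmonic_series[OF assms(2)] by metis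
qed

lemma zero_square_integrable: "square_integrable 0"
  by (rule Lh2_square_integrable[OF zero_in_Lh2])

lemma pairing_zero_left: "pairing 0 g = 0"
  by (simp add: pairing_def)

lemma Lh2_norm_zero_imp:
  assumes "h \<in> Lh2" "L2_norm h = 0"
  shows "h = 0"
proof (rule Lh2_eqI[OF assms(1) zero_in_Lh2])
  fix k
  have "cmod (pairing h (disk_monomial k)) \<le> L2_norm h * L2_norm (disk_monomial k)"
    by (intro norm_pairing_le Lh2_square_integrable assms disk_monomial_in_Lh2)
  then show "pairing h (disk_monomial k) = pairing 0 (disk_monomial k)"
    using assms(2) by (simp add: pairing_zero_left)
qed

text \<open>
  An element of \<open>Lh2\<close> is determined by its pairings with the monomials, since these are its coefficients.
\<close>

lemma pairing_nondegenerate: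
  assumes h: "h \<in> Lh2" and zero: "\<And>g. g \<in> Lh2 \<Longrightarrow> pairing g h = 0"
  shows "h = 0"
proof (rule Lh2_eqI[OF h zero_in_Lh2])
  fix k
  show "pairing h (disk_monomial k) = pairing 0 (disk_monomial k)"
    using zero[OF disk_monomial_in_Lh2, of k] by (simp add: pairing_commute pairing_zero_left)
qed

definition partial_sum :: "(int \<Rightarrow> complex) \<Rightarrow> nat \<Rightarrow> complex \<Rightarrow> complex" where
  "partial_sum c N = (\<Sum>n<N. \<Sum>k\<in>{int n, - int n}. cscale (c k) (disk_monomial k))"

lemma sum_fun_apply: "(\<Sum>i\<in>I. f i) x = (\<Sum>i\<in>I. f i x)" for f :: "'i \<Rightarrow> 'a \<Rightarrow> complex"
  by (induction I rule: infinite_finite_induct) auto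

lemma partial_sum_apply: "partial_sum c N z = (\<Sum>n<N. harmonic_term c n z)"
  unfolding partial_sum_def harmonic_term_def sum_fun_apply cscale_def by (rule refl)

lemma partial_sum_in_span: "partial_sum c N \<in> harmonic_trig_polys"
  unfolding partial_sum_def
  by (intro cfun.span_sum cfun.span_scale cfun.span_base rangeI)

lemma partial_sum_in_Lh2: "partial_sum c N \<in> Lh2"
  using partial_sum_in_span harmonic_trig_polys_subset harmonic_polys_Lh2 by blast

lemma pairing_sum_left:
  assumes "finite I" "\<And>i. i \<in> I \<Longrightarrow> square_integrable (f i)" "square_integrable g"
  shows "square_integrable (\<Sum>i\<in>I. f i) \<and> pairing (\<Sum>i\<in>I. f i) g = (\<Sum>i\<in>I. pairing (f i) g)"
  using assms
proof (induction I)
  case empty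
  then show ?case
    using zero_square_integrable pairing_zero_left[of g] by (simp add: zero_fun_def)
next
  case (insert i I)
  then have "square_integrable (f i)" "square_integrable (\<Sum>i\<in>I. f i)"
    by auto
  moreover have "sum f (insert i I) = f i + sum f I"
    by (rule sum.insert[OF insert.hyps])
  moreover have "(\<Sum>j\<in>insert i I. pairing (f j) g) = pairing (f i) g + (\<Sum>j\<in>I. pairing (f j) g)"
    by (rule sum.insert[OF insert.hyps])
  ultimately show ?case
    using square_integrable_add[of "f i" "sum f I"] pairing_add_left[of "f i" "sum f I" g] insert
    by (simp only: insert_iff simp_thms)
qed

lemma pairing_partial_sum:
  "pairing (partial_sum c N) g = (\<Sum>n<N. \<Sum>k\<in>{int n, - int n}. c k * pairing (disk_monomial k) g)"
  if g: "square_integrable g"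
proof -
  have m: "square_integrable (cscale (c k) (disk_monomial k))" for k
    by (intro square_integrable_cscale Lh2_square_integrable disk_monomial_in_Lh2)
  have inner: "square_integrable (\<Sum>k\<in>{int n, - int n}. cscale (c k) (disk_monomial k)) \<and>
      pairing (\<Sum>k\<in>{int n, - int n}. cscale (c k) (disk_monomial k)) g =
      (\<Sum>k\<in>{int n, - int n}. pairing (cscale (c k) (disk_monomial k)) g)" for n
    by (rule pairing_sum_left) (use m g in auto)
  have "pairing (partial_sum c N) g =
      (\<Sum>n<N. pairing (\<Sum>k\<in>{int n, - int n}. cscale (c k) (disk_monomial k)) g)"
    unfolding partial_sum_def using inner g by (intro pairing_sum_left[THEN conjunct2]) auto
  then show ?thesis
    using inner by (simp only: pairing_cscale_left)
qed

lemma cnj_partial_sum: "(\<lambda>z. cnj (partial_sum c N z)) = partial_sum (\<lambda>k. cnj (c (- k))) N"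
proof
  fix z
  have "(\<Sum>k\<in>{int n, - int n}. cnj (c k) * disk_monomial (- k) z) =
      (\<Sum>k\<in>{int n, - int n}. cnj (c (- k)) * disk_monomial k z)" for n
    by (rule sum.reindex_bij_witness[of _ uminus uminus]) auto
  then show "cnj (partial_sum c N z) = partial_sum (\<lambda>k. cnj (c (- k))) N z"
    by (simp only: partial_sum_apply harmonic_term_def cnj_sum complex_cnj_mult cnj_disk_monomial)
qed

lemma pairing_monomial_partial_sum:
  assumes "\<bar>l\<bar> < int N"
  shows "pairing (partial_sum c N) (disk_monomial l) = c (- l) / (of_int \<bar>l\<bar> + 1)"
proof -
  have "pairing (partial_sum c N) (disk_monomial l) =
      (\<Sum>n<N. \<Sum>k\<in>{int n, - int n}. if k = - l then c (- l) / (of_int \<bar>l\<bar> + 1) else 0)"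
    unfolding pairing_partial_sum[OF Lh2_square_integrable[OF disk_monomial_in_Lh2]]
  proof (intro sum.cong refl)
    fix k
    show "c k * pairing (disk_monomial k) (disk_monomial l) =
        (if k = - l then c (- l) / (of_int \<bar>l\<bar> + 1) else 0)"
    proof (cases "k = - l")
      case False
      then have "k + l \<noteq> 0" by linarith
      with False show ?thesis
        unfolding pairing_disk_monomial by (simp only: if_False mult_zero_right)
    qed (simp add: pairing_disk_monomial)
  qed
  also have "\<dots> = (\<Sum>n<N. if n = nat \<bar>l\<bar> then c (- l) / (of_int \<bar>l\<bar> + 1) else 0)"
  proof (intro sum.cong refl)
    fix n
    have "- l \<in> {int n, - int n} \<longleftrightarrow> n = nat \<bar>l\<bar>" by auto
    then show "(\<Sum>k\<in>{int n, - int n}. if k = - l then c (- l) / (of_int \<bar>l\<bar> + 1) else 0) =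
        (if n = nat \<bar>l\<bar> then c (- l) / (of_int \<bar>l\<bar> + 1) else 0)"
      by (simp only: sum.delta finite.intros)
  qed
  also have "\<dots> = c (- l) / (of_int \<bar>l\<bar> + 1)"
    using assms by (subst sum.delta) auto
  finally show ?thesis .
qed

text \<open>
  The difference \<open>h - s\<close> has vanishing coefficients below degree \<open>N\<close>, and the conjugate of \<open>s\<close> is
  again a combination of monomials of these degrees. So \<open>h - s\<close> and \<open>s\<close> are orthogonal.
\<close>

lemma L2_norm_partial_sum_Pythagoras:
  fixes N :: nat
  assumes h: "h \<in> Lh2"
  defines "s \<equiv> partial_sum (harmonic_coeffs h) N"
  shows "(L2_norm h)\<^sup>2 = (L2_norm s)\<^sup>2 + (L2_norm (h - s))\<^sup>2"
proof -
  define d where "d = h - s"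
  have s: "s \<in> Lh2" unfolding s_def by (rule partial_sum_in_Lh2)
  have sq: "square_integrable s" "square_integrable d" "square_integrable h"
    using h s by (auto simp: d_def intro: Lh2_square_integrable Lh2_diff)
  have dk: "pairing (disk_monomial k) d = 0" if "\<bar>k\<bar> < int N" for k
  proof -
    have "pairing s (disk_monomial k) = harmonic_coeffs h (- k) / (of_int \<bar>k\<bar> + 1)"
      unfolding s_def by (rule pairing_monomial_partial_sum[OF that])
    also have "\<dots> = pairing h (disk_monomial k)"
      unfolding harmonic_coeffs_def abs_minus_cancel minus_minus
      by (rule nonzero_mult_div_cancel_left[OF of_int_abs_plus_1_neq_0])
    finally show ?thesis
      unfolding d_def pairing_commute[of _ "h - s"]
      by (simp add: pairing_diff_left[OF sq(3,1) Lh2_square_integrable[OF disk_monomial_in_Lh2]])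
  qed
  have cs: "square_integrable (\<lambda>z. cnj (s z))"
    unfolding s_def cnj_partial_sum by (rule Lh2_square_integrable[OF partial_sum_in_Lh2])
  have "pairing (\<lambda>z. cnj (s z)) d = 0"
    unfolding s_def cnj_partial_sum pairing_partial_sum[OF sq(2)]
    by (intro sum.neutral ballI) (auto simp: dk)
  then have orth: "(\<integral>z. cnj (s z) * d z \<partial>dA) = 0"
    by (simp add: pairing_def)
  have "(\<integral>z. Re (cnj (s z) * d z) \<partial>dA) = Re (\<integral>z. cnj (s z) * d z \<partial>dA)"
    by (rule integral_Re[OF integrable_product[OF cs sq(2)]])
  then have orth': "(\<integral>z. Re (cnj (s z) * d z) \<partial>dA) = 0"
    using orth by simp
  have "(cmod (h z))\<^sup>2 = (cmod (s z))\<^sup>2 + (cmod (d z))\<^sup>2 + 2 * Re (cnj (s z) * d z)" for z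
  proof -
    have "h z = s z + d z" by (simp add: d_def)
    then show ?thesis
      unfolding cmod_power2 by (simp add: power2_eq_square algebra_simps)
  qed
  then have "(L2_norm h)\<^sup>2 =
      (\<integral>z. (cmod (s z))\<^sup>2 + (cmod (d z))\<^sup>2 + 2 * Re (cnj (s z) * d z) \<partial>dA)"
    unfolding L2_norm_power2 by presburger
  also have "\<dots> = (L2_norm s)\<^sup>2 + (L2_norm d)\<^sup>2 + 2 * (\<integral>z. Re (cnj (s z) * d z) \<partial>dA)"
    unfolding L2_norm_power2
    using sq(1,2) integrable_Re[OF integrable_product[OF cs sq(2)]]
    by (simp add: square_integrable_def del: times_complex.sel)
  finally show ?thesis
    using orth' by (simp add: d_def)
qed

text \<open>
  The partial sums \<open>s N\<close> converge to \<open>h\<close> pointwise. If they stayed away from \<open>h\<close> in norm, then by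
  Pythagoras their norms would stay below that of \<open>h\<close> by a fixed amount, and Fatou's lemma would give
  the norm of \<open>h\<close> a value smaller than itself.
\<close>

lemma harmonic_trig_polys_dense:
  assumes h: "h \<in> Lh2" and e: "0 < e"
  shows "\<exists>p\<in>harmonic_trig_polys. L2_norm p \<le> L2_norm h \<and> L2_norm (h - p) < e"
proof (rule ccontr)
  define s where "s = partial_sum (harmonic_coeffs h)"
  assume no: "\<not> ?thesis"
  have Pyth: "(L2_norm h)\<^sup>2 = (L2_norm (s N))\<^sup>2 + (L2_norm (h - s N))\<^sup>2" for N
    unfolding s_def by (rule L2_norm_partial_sum_Pythagoras[OF h])
  have le: "L2_norm (s N) \<le> L2_norm h" for N
  proof (rule power2_le_imp_le[OF _ L2_norm_nonneg])
    show "(L2_norm (s N))\<^sup>2 \<le> (L2_norm h)\<^sup>2"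
      unfolding Pyth[of N] by simp
  qed
  have "s N \<in> harmonic_trig_polys" for N
    unfolding s_def by (rule partial_sum_in_span)
  then have far: "e \<le> L2_norm (h - s N)" for N
    using no le[of N] by force
  have C: "(L2_norm (s N))\<^sup>2 \<le> (L2_norm h)\<^sup>2 - e\<^sup>2" for N
    using Pyth[of N] power_mono[OF far[of N], of 2] e by simp
  define C where "C = sqrt ((L2_norm h)\<^sup>2 - e\<^sup>2)"
  have "L2_norm h \<le> C"
  proof (rule square_integrable_Fatou(2))
    show "square_integrable (s N)" for N
      unfolding s_def by (rule Lh2_square_integrable[OF partial_sum_in_Lh2])
    show "L2_norm (s N) \<le> C" for N
      unfolding C_def using C[of N] by (rule real_le_rsqrt)
    fix z
    have "(\<lambda>N. s N z) \<longlonglongrightarrow> harmonic_series (harmonic_coeffs h) z"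
      using harmonic_series_sums[OF coeff_bound_convergent[OF coeff_bound_Lh2[OF h]], of z]
      unfolding s_def partial_sum_apply sums_def .
    then show "(\<lambda>N. s N z) \<longlonglongrightarrow> h z"
      by (simp only: Lh2_eq_harmonic_series[OF h, symmetric])
  qed
  then have "(L2_norm h)\<^sup>2 \<le> C\<^sup>2"
    by (intro power_mono L2_norm_nonneg)
  moreover have "C\<^sup>2 = (L2_norm h)\<^sup>2 - e\<^sup>2"
    using C[of 0] zero_le_power2[of "L2_norm (s 0)"] unfolding C_def by (intro real_sqrt_pow2) linarith
  ultimately show False
    using e by simp
qed

section \<open>Toeplitz operators and their symmetry\<close>

lemma eq_0_if_norm_le_multiples:
  assumes "0 \<le> (M::real)" "\<And>e. 0 < e \<Longrightarrow> cmod x \<le> M * e"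
  shows "x = 0"
proof (rule ccontr)
  assume "x \<noteq> 0"
  (* The summand 1 keeps the denominator positive when M = 0. *)
  define e where "e = cmod x / (2 * (M + 1))"
  have "0 < e" using \<open>x \<noteq> 0\<close> assms(1) by (simp add: e_def)
  have "cmod x \<le> M * e" by (rule assms(2)[OF \<open>0 < e\<close>])
  also have "\<dots> < (M + 1) * e" using \<open>0 < e\<close> by simp
  also have "\<dots> = cmod x / 2" using assms(1) by (simp add: e_def field_simps)
  finally show False using \<open>x \<noteq> 0\<close> by simp
qed

lemma pairing_zero_right: "pairing g 0 = 0"
  by (simp add: pairing_def)

lemma harmonic_coeffs_add:
  assumes "integrable dA F" "integrable dA G"
  shows "harmonic_coeffs (\<lambda>w. F w + G w) = (\<lambda>k. harmonic_coeffs F k + harmonic_coeffs G k)"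
  by (rule ext)
     (simp add: harmonic_coeffs_def pairing_def distrib_right distrib_left integrable_mult_monomial assms)

lemma Q_add:
  assumes "integrable dA F" "integrable dA G"
  shows "Q (\<lambda>w. F w + G w) = Q F + Q G"
proof -
  have "integrable dA (\<lambda>w. F w + G w)" using assms by simp
  then show ?thesis
    by (intro ext)
       (simp add: Q_eq_harmonic_series assms harmonic_coeffs_add harmonic_series_add
        coeff_bound_convergent[OF coeff_bound_harmonic_coeffs])
qed

lemma Q_scale: "Q (\<lambda>w. c * F w) = cscale c (Q F)"
proof
  fix z
  have "(\<integral>w. (1 / (1 - z * cnj w)\<^sup>2 + 1 / (1 - cnj z * w)\<^sup>2 - 1) * (c * F w) \<partial>dA) =
      (\<integral>w. c * ((1 / (1 - z * cnj w)\<^sup>2 + 1 / (1 - cnj z * w)\<^sup>2 - 1) * F w) \<partial>dA)"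
    by (simp only: mult.left_commute)
  then show "Q (\<lambda>w. c * F w) z = cscale c (Q F) z"
    by (simp add: Q_def cscale_def)
qed

text \<open>
  A T-function together with a bound that is known to be nonnegative.
\<close>

locale T_symbol =
  fixes u :: "complex \<Rightarrow> complex" and C :: real
  assumes integrable_symbol: "integrable dA u"
    and C_nonneg: "0 \<le> C"
    and Q_in_Lh2: "p \<in> harmonic_polys \<Longrightarrow> Q (\<lambda>w. u w * p w) \<in> Lh2"
    and Q_norm_le: "p \<in> harmonic_polys \<Longrightarrow> L2_norm (Q (\<lambda>w. u w * p w)) \<le> C * L2_norm p"
begin

definition poly_toeplitz :: "(complex \<Rightarrow> complex) \<Rightarrow> complex \<Rightarrow> complex" where
  "poly_toeplitz p = Q (\<lambda>w. u w * p w)"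

lemma poly_toeplitz_in_Lh2: "p \<in> harmonic_polys \<Longrightarrow> poly_toeplitz p \<in> Lh2"
  by (simp add: poly_toeplitz_def Q_in_Lh2)

lemma poly_toeplitz_norm_le: "p \<in> harmonic_polys \<Longrightarrow> L2_norm (poly_toeplitz p) \<le> C * L2_norm p"
  by (simp add: poly_toeplitz_def Q_norm_le)

lemma poly_toeplitz_add:
  assumes "p \<in> harmonic_polys" "q \<in> harmonic_polys"
  shows "poly_toeplitz (p + q) = poly_toeplitz p + poly_toeplitz q"
proof -
  have "(\<lambda>w. u w * (p + q) w) = (\<lambda>w. u w * p w + u w * q w)"
    by (simp add: distrib_left)
  then show ?thesis
    unfolding poly_toeplitz_def
    by (simp add: Q_add integrable_mult_harmonic_poly integrable_symbol assms)
qed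

lemma poly_toeplitz_cscale: "poly_toeplitz (cscale c p) = cscale c (poly_toeplitz p)"
  unfolding poly_toeplitz_def using Q_scale[of c "\<lambda>w. u w * p w"] by (simp add: cscale_def mult.left_commute)

lemma pairing_poly_toeplitz_monomial:
  assumes "p \<in> harmonic_polys"
  shows "pairing (poly_toeplitz p) (disk_monomial k) = (\<integral>w. u w * p w * disk_monomial k w \<partial>dA)"
  unfolding poly_toeplitz_def
  using pairing_Q_monomial[OF integrable_mult_harmonic_poly[OF integrable_symbol assms] Q_in_Lh2[OF assms]]
  by (simp add: pairing_def)

lemmas sq_int = Lh2_square_integrable
lemmas monomial_poly = disk_monomial_in_harmonic_polys

text \<open>
  For monomials both sides are the integral of \<open>u\<close> times the product of the two monomials, by
  \<open>pairing_Q_monomial\<close>; the general case follows by linearity.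
\<close>

lemma poly_toeplitz_symmetric_trig:
  assumes "p \<in> harmonic_trig_polys"
  shows "pairing (poly_toeplitz p) (disk_monomial k) = pairing p (poly_toeplitz (disk_monomial k))"
proof -
  have "p \<in> harmonic_polys \<and> pairing (poly_toeplitz p) (disk_monomial k) = pairing p (poly_toeplitz (disk_monomial k))"
    using assms
  proof (induction rule: cfun.span_induct_alt)
    case base
    have "poly_toeplitz 0 = 0"
      unfolding poly_toeplitz_def Q_def by (simp add: fun_eq_iff)
    moreover have "0 \<in> harmonic_polys"
      using subspace_harmonic_polys by (rule cfun.subspace_0)
    ultimately show ?case
      by (simp only: pairing_zero_left simp_thms)
  next
    case (step c x y)
    then obtain j where x: "x = disk_monomial j" by blast
    have xh: "cscale c x \<in> harmonic_polys"
      unfolding x by (rule cfun.subspace_scale[OF subspace_harmonic_polys monomial_poly])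
    have y: "y \<in> harmonic_polys" "pairing (poly_toeplitz y) (disk_monomial k) = pairing y (poly_toeplitz (disk_monomial k))"
      using step by auto
    have mk: "poly_toeplitz (disk_monomial k) \<in> Lh2" by (rule poly_toeplitz_in_Lh2[OF monomial_poly])
    have "pairing (poly_toeplitz x) (disk_monomial k) = pairing x (poly_toeplitz (disk_monomial k))"
      unfolding x pairing_commute[of "disk_monomial j"] pairing_poly_toeplitz_monomial[OF monomial_poly]
      by (simp only: mult.assoc mult.commute mult.left_commute)
    then have "pairing (poly_toeplitz (cscale c x)) (disk_monomial k) = pairing (cscale c x) (poly_toeplitz (disk_monomial k))"
      by (simp add: poly_toeplitz_cscale pairing_cscale_left)
    then have "pairing (poly_toeplitz (cscale c x + y)) (disk_monomial k) = pairing (cscale c x + y) (poly_toeplitz (disk_monomial k))"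
      unfolding poly_toeplitz_add[OF xh y(1)]
      using y(2) pairing_add_left[OF sq_int[OF poly_toeplitz_in_Lh2[OF xh]] sq_int[OF poly_toeplitz_in_Lh2[OF y(1)]]
            sq_int[OF harmonic_polys_Lh2[OF monomial_poly]], of k]
          pairing_add_left[OF sq_int[OF harmonic_polys_Lh2[OF xh]] sq_int[OF harmonic_polys_Lh2[OF y(1)]]
            sq_int[OF mk]]
      by simp
    moreover have "cscale c x + y \<in> harmonic_polys"
      by (rule cfun.subspace_add[OF subspace_harmonic_polys xh y(1)])
    ultimately show ?case by blast
  qed
  then show ?thesis ..
qed

text \<open>
  A harmonic polynomial \<open>p\<close> is given as a polynomial in the real coordinates; combinations \<open>s\<close> of
  monomials approximate it in norm, and both sides of the identity are continuous in \<open>p\<close> by the bound on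
  \<open>poly_toeplitz\<close>.
\<close>

lemma poly_toeplitz_symmetric_monomial:
  assumes p: "p \<in> harmonic_polys"
  shows "pairing (poly_toeplitz p) (disk_monomial k) = pairing p (poly_toeplitz (disk_monomial k))"
proof -
  have pL: "p \<in> Lh2" by (rule harmonic_polys_Lh2[OF p])
  have "pairing (poly_toeplitz p) (disk_monomial k) - pairing p (poly_toeplitz (disk_monomial k)) = 0"
  proof (rule eq_0_if_norm_le_multiples)
    show "0 \<le> C + L2_norm (poly_toeplitz (disk_monomial k))"
      using C_nonneg L2_norm_nonneg by (rule add_nonneg_nonneg)
    fix e :: real assume "0 < e"
    then obtain s where s: "s \<in> harmonic_trig_polys" "L2_norm (p - s) < e"
      using harmonic_trig_polys_dense[OF pL] by blast
    have sh: "s \<in> harmonic_polys" using s(1) harmonic_trig_polys_subset by blast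
    have d: "p - s \<in> harmonic_polys"
      by (rule cfun.subspace_diff[OF subspace_harmonic_polys p sh])
    have "poly_toeplitz p = poly_toeplitz ((p - s) + s)" by simp
    also have "\<dots> = poly_toeplitz (p - s) + poly_toeplitz s" by (rule poly_toeplitz_add[OF d sh])
    finally have split_p: "poly_toeplitz p = poly_toeplitz (p - s) + poly_toeplitz s" .
    have 1: "pairing (poly_toeplitz p) (disk_monomial k) = pairing (poly_toeplitz (p - s)) (disk_monomial k) +
        pairing s (poly_toeplitz (disk_monomial k))"
      unfolding split_p poly_toeplitz_symmetric_trig[OF s(1), symmetric]
      by (intro pairing_add_left sq_int poly_toeplitz_in_Lh2 d sh disk_monomial_in_Lh2)
    have 2: "pairing (p - s) (poly_toeplitz (disk_monomial k)) =
        pairing p (poly_toeplitz (disk_monomial k)) - pairing s (poly_toeplitz (disk_monomial k))"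
      by (intro pairing_diff_left sq_int poly_toeplitz_in_Lh2 pL harmonic_polys_Lh2 sh monomial_poly)
    have "cmod (pairing (poly_toeplitz (p - s)) (disk_monomial k)) \<le> L2_norm (poly_toeplitz (p - s)) * L2_norm (disk_monomial k)"
      by (intro norm_pairing_le sq_int poly_toeplitz_in_Lh2 d disk_monomial_in_Lh2)
    also have "\<dots> \<le> L2_norm (poly_toeplitz (p - s))"
      by (intro mult_left_le L2_norm_disk_monomial_le_1 L2_norm_nonneg)
    also have "\<dots> \<le> C * L2_norm (p - s)"
      by (rule poly_toeplitz_norm_le[OF d])
    also have "\<dots> \<le> C * e"
      using s(2) C_nonneg by (intro mult_left_mono) auto
    finally have 3: "cmod (pairing (poly_toeplitz (p - s)) (disk_monomial k)) \<le> C * e" .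
    have "cmod (pairing (p - s) (poly_toeplitz (disk_monomial k))) \<le> L2_norm (p - s) * L2_norm (poly_toeplitz (disk_monomial k))"
      by (intro norm_pairing_le sq_int poly_toeplitz_in_Lh2 harmonic_polys_Lh2 d monomial_poly)
    also have "\<dots> \<le> e * L2_norm (poly_toeplitz (disk_monomial k))"
      using s(2) by (intro mult_right_mono L2_norm_nonneg) auto
    finally have 4: "cmod (pairing (p - s) (poly_toeplitz (disk_monomial k))) \<le> e * L2_norm (poly_toeplitz (disk_monomial k))" .
    have "pairing (poly_toeplitz p) (disk_monomial k) - pairing p (poly_toeplitz (disk_monomial k)) =
        pairing (poly_toeplitz (p - s)) (disk_monomial k) - pairing (p - s) (poly_toeplitz (disk_monomial k))"
      unfolding 1 2 by simp
    then have "cmod (pairing (poly_toeplitz p) (disk_monomial k) - pairing p (poly_toeplitz (disk_monomial k))) \<le>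
        cmod (pairing (poly_toeplitz (p - s)) (disk_monomial k)) + cmod (pairing (p - s) (poly_toeplitz (disk_monomial k)))"
      by (simp only: norm_triangle_ineq4)
    also have "\<dots> \<le> C * e + e * L2_norm (poly_toeplitz (disk_monomial k))"
      using 3 4 by (rule add_mono)
    also have "\<dots> = (C + L2_norm (poly_toeplitz (disk_monomial k))) * e"
      by (simp add: algebra_simps)
    finally show "cmod (pairing (poly_toeplitz p) (disk_monomial k) - pairing p (poly_toeplitz (disk_monomial k))) \<le>
        (C + L2_norm (poly_toeplitz (disk_monomial k))) * e" .
  qed
  then show ?thesis by simp
qed

text \<open>
  If the extension \<open>T\<close> is to be symmetric, then the pairing of \<open>T h\<close> with a monomial must be the pairing
  of \<open>h\<close> with the image of the monomial. This prescribes all coefficients of \<open>T h\<close>.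
\<close>

definition ext_coeffs :: "(complex \<Rightarrow> complex) \<Rightarrow> int \<Rightarrow> complex" where
  "ext_coeffs h k = (of_int \<bar>k\<bar> + 1) * pairing h (poly_toeplitz (disk_monomial (- k)))"

definition ext_toeplitz :: "(complex \<Rightarrow> complex) \<Rightarrow> complex \<Rightarrow> complex" where
  "ext_toeplitz h = (if h \<in> Lh2 then harmonic_series (ext_coeffs h) else 0)"

lemma ext_toeplitz_eq_poly_toeplitz:
  assumes p: "p \<in> harmonic_polys"
  shows "ext_toeplitz p = poly_toeplitz p"
proof -
  have "ext_coeffs p = harmonic_coeffs (poly_toeplitz p)"
    by (rule ext) (simp only: ext_coeffs_def harmonic_coeffs_def poly_toeplitz_symmetric_monomial[OF p])
  then show ?thesis
    using Lh2_eq_harmonic_series[OF poly_toeplitz_in_Lh2[OF p]] harmonic_polys_Lh2[OF p] by (simp add: ext_toeplitz_def)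
qed

lemma coeff_bound_ext_coeffs:
  assumes h: "h \<in> Lh2"
  shows "coeff_bound (C * L2_norm h) (ext_coeffs h)"
  unfolding coeff_bound_def
proof
  fix k
  have "L2_norm (poly_toeplitz (disk_monomial (- k))) \<le> C * L2_norm (disk_monomial (- k))"
    by (rule poly_toeplitz_norm_le[OF monomial_poly])
  also have "\<dots> \<le> C"
    by (intro mult_left_le L2_norm_disk_monomial_le_1 C_nonneg)
  finally have norm_C: "L2_norm (poly_toeplitz (disk_monomial (- k))) \<le> C" .
  have "cmod (pairing h (poly_toeplitz (disk_monomial (- k)))) \<le> L2_norm h * L2_norm (poly_toeplitz (disk_monomial (- k)))"
    by (intro norm_pairing_le sq_int h poly_toeplitz_in_Lh2 monomial_poly)
  also have "\<dots> \<le> L2_norm h * C"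
    by (intro mult_left_mono norm_C L2_norm_nonneg)
  finally have "cmod (pairing h (poly_toeplitz (disk_monomial (- k)))) \<le> C * L2_norm h"
    by (simp only: mult.commute)
  then have "(real_of_int \<bar>k\<bar> + 1) * cmod (pairing h (poly_toeplitz (disk_monomial (- k)))) \<le>
      (real_of_int \<bar>k\<bar> + 1) * (C * L2_norm h)"
    by (intro mult_left_mono) auto
  then show "cmod (ext_coeffs h k) \<le> C * L2_norm h * (real_of_int \<bar>k\<bar> + 1)"
    unfolding ext_coeffs_def norm_mult norm_of_int_abs_plus_1 by (simp only: mult_ac)
qed

lemmas ext_convergent = coeff_bound_convergent[OF coeff_bound_ext_coeffs]

lemma ext_coeffs_add:
  assumes "g \<in> Lh2" "h \<in> Lh2"
  shows "ext_coeffs (g + h) = (\<lambda>k. ext_coeffs g k + ext_coeffs h k)"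
  unfolding ext_coeffs_def
  by (simp add: pairing_add_left sq_int assms poly_toeplitz_in_Lh2 monomial_poly distrib_left)

lemma ext_toeplitz_add:
  assumes "g \<in> Lh2" "h \<in> Lh2"
  shows "ext_toeplitz (g + h) = ext_toeplitz g + ext_toeplitz h"
proof
  fix z
  have "ext_toeplitz (g + h) z = harmonic_series (\<lambda>k. ext_coeffs g k + ext_coeffs h k) z"
    using Lh2_add[OF assms] by (simp add: ext_toeplitz_def ext_coeffs_add assms)
  also have "\<dots> = (ext_toeplitz g + ext_toeplitz h) z"
    using assms by (simp add: harmonic_series_add ext_convergent ext_toeplitz_def)
  finally show "ext_toeplitz (g + h) z = (ext_toeplitz g + ext_toeplitz h) z" .
qed

lemma ext_toeplitz_cscale:
  assumes "h \<in> Lh2"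
  shows "ext_toeplitz (cscale c h) = cscale c (ext_toeplitz h)"
proof
  fix z
  have "ext_coeffs (cscale c h) = (\<lambda>k. c * ext_coeffs h k)"
    by (rule ext) (simp only: ext_coeffs_def pairing_cscale_left mult.left_commute)
  then have "ext_toeplitz (cscale c h) z = harmonic_series (\<lambda>k. c * ext_coeffs h k) z"
    using Lh2_cscale[OF assms, of c] by (simp add: ext_toeplitz_def)
  also have "\<dots> = cscale c (ext_toeplitz h) z"
    using assms by (simp add: harmonic_series_scale ext_convergent ext_toeplitz_def cscale_def)
  finally show "ext_toeplitz (cscale c h) z = cscale c (ext_toeplitz h) z" .
qed

text \<open>
  Approximate \<open>h\<close> by \<open>p n\<close> with norms at most that of \<open>h\<close>. The coefficients of the images converge,
  hence the images converge pointwise, and Fatou's lemma carries the norm bound over to the limit.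
\<close>

lemma ext_toeplitz_norm_le_and_in_Lh2:
  assumes h: "h \<in> Lh2"
  shows "L2_norm (ext_toeplitz h) \<le> C * L2_norm h \<and> ext_toeplitz h \<in> Lh2"
proof -
  have "\<forall>n. \<exists>p. p \<in> harmonic_trig_polys \<and> L2_norm p \<le> L2_norm h \<and> L2_norm (h - p) < inverse (real (Suc n))"
  proof
    fix n
    show "\<exists>p. p \<in> harmonic_trig_polys \<and> L2_norm p \<le> L2_norm h \<and> L2_norm (h - p) < inverse (real (Suc n))"
      using harmonic_trig_polys_dense[OF h, of "inverse (real (Suc n))"] by (auto simp del: of_nat_Suc)
  qed
  from choice[OF this] obtain p where p: "\<And>n. p n \<in> harmonic_trig_polys" "\<And>n. L2_norm (p n) \<le> L2_norm h"
    "\<And>n. L2_norm (h - p n) < inverse (real (Suc n))"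
    by blast
  have ph: "p n \<in> harmonic_polys" for n
    using p(1) harmonic_trig_polys_subset by blast
  have pL: "p n \<in> Lh2" for n
    by (rule harmonic_polys_Lh2[OF ph])
  have dL: "h - p n \<in> Lh2" for n
    by (rule Lh2_diff[OF h pL])
  have sq_ext: "\<And>n. square_integrable (ext_toeplitz (p n))"
    unfolding ext_toeplitz_eq_poly_toeplitz[OF ph] by (rule sq_int[OF poly_toeplitz_in_Lh2[OF ph]])
  have lim: "(\<lambda>n. ext_toeplitz (p n) z) \<longlonglongrightarrow> ext_toeplitz h z" if z: "z \<in> unit_disk" for z
  proof -
    define K where "K = (\<Sum>n. 2 * (real (Suc n) * cmod z ^ n))"
    have K: "0 \<le> K"
      unfolding K_def using z by (intro suminf_nonneg summable_mult summable_Suc_power) auto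
    have close: "norm (ext_toeplitz (p n) z - ext_toeplitz h z) \<le> (C * K) * inverse (real (Suc n))" for n
    proof -
      have "ext_toeplitz h = ext_toeplitz (h - p n + p n)" by simp
      also have "\<dots> = ext_toeplitz (h - p n) + ext_toeplitz (p n)" by (rule ext_toeplitz_add[OF dL pL])
      finally have "ext_toeplitz (p n) z - ext_toeplitz h z = - ext_toeplitz (h - p n) z" by simp
      then have "norm (ext_toeplitz (p n) z - ext_toeplitz h z) = cmod (harmonic_series (ext_coeffs (h - p n)) z)"
        using dL by (simp add: ext_toeplitz_def)
      also have "\<dots> \<le> C * L2_norm (h - p n) * K"
        unfolding K_def by (rule norm_harmonic_series_le[OF coeff_bound_ext_coeffs[OF dL] z])
      also have "\<dots> \<le> C * inverse (real (Suc n)) * K"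
        using p(3)[of n] by (intro mult_right_mono mult_left_mono C_nonneg K) auto
      finally show ?thesis by (simp only: mult_ac)
    qed
    have "(\<lambda>n. (C * K) * inverse (real (Suc n))) \<longlonglongrightarrow> (C * K) * 0"
      by (intro tendsto_mult tendsto_const LIMSEQ_inverse_real_of_nat)
    then have "(\<lambda>n. ext_toeplitz (p n) z - ext_toeplitz h z) \<longlonglongrightarrow> 0"
      unfolding mult_zero_right
      by (rule Lim_null_comparison[OF always_eventually[OF allI[OF close]]])
    then show ?thesis by (rule LIM_zero_cancel)
  qed
  have bd: "L2_norm (ext_toeplitz (p n)) \<le> C * L2_norm h" for n
    unfolding ext_toeplitz_eq_poly_toeplitz[OF ph] by (rule order_trans[OF poly_toeplitz_norm_le[OF ph] mult_left_mono[OF p(2) C_nonneg]])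
  have "square_integrable (ext_toeplitz h)" "L2_norm (ext_toeplitz h) \<le> C * L2_norm h"
    using square_integrable_Fatou[where f = "\<lambda>n. ext_toeplitz (p n)", OF sq_ext lim bd] by auto
  moreover have "harmonic_on (ext_toeplitz h) unit_disk"
    using h by (simp add: ext_toeplitz_def harmonic_on_harmonic_series ext_convergent)
  moreover have "ext_toeplitz h z = 0" if "z \<notin> unit_disk" for z
    using h that by (simp add: ext_toeplitz_def harmonic_series_outside)
  ultimately show ?thesis
    by (simp add: Lh2_iff)
qed

lemmas ext_toeplitz_in_Lh2 = ext_toeplitz_norm_le_and_in_Lh2[THEN conjunct2]
lemmas ext_toeplitz_norm_le = ext_toeplitz_norm_le_and_in_Lh2[THEN conjunct1]

text \<open>
  This is how the coefficients of the extension were chosen.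
\<close>

lemma ext_toeplitz_symmetric_monomial:
  assumes h: "h \<in> Lh2"
  shows "pairing (ext_toeplitz h) (disk_monomial k) = pairing h (poly_toeplitz (disk_monomial k))"
proof -
  have ext_toeplitz: "ext_toeplitz h = harmonic_series (ext_coeffs h)" using h by (simp add: ext_toeplitz_def)
  have "integrable dA (harmonic_series (ext_coeffs h))"
    using square_integrable_imp_integrable[OF sq_int[OF ext_toeplitz_in_Lh2[OF h]]] by (simp only: ext_toeplitz)
  then have "pairing (ext_toeplitz h) (disk_monomial k) = ext_coeffs h (- k) / (of_int \<bar>k\<bar> + 1)"
    unfolding ext_toeplitz by (rule pairing_harmonic_series_monomial[OF ext_convergent[OF h]])
  then show ?thesis
    unfolding ext_coeffs_def abs_minus_cancel minus_minus
    by (simp only: nonzero_mult_div_cancel_left[OF of_int_abs_plus_1_neq_0])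
qed

lemma ext_toeplitz_symmetric_trig:
  assumes h: "h \<in> Lh2" and p: "p \<in> harmonic_trig_polys"
  shows "pairing (ext_toeplitz h) p = pairing h (ext_toeplitz p)"
proof -
  have "p \<in> Lh2 \<and> pairing (ext_toeplitz h) p = pairing h (ext_toeplitz p)"
    using p
  proof (induction rule: cfun.span_induct_alt)
    case base
    have "ext_toeplitz 0 = 0"
      using ext_toeplitz_cscale[OF zero_in_Lh2, of 0] by (simp add: cscale_def zero_fun_def)
    then show ?case
      by (simp only: zero_in_Lh2 pairing_zero_right simp_thms)
  next
    case (step c x y)
    then obtain j where x: "x = disk_monomial j" by blast
    have xL: "x \<in> Lh2" unfolding x by (rule disk_monomial_in_Lh2)
    have "pairing (ext_toeplitz h) x = pairing h (ext_toeplitz x)"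
      unfolding x by (simp only: ext_toeplitz_symmetric_monomial[OF h] ext_toeplitz_eq_poly_toeplitz[OF monomial_poly])
    moreover have yL: "y \<in> Lh2" and "pairing (ext_toeplitz h) y = pairing h (ext_toeplitz y)"
      using step by auto
    moreover have cxL: "cscale c x \<in> Lh2" by (rule Lh2_cscale[OF xL])
    moreover have "pairing (ext_toeplitz h) (cscale c x + y) = pairing (ext_toeplitz h) (cscale c x) + pairing (ext_toeplitz h) y"
      by (intro pairing_add_right sq_int ext_toeplitz_in_Lh2 h cxL yL)
    moreover have "pairing h (ext_toeplitz (cscale c x) + ext_toeplitz y) = pairing h (ext_toeplitz (cscale c x)) + pairing h (ext_toeplitz y)"
      by (intro pairing_add_right sq_int ext_toeplitz_in_Lh2 h cxL yL)
    ultimately show ?case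
      by (simp only: Lh2_add ext_toeplitz_add[OF cxL yL] ext_toeplitz_cscale[OF xL] pairing_cscale_right simp_thms)
  qed
  then show ?thesis ..
qed

text \<open>
  Both sides are continuous in \<open>g\<close>, and they agree on the dense subspace of combinations of monomials.
\<close>

lemma ext_toeplitz_symmetric:
  assumes h: "h \<in> Lh2" and g: "g \<in> Lh2"
  shows "pairing (ext_toeplitz h) g = pairing h (ext_toeplitz g)"
proof -
  have "pairing (ext_toeplitz h) g - pairing h (ext_toeplitz g) = 0"
  proof (rule eq_0_if_norm_le_multiples)
    show "0 \<le> 2 * C * L2_norm h"
      using C_nonneg L2_norm_nonneg by simp
    fix e :: real assume "0 < e"
    then obtain p where p: "p \<in> harmonic_trig_polys" "L2_norm (g - p) < e"
      using harmonic_trig_polys_dense[OF g] by blast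
    have pL: "p \<in> Lh2" using p(1) harmonic_trig_polys_subset harmonic_polys_Lh2 by blast
    have dL: "g - p \<in> Lh2" by (rule Lh2_diff[OF g pL])
    have "pairing (ext_toeplitz h) ((g - p) + p) = pairing (ext_toeplitz h) (g - p) + pairing (ext_toeplitz h) p"
      by (intro pairing_add_right sq_int ext_toeplitz_in_Lh2 h dL pL)
    moreover have "pairing h (ext_toeplitz ((g - p) + p)) = pairing h (ext_toeplitz (g - p)) + pairing h (ext_toeplitz p)"
      unfolding ext_toeplitz_add[OF dL pL] by (intro pairing_add_right sq_int ext_toeplitz_in_Lh2 h dL pL)
    ultimately have "pairing (ext_toeplitz h) g - pairing h (ext_toeplitz g) = pairing (ext_toeplitz h) (g - p) - pairing h (ext_toeplitz (g - p))"
      using ext_toeplitz_symmetric_trig[OF h p(1)] by simp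
    then have "cmod (pairing (ext_toeplitz h) g - pairing h (ext_toeplitz g)) \<le>
        cmod (pairing (ext_toeplitz h) (g - p)) + cmod (pairing h (ext_toeplitz (g - p)))"
      by (simp only: norm_triangle_ineq4)
    also have "\<dots> \<le> L2_norm (ext_toeplitz h) * L2_norm (g - p) + L2_norm h * L2_norm (ext_toeplitz (g - p))"
      by (intro add_mono norm_pairing_le sq_int ext_toeplitz_in_Lh2 h dL)
    also have "\<dots> \<le> (C * L2_norm h) * L2_norm (g - p) + L2_norm h * (C * L2_norm (g - p))"
      by (intro add_mono mult_right_mono mult_left_mono ext_toeplitz_norm_le h dL L2_norm_nonneg)
    also have "\<dots> = 2 * C * L2_norm h * L2_norm (g - p)"
      by simp
    also have "\<dots> \<le> 2 * C * L2_norm h * e"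
      using p(2) C_nonneg L2_norm_nonneg[of h] by (intro mult_left_mono) auto
    finally show "cmod (pairing (ext_toeplitz h) g - pairing h (ext_toeplitz g)) \<le> 2 * C * L2_norm h * e" .
  qed
  then show ?thesis by simp
qed

lemma bounded_op_ext_toeplitz: "bounded_op ext_toeplitz"
  unfolding bounded_op_def using ext_toeplitz_in_Lh2 ext_toeplitz_add ext_toeplitz_cscale ext_toeplitz_norm_le by blast

end

lemma bounded_opD:
  assumes "bounded_op A"
  shows "\<And>h. h \<in> Lh2 \<Longrightarrow> A h \<in> Lh2"
    and "\<And>g h. g \<in> Lh2 \<Longrightarrow> h \<in> Lh2 \<Longrightarrow> A (g + h) = A g + A h"
    and "\<And>c h. h \<in> Lh2 \<Longrightarrow> A (cscale c h) = cscale c (A h)"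
    and "\<exists>C. \<forall>h\<in>Lh2. L2_norm (A h) \<le> C * L2_norm h"
  using assms unfolding bounded_op_def by simp_all

lemma bounded_op_unique:
  assumes A: "bounded_op A" and B: "bounded_op B"
    and eq: "\<And>p. p \<in> harmonic_polys \<Longrightarrow> A p = B p" and h: "h \<in> Lh2"
  shows "A h = B h"
proof -
  obtain a b where a: "\<And>h. h \<in> Lh2 \<Longrightarrow> L2_norm (A h) \<le> a * L2_norm h"
    and b: "\<And>h. h \<in> Lh2 \<Longrightarrow> L2_norm (B h) \<le> b * L2_norm h"
    using bounded_opD(4)[OF A] bounded_opD(4)[OF B] by metis
  have AL: "\<And>h. h \<in> Lh2 \<Longrightarrow> A h \<in> Lh2" and BL: "\<And>h. h \<in> Lh2 \<Longrightarrow> B h \<in> Lh2"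
    and Aadd: "\<And>g h. g \<in> Lh2 \<Longrightarrow> h \<in> Lh2 \<Longrightarrow> A (g + h) = A g + A h"
    and Badd: "\<And>g h. g \<in> Lh2 \<Longrightarrow> h \<in> Lh2 \<Longrightarrow> B (g + h) = B g + B h"
    using bounded_opD(1,2)[OF A] bounded_opD(1,2)[OF B] by blast+
  have "L2_norm (A h - B h) \<le> (\<bar>a\<bar> + \<bar>b\<bar>) * e" if "0 < e" for e
  proof -
    obtain p where p: "p \<in> harmonic_trig_polys" "L2_norm (h - p) < e"
      using harmonic_trig_polys_dense[OF h \<open>0 < e\<close>] by blast
    have ph: "p \<in> harmonic_polys" using p(1) harmonic_trig_polys_subset by blast
    have pL: "p \<in> Lh2" by (rule harmonic_polys_Lh2[OF ph])
    have dL: "h - p \<in> Lh2" by (rule Lh2_diff[OF h pL])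
    have "A h - B h = A (h - p) + cscale (- 1) (B (h - p))"
      using Aadd[OF dL pL] Badd[OF dL pL] eq[OF ph] minus_eq_cscale[of "A (h - p)" "B (h - p)"]
      by simp
    then have "L2_norm (A h - B h) \<le> L2_norm (A (h - p)) + L2_norm (cscale (- 1) (B (h - p)))"
      using L2_norm_triangle[OF Lh2_square_integrable[OF AL[OF dL]]
          square_integrable_cscale[OF Lh2_square_integrable[OF BL[OF dL]]], of "- 1"] by simp
    also have "\<dots> = L2_norm (A (h - p)) + L2_norm (B (h - p))"
      by (simp only: L2_norm_cscale norm_minus_cancel norm_one mult_1)
    also have "\<dots> \<le> \<bar>a\<bar> * L2_norm (h - p) + \<bar>b\<bar> * L2_norm (h - p)"
      using a[OF dL] b[OF dL] mult_right_mono[OF abs_ge_self[of a] L2_norm_nonneg[of "h - p"]]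
        mult_right_mono[OF abs_ge_self[of b] L2_norm_nonneg[of "h - p"]] by linarith
    also have "\<dots> = (\<bar>a\<bar> + \<bar>b\<bar>) * L2_norm (h - p)"
      by (simp add: distrib_right)
    also have "\<dots> \<le> (\<bar>a\<bar> + \<bar>b\<bar>) * e"
      using p(2) by (intro mult_left_mono) auto
    finally show ?thesis .
  qed
  then have "complex_of_real (L2_norm (A h - B h)) = 0"
    by (intro eq_0_if_norm_le_multiples[of "\<bar>a\<bar> + \<bar>b\<bar>"]) (auto simp: L2_norm_nonneg)
  then have "A h - B h = 0"
    by (intro Lh2_norm_zero_imp Lh2_diff AL BL h) simp
  then show ?thesis by simp
qed

text \<open>
  The extension meets the requirements in the definition of \<open>toeplitz u\<close>, and by density it is the
  only operator that does. So \<open>toeplitz u\<close> inherits its symmetry.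
\<close>

lemma toeplitz_bounded_symmetric:
  assumes "T_function u"
  shows "bounded_op (toeplitz u)"
    and "\<And>g h. \<lbrakk>g \<in> Lh2; h \<in> Lh2\<rbrakk> \<Longrightarrow> pairing (toeplitz u g) h = pairing g (toeplitz u h)"
proof -
  obtain C where u: "integrable dA u"
    and C: "\<And>h. h \<in> harmonic_polys \<Longrightarrow> Q (\<lambda>w. u w * h w) \<in> Lh2"
      "\<And>h. h \<in> harmonic_polys \<Longrightarrow> L2_norm (Q (\<lambda>w. u w * h w)) \<le> C * L2_norm h"
    using assms unfolding T_function_def by blast
  interpret T_symbol u "\<bar>C\<bar>"
  proof
    fix p assume p: "p \<in> harmonic_polys"
    show "L2_norm (Q (\<lambda>w. u w * p w)) \<le> \<bar>C\<bar> * L2_norm p"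
      using C(2)[OF p] mult_right_mono[OF abs_ge_self[of C] L2_norm_nonneg[of p]] by linarith
  qed (use u C in auto)
  have "toeplitz u = ext_toeplitz"
    unfolding toeplitz_def
  proof (rule the_equality)
    show "bounded_op ext_toeplitz \<and> (\<forall>h\<in>harmonic_polys. ext_toeplitz h = Q (\<lambda>w. u w * h w)) \<and> (\<forall>h. h \<notin> Lh2 \<longrightarrow> ext_toeplitz h = 0)"
      using bounded_op_ext_toeplitz ext_toeplitz_eq_poly_toeplitz by (auto simp: poly_toeplitz_def ext_toeplitz_def)
  next
    fix A
    assume A: "bounded_op A \<and> (\<forall>h\<in>harmonic_polys. A h = Q (\<lambda>w. u w * h w)) \<and> (\<forall>h. h \<notin> Lh2 \<longrightarrow> A h = 0)"
    show "A = ext_toeplitz"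
    proof
      fix h
      show "A h = ext_toeplitz h"
      proof (cases "h \<in> Lh2")
        case True
        show ?thesis
          using A by (intro bounded_op_unique[OF _ bounded_op_ext_toeplitz _ True]) (auto simp: ext_toeplitz_eq_poly_toeplitz poly_toeplitz_def)
      next
        case False
        then show ?thesis using A by (simp add: ext_toeplitz_def)
      qed
    qed
  qed
  then show "bounded_op (toeplitz u)"
    and "\<And>g h. \<lbrakk>g \<in> Lh2; h \<in> Lh2\<rbrakk> \<Longrightarrow> pairing (toeplitz u g) h = pairing g (toeplitz u h)"
    using bounded_op_ext_toeplitz ext_toeplitz_symmetric by auto
qed

section \<open>Semicommutators and their transposes\<close>

text \<open>
  In the last part each Toeplitz operator is moved to the other side of the pairing; the one applied
  last moves first, which reverses the order of the product.
\<close>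

lemma gen_semicommutator_linear_transpose:
  assumes "T_function f" "T_function g" "T_function k"
  shows "h \<in> Lh2 \<Longrightarrow> gen_semicommutator f g k h \<in> Lh2"
    and "\<lbrakk>h \<in> Lh2; h' \<in> Lh2\<rbrakk> \<Longrightarrow>
      gen_semicommutator f g k (h + h') = gen_semicommutator f g k h + gen_semicommutator f g k h'"
    and "h \<in> Lh2 \<Longrightarrow> gen_semicommutator f g k (cscale c h) = cscale c (gen_semicommutator f g k h)"
    and "\<lbrakk>h \<in> Lh2; h' \<in> Lh2\<rbrakk> \<Longrightarrow>
      pairing (gen_semicommutator f g k h) h' = pairing h (gen_semicommutator g f k h')"
proof -
  have F: "bounded_op (toeplitz f)" "bounded_op (toeplitz g)" "bounded_op (toeplitz k)"
    using assms toeplitz_bounded_symmetric(1) by auto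
  note L = F[THEN bounded_opD(1)] and add = F[THEN bounded_opD(2)] and scal = F[THEN bounded_opD(3)]
  show "h \<in> Lh2 \<Longrightarrow> gen_semicommutator f g k h \<in> Lh2"
    unfolding gen_semicommutator_def by (intro Lh2_diff L)
  show "\<lbrakk>h \<in> Lh2; h' \<in> Lh2\<rbrakk> \<Longrightarrow>
      gen_semicommutator f g k (h + h') = gen_semicommutator f g k h + gen_semicommutator f g k h'"
    unfolding gen_semicommutator_def by (simp add: add L)
  show "h \<in> Lh2 \<Longrightarrow> gen_semicommutator f g k (cscale c h) = cscale c (gen_semicommutator f g k h)"
    unfolding gen_semicommutator_def
    by (simp add: scal L) (simp add: cscale_def fun_eq_iff right_diff_distrib)
  show "pairing (gen_semicommutator f g k h) h' = pairing h (gen_semicommutator g f k h')"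
    if "h \<in> Lh2" "h' \<in> Lh2"
    using that toeplitz_bounded_symmetric(2)[OF assms(1)] toeplitz_bounded_symmetric(2)[OF assms(2)]
      toeplitz_bounded_symmetric(2)[OF assms(3)]
    unfolding gen_semicommutator_def
    by (simp add: pairing_diff_left pairing_diff_right Lh2_square_integrable L)
qed

text \<open>
  The annihilator of \<open>k\<close> is closed because the pairing is continuous.
\<close>

lemma Lh2_closure_annihilator:
  assumes k: "k \<in> Lh2" and S: "S \<subseteq> Lh2" and zero: "\<And>g. g \<in> S \<Longrightarrow> pairing k g = 0"
    and g: "g \<in> Lh2_closure S"
  shows "pairing k g = 0"
proof (rule eq_0_if_norm_le_multiples[OF L2_norm_nonneg])
  fix e :: real assume "0 < e"
  then obtain s where s: "s \<in> S" "L2_norm (g - s) < e"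
    using g unfolding Lh2_closure_def by blast
  have gL: "g \<in> Lh2" using g by (simp add: Lh2_closure_def)
  have "pairing k g = pairing k (g - s)"
    using s(1) S k gL zero[OF s(1)] by (simp add: pairing_diff_right Lh2_square_integrable subset_iff)
  then have "cmod (pairing k g) \<le> L2_norm k * L2_norm (g - s)"
    using s(1) S k gL by (auto intro!: norm_pairing_le Lh2_square_integrable Lh2_diff)
  also have "\<dots> \<le> L2_norm k * e"
    using s(2) by (intro mult_left_mono L2_norm_nonneg) simp
  finally show "cmod (pairing k g) \<le> L2_norm k * e" .
qed

lemma subset_Lh2_closure: "S \<subseteq> Lh2 \<Longrightarrow> S \<subseteq> Lh2_closure S"
  unfolding Lh2_closure_def
proof (intro subsetI CollectI conjI allI impI)
  fix g and e :: real assume "g \<in> S" "0 < e"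
  have "L2_norm (g - g) < e"
    using \<open>0 < e\<close> by (simp add: L2_norm_def)
  with \<open>g \<in> S\<close> show "\<exists>h\<in>S. L2_norm (g - h) < e" by blast
qed auto

text \<open>
  The range of the transposed operator annihilates the kernel of \<open>gen_semicommutator f g k\<close>. The closure
  of the range does so as well, and \<open>rank_transpose_le\<close> bounds the dimension of this annihilator.
\<close>

lemma transpose_finite_rank:
  assumes T: "T_function f" "T_function g" "T_function k"
    and fin: "finite B" "gen_semicommutator f g k ` Lh2 \<subseteq> cfun.span B"
  shows "\<exists>C. finite C \<and> card C \<le> cfun.dim (gen_semicommutator f g k ` Lh2) \<and>
    Lh2_closure (gen_semicommutator g f k ` Lh2) \<subseteq> cfun.span C"
proof -
  define A where "A = gen_semicommutator f g k"
  define A' where "A' = gen_semicommutator g f k"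
  note A = gen_semicommutator_linear_transpose[OF T, folded A_def A'_def]
  have A'L: "A' ` Lh2 \<subseteq> Lh2"
    using gen_semicommutator_linear_transpose(1)[OF T(2,1,3)] by (auto simp: A'_def)
  have "\<exists>C. finite C \<and> card C \<le> cfun.dim (A ` Lh2) \<and>
      {h \<in> Lh2. \<forall>x\<in>Lh2. A x = 0 \<longrightarrow> pairing x h = 0} \<subseteq> cfun.span C"
  proof (rule cfun.rank_transpose_le[where \<beta> = pairing and B = B])
    show "z = 0" if "z \<in> Lh2" "\<And>x. x \<in> Lh2 \<Longrightarrow> pairing x z = 0" for z
      using that by (rule pairing_nondegenerate)
    show "cfun.subspace Lh2" by (rule subspace_Lh2)
    show "A ` Lh2 \<subseteq> cfun.span B" using fin(2) by (simp only: A_def)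
  qed (simp_all only: A fin(1) pairing_add_left pairing_add_right pairing_cscale_left
        pairing_cscale_right Lh2_square_integrable)
  then obtain C where C: "finite C" "card C \<le> cfun.dim (A ` Lh2)"
    "{h \<in> Lh2. \<forall>x\<in>Lh2. A x = 0 \<longrightarrow> pairing x h = 0} \<subseteq> cfun.span C"
    by blast
  have "pairing x h = 0" if h: "h \<in> Lh2_closure (A' ` Lh2)" and x: "x \<in> Lh2" "A x = 0" for h x
  proof (rule Lh2_closure_annihilator[OF x(1) A'L _ h])
    fix y assume "y \<in> A' ` Lh2"
    then obtain w where w: "w \<in> Lh2" "y = A' w" by blast
    then show "pairing x y = 0"
      using A(4)[OF x(1) w(1)] x(2) by (simp add: pairing_zero_left)
  qed
  then have "Lh2_closure (A' ` Lh2) \<subseteq> cfun.span C"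
    using C(3) by (auto simp: Lh2_closure_def)
  with C(1,2) show ?thesis
    unfolding A_def A'_def by blast
qed

theorem theorem2p2:
  fixes f\<^sub>1 f\<^sub>2 f :: "complex \<Rightarrow> complex" and N :: nat
  assumes "T_function f\<^sub>1" and "T_function f\<^sub>2" and "T_function f"
    and "has_finite_rank (gen_semicommutator f\<^sub>1 f\<^sub>2 f) N"
  shows "has_finite_rank (gen_semicommutator f\<^sub>2 f\<^sub>1 f) N"
proof -
  define A where "A = gen_semicommutator f\<^sub>1 f\<^sub>2 f"
  define A' where "A' = gen_semicommutator f\<^sub>2 f\<^sub>1 f"
  have AL: "A ` Lh2 \<subseteq> Lh2" "A' ` Lh2 \<subseteq> Lh2"
    using gen_semicommutator_linear_transpose(1)[OF assms(1,2,3)] gen_semicommutator_linear_transpose(1)[OF assms(2,1,3)]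
    unfolding A_def A'_def by blast+
  obtain B where B: "finite B" "Lh2_closure (A ` Lh2) \<subseteq> cfun.span B" and N: "cfun.dim (A ` Lh2) = N"
    using assms(4) unfolding has_finite_rank_def A_def by blast
  have "A ` Lh2 \<subseteq> cfun.span B"
    using subset_Lh2_closure[OF AL(1)] B(2) by blast
  then obtain C where C: "finite C" "card C \<le> N" "Lh2_closure (A' ` Lh2) \<subseteq> cfun.span C"
    using transpose_finite_rank[OF assms(1,2,3) B(1)] N unfolding A_def A'_def by blast
  have A'C: "A' ` Lh2 \<subseteq> cfun.span C"
    using subset_Lh2_closure[OF AL(2)] C(3) by blast
  have "cfun.dim (A' ` Lh2) \<le> N"
    using cfun.dim_le_card[OF A'C C(1)] C(2) by (rule order_trans)
  obtain E where E: "finite E" "card E \<le> cfun.dim (A' ` Lh2)"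
      "Lh2_closure (A ` Lh2) \<subseteq> cfun.span E"
    using transpose_finite_rank[OF assms(2,1,3) C(1)] A'C unfolding A_def A'_def by blast
  have "A ` Lh2 \<subseteq> cfun.span E"
    using subset_Lh2_closure[OF AL(1)] E(3) by blast
  then have "cfun.dim (A ` Lh2) \<le> card E"
    by (rule cfun.dim_le_card[OF _ E(1)])
  then have "N \<le> cfun.dim (A' ` Lh2)"
    using E(2) N by linarith
  with \<open>cfun.dim (A' ` Lh2) \<le> N\<close> have "cfun.dim (A' ` Lh2) = N"
    by (rule antisym)
  then show ?thesis
    unfolding has_finite_rank_def A'_def[symmetric] using C(1,3) by blast
qed

end
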